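(* Let $\varphi,\psi$ be two moment profiles with $r\le \psi(r)\le\varphi(r)$ for all $r>1$. Let $(p_n)_{n\ge1}$ be positive reals and $(v_n)_{n\ge 1}$ reals, and for $t\in\mathbb{C}$ let $$\mu_t=\sum_{n=1}^\infty\Big[\frac{p_n}{2}\,\delta_{S_{v_n-t}}+\frac{p_n}{2}\,\delta_{S_{-v_n-t}}\Big].$$ Assume: (i) $\sum_{n\ge1}p_n=1$ and $0<\limsup_{n\to\infty}\frac{p_{n-1}}{p_n}\le 1$; (ii) $v_n>0$ and $v_{n+1}-v_n>4$ for every $n\ge1$, and $\lim_{n\to\infty}v_n=\lim_{n\to\infty}(v_n-v_{n-1})=\infty$; (iii) $\sup_{|t|\le m}\int\psi(\log\|g\|)\,d\mu_t(g)<\infty$ for every $m>0$; (iv) $\lim_{n\to\infty}p_n\,\varphi(\log v_n)=\infty$. Then: (a) If $\varphi$ is an exponential moment profile ($\varphi(r)=e^{\alpha r}$ with $\alpha>0$) or a sub-exponential moment profile ($\varphi(r)=e^{r^\theta}$ with $0<\theta\le1$), then the Lyapunov exponent function $\mathbb{R}\ni E\mapsto L_1(\mu_E)$ does not have $\omega=\mathscr{T}_2(\varphi)$, $\omega(r)=\varphi(\log\frac1r)^{-2}$, as a local modulus of continuity. (b) If $\varphi(r)=r^p$ for some $p>1$, then the function $\mathbb{R}\ni E\mapsto L_1(\mu_E)$ is not locally $(2p-1)$-log-Hölder continuous.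
   Context: For $v\in\mathbb{C}$, $S_v=\begin{bmatrix} v&-1\\1&0\end{bmatrix}$. A moment profile is a continuous, strictly increasing function $\varphi:(1,+\infty)\to(0,+\infty)$ with $\lim_{r\to\infty}\varphi(r)=\infty$. Integrals $\int\varphi(\log\|g\|)\,d\mu(g)$ are over the $g$ with $\log\|g\|>1$; the remaining $g$ are irrelevant for finiteness. A modulus of continuity is a continuous, strictly increasing $\omega:[0,1)\to[0,\infty)$ with $\omega(0)=0$ (only values near $0$ matter). For $\beta>0$, $\mathscr{T}_\beta(\varphi)$ is the modulus $\omega(r)=\varphi(\log\frac1r)^{-\beta}$ for small $r>0$, $\omega(0)=0$. A function $f:X\to\mathbb{R}$ on a metric space $(X,d)$ has local modulus of continuity $\omega$ if for every $a\in X$ there are $r>0$ and $C<\infty$ such that $|f(x)-f(y)|\le C\,\omega(d(x,y))$ whenever $d(x,a)<r$ and $d(y,a)<r$. For $\gamma>0$, $f$ is locally $\gamma$-log-Hölder continuous if it has local modulus of continuity $\omega(r)=(\log\frac1r)^{-\gamma}$. The Lyapunov exponent is $L_1(\mu_t)=\lim_{n\to\infty}\frac1n\int\log\|g\|\,d\mu_t^{n}(g)$, where $\mu_t^{n}$ is the $n$-th convolution power. *)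

theory Defs
  imports "HOL-Probability.Probability"
begin

definition schroedinger :: "complex \<Rightarrow> complex^2^2" where
  "schroedinger z = vector [vector [z, -1], vector [1, 0]]"

(* The type class norm on complex^2^2 is the Frobenius norm; here the operator norm
   with respect to the Euclidean norm on complex^2 is meant. *)
definition op_norm :: "complex^2^2 \<Rightarrow> real" where
  "op_norm g = onorm ((*v) g)"

(* A profile is a total function, but only its values on (1, \<infinity>) are ever constrained or used. *)
definition moment_profile :: "(real \<Rightarrow> real) \<Rightarrow> bool" where
  "moment_profile \<phi> \<longleftrightarrow>
     continuous_on {1<..} \<phi> \<and> strict_mono_on {1<..} \<phi> \<and> (\<forall>r>1. \<phi> r > 0) \<and>
     filterlim \<phi> at_top at_top"

definition exponential_profile :: "(real \<Rightarrow> real) \<Rightarrow> bool" where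
  "exponential_profile \<phi> \<longleftrightarrow> (\<exists>\<alpha>>0. \<forall>r>1. \<phi> r = exp (\<alpha> * r))"

definition subexponential_profile :: "(real \<Rightarrow> real) \<Rightarrow> bool" where
  "subexponential_profile \<phi> \<longleftrightarrow> (\<exists>\<theta>. 0 < \<theta> \<and> \<theta> \<le> 1 \<and> (\<forall>r>1. \<phi> r = exp (r powr \<theta>)))"

definition moment :: "(real \<Rightarrow> real) \<Rightarrow> (complex^2^2) measure \<Rightarrow> ennreal" where
  "moment \<phi> M =
     (\<integral>\<^sup>+ g. ennreal (\<phi> (ln (op_norm g))) * indicator {g. ln (op_norm g) > 1} g \<partial>M)"

(* The formula is meant for small r > 0 (r < 1 / e, where ln (1 / r) > 1); larger r never
   matter for has_local_modulus, whose radius may always be decreased. *)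
definition profile_modulus :: "real \<Rightarrow> (real \<Rightarrow> real) \<Rightarrow> real \<Rightarrow> real" where
  "profile_modulus \<beta> \<phi> r = (if r = 0 then 0 else \<phi> (ln (1 / r)) powr (- \<beta>))"

definition has_local_modulus :: "(real \<Rightarrow> real) \<Rightarrow> ('a::metric_space \<Rightarrow> real) \<Rightarrow> bool" where
  "has_local_modulus \<omega> f \<longleftrightarrow>
     (\<forall>a. \<exists>r>0. \<exists>C. \<forall>x y. dist x a < r \<longrightarrow> dist y a < r \<longrightarrow> \<bar>f x - f y\<bar> \<le> C * \<omega> (dist x y))"

definition locally_log_Hoelder :: "real \<Rightarrow> ('a::metric_space \<Rightarrow> real) \<Rightarrow> bool" where
  "locally_log_Hoelder \<gamma> f \<longleftrightarrow>
     has_local_modulus (\<lambda>r. if r = 0 then 0 else ln (1 / r) powr (- \<gamma>)) f"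

(* The library's convolution is the additive one; this is convolution for the matrix product. *)
definition mult_convolution ::
    "(complex^2^2) measure \<Rightarrow> (complex^2^2) measure \<Rightarrow> (complex^2^2) measure" where
  "mult_convolution M N = distr (M \<Otimes>\<^sub>M N) borel (\<lambda>(g, h). g ** h)"

fun convolution_power :: "(complex^2^2) measure \<Rightarrow> nat \<Rightarrow> (complex^2^2) measure" where
  "convolution_power M 0 = return borel (mat 1)"
| "convolution_power M (Suc n) = mult_convolution M (convolution_power M n)"

definition lyapunov_exponent :: "(complex^2^2) measure \<Rightarrow> real" where
  "lyapunov_exponent M =
     lim (\<lambda>n. (1 / real n) * (\<integral>g. ln (op_norm g) \<partial>convolution_power M n))"

(* Sequences are indexed by n \<ge> 1; the entries p 0 and v 0 are not used. *)
definition schroedinger_measure ::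
    "(nat \<Rightarrow> real) \<Rightarrow> (nat \<Rightarrow> real) \<Rightarrow> complex \<Rightarrow> (complex^2^2) measure" where
  "schroedinger_measure p v t = measure_of UNIV (sets borel)
     (\<lambda>A. \<Sum>n. ennreal (p (Suc n) / 2) *
                  emeasure (return borel (schroedinger (of_real (v (Suc n)) - t))) A
              + ennreal (p (Suc n) / 2) *
                  emeasure (return borel (schroedinger (- of_real (v (Suc n)) - t))) A)"

lemma sets_schroedinger_measure [simp, measurable_cong]:
  "sets (schroedinger_measure p v t) = sets borel"
  unfolding schroedinger_measure_def
  using sets.sets_measure_of_eq[of "borel :: (complex^2^2) measure"] by simp

lemma emeasure_schroedinger_measure:
  assumes "A \<in> sets borel"
  shows "emeasure (schroedinger_measure p v t) A =
     (\<Sum>n. ennreal (p (Suc n) / 2) *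
                  emeasure (return borel (schroedinger (of_real (v (Suc n)) - t))) A
              + ennreal (p (Suc n) / 2) *
                  emeasure (return borel (schroedinger (- of_real (v (Suc n)) - t))) A)"
  (is "_ = ?\<nu> A")
proof (rule emeasure_measure_of[OF schroedinger_measure_def])
  let ?M = "schroedinger_measure p v t"
  show "sets borel \<subseteq> Pow UNIV" by simp
  show "A \<in> sets ?M" using assms by simp
  show "positive (sets ?M) ?\<nu>" by (simp add: positive_def)
  show "countably_additive (sets ?M) ?\<nu>"
  proof (rule countably_additiveI)
    fix B :: "nat \<Rightarrow> (complex^2^2) set"
    assume B: "range B \<subseteq> sets ?M" "disjoint_family B"
    have R: "emeasure (return borel x) (\<Union>i. B i) = (\<Sum>i. emeasure (return borel x) (B i))"
      for x :: "complex^2^2"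
      using suminf_emeasure[of B "return borel x"] B by simp
    show "(\<Sum>i. ?\<nu> (B i)) = ?\<nu> (\<Union>i. B i)"
    proof -
      have "?\<nu> (\<Union>i. B i) = (\<Sum>n. \<Sum>i. ennreal (p (Suc n) / 2) *
                  emeasure (return borel (schroedinger (of_real (v (Suc n)) - t))) (B i)
              + ennreal (p (Suc n) / 2) *
                  emeasure (return borel (schroedinger (- of_real (v (Suc n)) - t))) (B i))"
        by (simp only: R ennreal_suminf_cmult[symmetric] suminf_add[OF summableI summableI])
      also have "\<dots> = (\<Sum>i. ?\<nu> (B i))"
        by (subst (1 3) nn_integral_count_space_nat[symmetric])
           (rule nn_integral_suminf, simp)
      finally show ?thesis by (rule sym)
    qed
  qed
qed

end

theory Submission
  imports Defs "HOL-Complex_Analysis.Complex_Analysis" "HOL-Real_Asymp.Real_Asymp"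
    "HOL-Computational_Algebra.Computational_Algebra"
begin

text \<open>
  Write \<open>L E\<close> for the Lyapunov exponent of the random product at real energy \<open>E\<close>, where the
  potential takes the values \<open>v n\<close> and \<open>- v n\<close> with probability \<open>p n / 2\<close> each. The failure of regularity
  is caused by resonances at the energy \<open>a = v 1\<close>. If a site of potential \<open>v 1\<close> has the neighbours
  \<open>v n\<close> and \<open>- v n\<close>, then the two huge barriers almost decouple it from the rest of the chain: each
  shifts its energy by about \<open>1 / v n\<close>, but with opposite signs, so that the shift that remains is
  only of order \<open>1 / (v n)\<^sup>2\<close>. Such patterns occur with a frequency of order \<open>(p n)\<^sup>2\<close>, and so a window of
  width \<open>1 / (v n)\<^sup>2\<close> around \<open>a\<close> carries a mass of order \<open>(p n)\<^sup>2\<close> of the density of states. Since \<open>L\<close> is the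
  logarithmic potential of the density of states, this must be visible in \<open>L\<close>.

  The proof avoids spectral theory. The scalar \<open>wave\<close>, which is the entry of the
  transfer matrix between the vectors \<open>(1, - \<i>)\<close> and \<open>(1, \<i>)\<close>, is at real energies comparable to the norm of the
  matrix (\<open>cmod_wave_le_op_norm\<close>, \<open>op_norm_le_wave\<close>), and as a polynomial in the energy it has no zero in
  the closed upper half plane (\<open>wave_nonzero\<close>). Hence the Poisson formula holds for its log-modulus (\<open>poisson_poly\<close>),
  and the average of \<open>L (a + \<eta> * u)\<close> over a Cauchy distributed \<open>u\<close> is the growth
  rate of the mean of \<open>ln |wave|\<close> at the complex energy \<open>a + \<i> \<eta>\<close> (\<open>poisson_lyap_LIMSEQ\<close>).

  At complex energies the effect of the resonances can be computed site by site. Raising the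
  imaginary part of the energy from \<open>r\<close> to \<open>R\<close> at a single site multiplies \<open>wave\<close> by a factor of
  modulus at least \<open>1\<close> (\<open>ln_wave_telescope\<close>, \<open>cmod_vertical_mono\<close>), and at a resonant site by at least a constant
  times \<open>R * (v n)\<^sup>2\<close> when \<open>r = 1 / (v n)\<^sup>2\<close>. The two sites behind the barriers are chosen from \<open>{v 1, v 2}\<close>; because
  these values are more than \<open>4\<close> apart, one of them always keeps the remainder of the chain out
  of resonance with the barrier (\<open>prob_m_function_barrier\<close>). Taking expectations yields \<open>resonance_gain\<close>.

  Conversely, if \<open>L\<close> varies by at most \<open>B\<close> within distance \<open>s\<close> of \<open>a\<close>, then the Cauchy averages at the
  heights \<open>r \<le> R\<close> differ by at most \<open>2 * B + O(R / s)\<close> (\<open>poisson_lyap_error\<close>). Together,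
  \<open>c * (p n)\<^sup>2 * ln (R * (v n)\<^sup>2 / K) \<le> 2 * B + M * R / s\<close>, which is \<open>resonance_inequality\<close>. For
  the (sub-)exponential profiles the choice \<open>s = 1 / v n\<close> with \<open>R\<close> of order \<open>1 / (v n)\<^sup>2\<close> shows that \<open>p n * \<phi> (ln (v n))\<close>
  would be bounded, provided that \<open>(\<phi> (ln x))\<^sup>2 \<le> x\<close> for large \<open>x\<close>. For \<open>\<phi> r = r powr q\<close> the choice \<open>R = 1 / v n\<close> with
  \<open>s = (v n) powr (- 1 / 2)\<close> gains a factor \<open>ln (v n)\<close>, which is the reason for the exponent \<open>2 * q - 1\<close> instead of
  \<open>2 * q\<close>. The remaining case \<open>\<phi> r = exp (\<alpha> * r)\<close> with \<open>\<alpha> > 1 / 2\<close> is of a different nature: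
  the modulus is then a power of exponent larger than \<open>1\<close>, so that \<open>L\<close> would be constant, whereas \<open>L\<close> is large
  in the middle of the long gaps between consecutive values of the potential (\<open>lyap_not_constant\<close>).
\<close>

section \<open>The Cauchy distribution and the Poisson formula\<close>

definition cauchy_density :: "real \<Rightarrow> real" where
  "cauchy_density u = 1 / (pi * (1 + u\<^sup>2))"

lemma cauchy_density_measurable [measurable]: "cauchy_density \<in> borel_measurable borel"
  unfolding cauchy_density_def by measurable

lemma cauchy_density_nonneg: "0 \<le> cauchy_density u"
  unfolding cauchy_density_def by simp

lemma nn_integral_even:
  fixes f :: "real \<Rightarrow> real"
  assumes [measurable]: "f \<in> borel_measurable borel" and even: "\<And>x. f (- x) = f x" and "0 \<le> T"
  shows "(\<integral>\<^sup>+x. ennreal (f x) * indicator {x. T \<le> \<bar>x\<bar>} x \<partial>lborel)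
    = 2 * (\<integral>\<^sup>+x. ennreal (f x) * indicator {T..} x \<partial>lborel)"
proof -
  \<comment> \<open>For \<open>T = 0\<close> the two half lines share the point \<open>0\<close>.\<close>
  have "AE x in lborel. x \<noteq> (0::real)"
    by (rule AE_lborel_singleton)
  hence "(\<integral>\<^sup>+x. ennreal (f x) * indicator {x. T \<le> \<bar>x\<bar>} x \<partial>lborel)
     = (\<integral>\<^sup>+x. ennreal (f x) * indicator {T..} x + ennreal (f x) * indicator {T..} (- x) \<partial>lborel)"
    using \<open>0 \<le> T\<close> by (intro nn_integral_cong_AE) (auto simp: indicator_def)
  also have "\<dots> = (\<integral>\<^sup>+x. ennreal (f x) * indicator {T..} x \<partial>lborel)
      + (\<integral>\<^sup>+x. ennreal (f x) * indicator {T..} (- x) \<partial>lborel)"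
    by (rule nn_integral_add) auto
  also have "(\<integral>\<^sup>+x. ennreal (f x) * indicator {T..} (- x) \<partial>lborel)
      = (\<integral>\<^sup>+x. ennreal (f x) * indicator {T..} x \<partial>lborel)"
    by (subst nn_integral_real_affine[where c = "-1" and t = 0]) (auto simp: even)
  finally show ?thesis by (simp add: mult_2)
qed

lemma cauchy_density_has_integral:
  "has_bochner_integral lborel cauchy_density 1"
proof (rule has_bochner_integral_nn_integral)
  have "(\<integral>\<^sup>+x. ennreal (cauchy_density x) \<partial>lborel)
      = (\<integral>\<^sup>+x. ennreal (cauchy_density x) * indicator {x. 0 \<le> \<bar>x\<bar>} x \<partial>lborel)"
    by (intro nn_integral_cong) auto
  also have "\<dots> = 2 * (\<integral>\<^sup>+x. ennreal (cauchy_density x) * indicator {0..} x \<partial>lborel)"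
    by (intro nn_integral_even) (auto simp: cauchy_density_def)
  also have "(\<integral>\<^sup>+x. ennreal (cauchy_density x) * indicator {0..} x \<partial>lborel)
      = ennreal (1 / 2 - arctan 0 / pi)"
  proof (rule nn_integral_FTC_atLeast)
    show "((\<lambda>x. arctan x / pi) has_real_derivative cauchy_density x) (at x)" for x
      unfolding cauchy_density_def
      by (rule derivative_eq_intros refl | simp)+ (simp add: divide_inverse)
    show "((\<lambda>x. arctan x / pi) \<longlongrightarrow> 1 / 2) at_top"
      by real_asymp
  qed (auto simp: cauchy_density_nonneg)
  finally show "(\<integral>\<^sup>+x. ennreal (cauchy_density x) \<partial>lborel) = ennreal 1"
    by (simp add: ennreal_mult[symmetric] del: ennreal_half flip: ennreal_numeral)
qed (auto simp: cauchy_density_nonneg)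

text \<open>The tail of the Cauchy density against a square-root weight; it controls the part of a Cauchy
average that lies outside the region where the local modulus applies.\<close>

lemma powr_tail_has_integral:
  fixes T :: real
  assumes "0 < T"
  shows "has_bochner_integral lborel
    (\<lambda>u. indicator {u. T \<le> \<bar>u\<bar>} u * \<bar>u\<bar> powr (- 3 / 2)) (4 * T powr (- 1 / 2))"
proof (rule has_bochner_integral_nn_integral)
  have "(\<integral>\<^sup>+x. ennreal (indicator {u. T \<le> \<bar>u\<bar>} x * \<bar>x\<bar> powr (- 3 / 2)) \<partial>lborel)
      = (\<integral>\<^sup>+x. ennreal (\<bar>x\<bar> powr (- 3 / 2)) * indicator {x. T \<le> \<bar>x\<bar>} x \<partial>lborel)"
    by (intro nn_integral_cong) (auto simp: indicator_def)
  also have "\<dots> = 2 * (\<integral>\<^sup>+x. ennreal (\<bar>x\<bar> powr (- 3 / 2)) * indicator {T..} x \<partial>lborel)"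
    using assms by (intro nn_integral_even) auto
  also have "(\<integral>\<^sup>+x. ennreal (\<bar>x\<bar> powr (- 3 / 2)) * indicator {T..} x \<partial>lborel)
      = ennreal (0 - (- 2 * T powr (- 1 / 2)))"
  proof (rule nn_integral_FTC_atLeast)
    show "((\<lambda>x. - 2 * x powr (- 1 / 2)) has_real_derivative \<bar>x\<bar> powr (- 3 / 2)) (at x)"
      if "T \<le> x" for x
      using that assms by (auto intro!: derivative_eq_intros)
    show "((\<lambda>x::real. - 2 * x powr (- 1 / 2)) \<longlongrightarrow> 0) at_top"
      by real_asymp
  qed auto
  finally show "(\<integral>\<^sup>+x. ennreal (indicator {u. T \<le> \<bar>u\<bar>} x * \<bar>x\<bar> powr (- 3 / 2)) \<partial>lborel)
      = ennreal (4 * T powr (- 1 / 2))"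
    by (simp add: ennreal_mult[symmetric] flip: ennreal_numeral)
qed (use assms in auto)

lemma cauchy_density_le: "u \<noteq> 0 \<Longrightarrow> cauchy_density u \<le> 1 / u\<^sup>2"
proof -
  assume u: "u \<noteq> 0"
  have "1 * u\<^sup>2 \<le> pi * (1 + u\<^sup>2)"
    using pi_gt3 by (intro mult_mono) auto
  thus ?thesis using u unfolding cauchy_density_def by (intro divide_left_mono) (auto simp: add_nonneg_pos)
qed

lemma powr_half_div_square:
  fixes u :: real
  assumes "u \<noteq> 0"
  shows "\<bar>u\<bar> powr (1 / 2) / u\<^sup>2 = \<bar>u\<bar> powr (- 3 / 2)"
proof -
  have "u\<^sup>2 = \<bar>u\<bar> powr 2" using assms by simp
  hence "\<bar>u\<bar> powr (1 / 2) / u\<^sup>2 = \<bar>u\<bar> powr (1 / 2 - 2)" by (simp only: powr_diff)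
  thus ?thesis by simp
qed

lemma cauchy_density_sqrt_integrable:
  "integrable lborel (\<lambda>u. cauchy_density u * \<bar>u\<bar> powr (1 / 2))"
proof (rule Bochner_Integration.integrable_bound)
  show "integrable lborel (\<lambda>u. cauchy_density u + indicator {u. 1 \<le> \<bar>u\<bar>} u * \<bar>u\<bar> powr (- 3 / 2))"
    using cauchy_density_has_integral powr_tail_has_integral[of 1]
    by (auto simp: has_bochner_integral_iff)
  show "AE u in lborel. norm (cauchy_density u * \<bar>u\<bar> powr (1 / 2))
      \<le> norm (cauchy_density u + indicator {u. 1 \<le> \<bar>u\<bar>} u * \<bar>u\<bar> powr (- 3 / 2))"
  proof (intro AE_I2)
    fix u :: real
    show "norm (cauchy_density u * \<bar>u\<bar> powr (1 / 2))
      \<le> norm (cauchy_density u + indicator {u. 1 \<le> \<bar>u\<bar>} u * \<bar>u\<bar> powr (- 3 / 2))"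
    proof (cases "1 \<le> \<bar>u\<bar>")
      case True
      hence u: "u \<noteq> 0" by auto
      have "cauchy_density u * \<bar>u\<bar> powr (1 / 2) \<le> 1 / u\<^sup>2 * \<bar>u\<bar> powr (1 / 2)"
        by (intro mult_right_mono cauchy_density_le u) auto
      also have "\<dots> = \<bar>u\<bar> powr (- 3 / 2)" using powr_half_div_square[OF u] by simp
      finally show ?thesis using True cauchy_density_nonneg[of u] by simp
    next
      case False
      hence "\<bar>u\<bar> powr (1 / 2) \<le> 1" by (simp add: powr_le1)
      thus ?thesis using False cauchy_density_nonneg[of u] by (simp add: mult_left_le)
    qed
  qed
qed auto

lemma ln_le_sqrt:
  fixes x :: real
  assumes "0 < x"
  shows "ln x \<le> 2 * x powr (1 / 2)"
proof -
  have "ln (x powr (1 / 2)) \<le> x powr (1 / 2)"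
    using assms by (intro ln_bound) auto
  thus ?thesis using assms by (simp add: ln_powr)
qed

text \<open>Everything that is averaged below grows at most logarithmically; the square root is a
convenient majorant that the Cauchy distribution still integrates.\<close>

lemma cauchy_integrable_bound:
  fixes h :: "real \<Rightarrow> real"
  assumes [measurable]: "h \<in> borel_measurable borel"
    and "\<And>u. \<bar>h u\<bar> \<le> A * (1 + \<bar>u\<bar> powr (1 / 2))"
  shows "integrable lborel (\<lambda>u. cauchy_density u * h u)"
proof (rule Bochner_Integration.integrable_bound)
  show "integrable lborel (\<lambda>u. A * (cauchy_density u + cauchy_density u * \<bar>u\<bar> powr (1 / 2)))"
    using cauchy_density_has_integral cauchy_density_sqrt_integrable
    by (auto simp: has_bochner_integral_iff)
  show "AE u in lborel. norm (cauchy_density u * h u)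
     \<le> norm (A * (cauchy_density u + cauchy_density u * \<bar>u\<bar> powr (1 / 2)))"
  proof (intro AE_I2)
    fix u
    have "cauchy_density u * \<bar>h u\<bar> \<le> cauchy_density u * (A * (1 + \<bar>u\<bar> powr (1 / 2)))"
      by (intro mult_left_mono assms cauchy_density_nonneg)
    also have "\<dots> = A * (cauchy_density u + cauchy_density u * \<bar>u\<bar> powr (1 / 2))"
      by (simp add: algebra_simps)
    also have "\<dots> \<le> \<bar>\<dots>\<bar>" by simp
    finally show "norm (cauchy_density u * h u)
     \<le> norm (A * (cauchy_density u + cauchy_density u * \<bar>u\<bar> powr (1 / 2)))"
      using cauchy_density_nonneg[of u] by (simp add: abs_mult[of "cauchy_density u"])
  qed
qed auto

lemma sqrt_add_le:
  fixes x y :: real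
  assumes "0 \<le> x" "0 \<le> y"
  shows "(x + y) powr (1 / 2) \<le> x powr (1 / 2) + y powr (1 / 2)"
  using assms sqrt_add_le_add_sqrt[of x y] by (simp add: powr_half_sqrt)

lemma ln_linear_factor_bound:
  assumes "Im \<zeta> < 0"
  obtains A where "\<And>u::real. \<bar>ln (cmod (of_real u - \<zeta>))\<bar> \<le> A * (1 + \<bar>u\<bar> powr (1 / 2))"
proof -
  define A where "A = \<bar>ln (- Im \<zeta>)\<bar> + 2 * (cmod \<zeta>) powr (1 / 2) + 2"
  have "\<bar>ln (cmod (of_real u - \<zeta>))\<bar> \<le> A * (1 + \<bar>u\<bar> powr (1 / 2))" for u :: real
  proof -
    have lo: "- Im \<zeta> \<le> cmod (of_real u - \<zeta>)"
      using abs_Im_le_cmod[of "of_real u - \<zeta>"] by simp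
    hence pos: "0 < cmod (of_real u - \<zeta>)" using assms by linarith
    have "ln (- Im \<zeta>) \<le> ln (cmod (of_real u - \<zeta>))"
      using assms lo pos by (intro ln_mono) auto
    moreover have "ln (cmod (of_real u - \<zeta>)) \<le> 2 * (\<bar>u\<bar> + cmod \<zeta>) powr (1 / 2)"
    proof -
      have "ln (cmod (of_real u - \<zeta>)) \<le> ln (\<bar>u\<bar> + cmod \<zeta>)"
        using pos norm_triangle_ineq4[of "of_real u" \<zeta>] by (intro ln_mono) (auto simp del: zero_less_norm_iff)
      also have "\<dots> \<le> 2 * (\<bar>u\<bar> + cmod \<zeta>) powr (1 / 2)"
        using pos norm_triangle_ineq4[of "of_real u" \<zeta>] by (intro ln_le_sqrt) (auto simp del: zero_less_norm_iff)
      finally show ?thesis .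
    qed
    ultimately have "\<bar>ln (cmod (of_real u - \<zeta>))\<bar>
       \<le> \<bar>ln (- Im \<zeta>)\<bar> + 2 * (cmod \<zeta>) powr (1 / 2) + 2 * \<bar>u\<bar> powr (1 / 2)"
      using sqrt_add_le[OF abs_ge_zero norm_ge_zero, of u \<zeta>] powr_ge_zero[of "\<bar>u\<bar>" "1/2"]
        powr_ge_zero[of "cmod \<zeta>" "1/2"] by linarith
    also have "\<dots> \<le> A * (1 + \<bar>u\<bar> powr (1 / 2))"
    proof -
      have "0 \<le> (\<bar>ln (- Im \<zeta>)\<bar> + 2 * (cmod \<zeta>) powr (1 / 2)) * \<bar>u\<bar> powr (1 / 2)" by simp
      thus ?thesis unfolding A_def by (simp add: algebra_simps)
    qed
    finally show ?thesis .
  qed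
  thus ?thesis using that by blast
qed

text \<open>The Poisson formula at the point \<open>\<i>\<close>, for the function \<open>ln |z - \<zeta>|\<close> that is harmonic on a
neighbourhood of the closed upper half plane. It comes from Cauchy's theorem on large half discs:
the logarithm grows so slowly that the arc contributes nothing in the limit.\<close>

lemma poisson_linear_factor:
  assumes \<zeta>: "Im \<zeta> < 0"
  shows "has_bochner_integral lborel (\<lambda>u. cauchy_density u * ln (cmod (of_real u - \<zeta>)))
    (ln (cmod (\<i> - \<zeta>)))"
proof -
  \<comment> \<open>Multiplication by \<open>- \<i>\<close> turns the half plane above \<open>\<zeta>\<close> into the right half plane, on which the
    principal logarithm is holomorphic. Subtracting \<open>G \<i>\<close> in \<open>q\<close> removes the pole at \<open>\<i>\<close>, so that no winding number
    is needed.\<close>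
  define G where "G z = Ln (- \<i> * (z - \<zeta>))" for z
  define q where "q z = (if z = \<i> then deriv G \<i> else (G z - G \<i>) / (z - \<i>))" for z
  define F where "F z = q z / (z + \<i>)" for z
  define S where "S = {z. max (Im \<zeta>) (- 1) < Im z}"
  have "S = {z. Im \<zeta> < Im z} \<inter> {z. - 1 < Im z}" by (auto simp: S_def)
  hence S: "open S" "convex S" "\<i> \<in> S"
    using \<zeta> by (auto intro!: open_Int convex_Int simp: open_halfspace_Im_gt convex_halfspace_Im_gt)
  have ReG: "0 < Re (- \<i> * (z - \<zeta>))" if "z \<in> S" for z
    using that by (simp add: S_def)
  have nz: "z + \<i> \<noteq> 0" if "z \<in> S" for z
    using that by (auto simp: S_def complex_eq_iff)
  have holG: "G holomorphic_on S"
    unfolding G_def using ReG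
    by (intro holomorphic_intros) (force simp: complex_nonpos_Reals_iff)+
  have holF: "F holomorphic_on S"
    unfolding F_def q_def using nz
    by (intro holomorphic_intros pole_lemma_open holG S) auto
  have Re_G: "Re (G z) = ln (cmod (z - \<zeta>))" if "z \<in> S" for z
    using ReG[OF that] unfolding G_def by (subst Re_Ln) (auto simp: norm_mult)
  have Im_G: "\<bar>Im (G z)\<bar> \<le> pi" if "z \<in> S" for z
  proof -
    have "- \<i> * (z - \<zeta>) \<noteq> 0" using ReG[OF that] by fastforce
    from mpi_less_Im_Ln[OF this] Im_Ln_le_pi[OF this] show ?thesis unfolding G_def by simp
  qed
  define f where "f x = (ln (cmod (of_real x - \<zeta>)) - ln (cmod (\<i> - \<zeta>))) * cauchy_density x" for x :: real
  have F_real: "Re (F (of_real x)) = pi * f x" for x :: real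
  proof -
    have x: "of_real x \<in> S" using \<zeta> by (auto simp: S_def)
    have xi: "complex_of_real x \<noteq> \<i>" by (auto simp: complex_eq_iff)
    have "F (of_real x) = (G (of_real x) - G \<i>) / ((of_real x - \<i>) * (of_real x + \<i>))"
      unfolding F_def q_def using xi by simp
    also have "(of_real x - \<i>) * (of_real x + \<i>) = complex_of_real (1 + x\<^sup>2)"
      by (simp add: algebra_simps power2_eq_square)
    finally have "Re (F (of_real x)) = (Re (G (of_real x)) - Re (G \<i>)) / (1 + x\<^sup>2)"
      by simp
    thus ?thesis using Re_G[OF x] Re_G[OF S(3)]
      by (simp add: f_def cauchy_density_def)
  qed
  obtain A where A: "\<And>u::real. \<bar>ln (cmod (of_real u - \<zeta>))\<bar> \<le> A * (1 + \<bar>u\<bar> powr (1 / 2))"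
    using ln_linear_factor_bound[OF \<zeta>] by blast
  have int: "integrable lborel (\<lambda>u. cauchy_density u * ln (cmod (of_real u - \<zeta>)))"
    by (rule cauchy_integrable_bound[OF _ A]) auto
  have int1: "integrable lborel cauchy_density" "integral\<^sup>L lborel cauchy_density = 1"
    using cauchy_density_has_integral by (auto simp: has_bochner_integral_iff)
  have intf: "integrable lborel f"
  proof -
    have "integrable lborel (\<lambda>u. cauchy_density u * ln (cmod (of_real u - \<zeta>))
        - cauchy_density u * ln (cmod (\<i> - \<zeta>)))"
      using int int1 by (intro Bochner_Integration.integrable_diff) auto
    thus ?thesis unfolding f_def by (simp add: algebra_simps)
  qed
  have cont: "continuous_on {-T..T} (\<lambda>x. F (of_real x))" for T :: real
    using \<zeta> by (intro continuous_on_compose2[OF holomorphic_on_imp_continuous_on[OF holF]] continuous_intros)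
       (auto simp: S_def)
  define B where "B T = (ln (T + cmod \<zeta>) + pi + cmod (G \<i>)) / (T\<^sup>2 - 1)" for T :: real
  have bound: "\<bar>integral {-T..T} f\<bar> \<le> B T * T" if T: "T > 2 + cmod \<zeta>" for T :: real
  proof -
    have T1: "T > 1" using T norm_ge_zero[of \<zeta>] by linarith
    let ?L = "linepath (of_real (- T)) (complex_of_real T)" and ?A = "part_circlepath 0 T 0 pi"
    have pL: "path_image ?L \<subseteq> S"
    proof -
      have "of_real (- T) \<in> S" "of_real T \<in> S" using \<zeta> by (auto simp: S_def)
      thus ?thesis using S(2) by (simp add: closed_segment_subset)
    qed
    have arc: "cmod z = T \<and> 0 \<le> Im z" if "z \<in> path_image ?A" for z
      using that T1 by (auto simp: path_image_part_circlepath norm_mult Im_exp sin_ge_zero)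
    have pA: "path_image ?A \<subseteq> S" using arc \<zeta> by (force simp: S_def)
    have ends: "exp (\<i> * of_real pi) = -1" by (simp add: exp_pi_i)
    have cont_int: "F contour_integrable_on ?L" "F contour_integrable_on ?A"
      by (intro contour_integrable_holomorphic_simple[OF holF S(1)] pL pA valid_path_linepath
          valid_path_part_circlepath)+
    have "(F has_contour_integral 0) (?L +++ ?A)"
      by (rule Cauchy_theorem_convex_simple[OF holF S(2)])
         (use pL pA ends in \<open>auto simp: path_image_join pathstart_part_circlepath\<close>)
    hence "contour_integral ?L F + contour_integral ?A F = 0"
      using cont_int by (metis contour_integral_join contour_integral_unique valid_path_linepath
        valid_path_part_circlepath)
    moreover have "contour_integral ?L F = integral {-T..T} (\<lambda>x. F (of_real x))"
      using T1 by (subst contour_integral_linepath_Reals_eq) auto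
    ultimately have eq: "cmod (integral {-T..T} (\<lambda>x. F (of_real x))) = cmod (contour_integral ?A F)"
      by (metis add_eq_0_iff norm_minus_cancel)
    have "cmod (contour_integral ?A F) \<le> B T * T * (pi - 0)"
    proof (rule has_contour_integral_bound_part_circlepath)
      show "(F has_contour_integral contour_integral ?A F) ?A"
        using cont_int by (simp add: has_contour_integral_integral)
      have "ln (T + cmod \<zeta>) \<ge> 0" using T1 norm_ge_zero[of \<zeta>] by (intro ln_ge_zero) linarith
      moreover have T2: "T\<^sup>2 > 1" using T1 by (simp add: one_less_power)
      ultimately show "0 \<le> B T" unfolding B_def by simp
      fix z assume "z \<in> path_image ?A"
      hence z: "cmod z = T" "0 \<le> Im z" "z \<in> S" using arc pA by auto
      have zi: "z \<noteq> \<i>" using z(1) T1 by auto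
      have den: "T\<^sup>2 - 1 \<le> cmod ((z - \<i>) * (z + \<i>))"
      proof -
        have "(z - \<i>) * (z + \<i>) = z\<^sup>2 - (- 1)" by (simp add: algebra_simps power2_eq_square)
        thus ?thesis using norm_triangle_ineq2[of "z\<^sup>2" "-1"] z(1) by (simp add: norm_power)
      qed
      have zlo: "1 \<le> cmod (z - \<zeta>)"
        using norm_triangle_ineq2[of z \<zeta>] z(1) T by linarith
      have "cmod (G z) \<le> \<bar>Re (G z)\<bar> + \<bar>Im (G z)\<bar>" by (rule cmod_le)
      also have "Re (G z) = ln (cmod (z - \<zeta>))" by (rule Re_G[OF z(3)])
      also have "\<bar>ln (cmod (z - \<zeta>))\<bar> = ln (cmod (z - \<zeta>))"
        using zlo by simp
      also have "\<dots> \<le> ln (T + cmod \<zeta>)"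
        using norm_triangle_ineq4[of z \<zeta>] z(1) zlo by (intro ln_mono) auto
      finally have "cmod (G z) \<le> ln (T + cmod \<zeta>) + pi" using Im_G[OF z(3)] by simp
      hence num: "cmod (G z - G \<i>) \<le> ln (T + cmod \<zeta>) + pi + cmod (G \<i>)"
        using norm_triangle_ineq4[of "G z" "G \<i>"] by simp
      have "cmod (F z) = cmod (G z - G \<i>) / cmod ((z - \<i>) * (z + \<i>))"
        unfolding F_def q_def using zi by (simp add: norm_divide norm_mult)
      also have "\<dots> \<le> (ln (T + cmod \<zeta>) + pi + cmod (G \<i>)) / (T\<^sup>2 - 1)"
        using num den T2 by (intro frac_le) (auto intro: order_trans[OF norm_ge_zero])
      finally show "cmod (F z) \<le> B T" unfolding B_def .
    qed (use T1 in auto)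
    have "integral {-T..T} f = Re (integral {-T..T} (\<lambda>x. F (of_real x))) / pi"
    proof -
      have "((\<lambda>x. F (of_real x)) has_integral integral {-T..T} (\<lambda>x. F (of_real x))) {-T..T}"
        using integrable_continuous_interval[OF cont] by (simp add: has_integral_integral)
      from has_integral_Re[OF this] have "((\<lambda>x. pi * f x) has_integral
          Re (integral {-T..T} (\<lambda>x. F (of_real x)))) {-T..T}"
        by (simp only: F_real)
      hence "integral {-T..T} (\<lambda>x. pi * f x) = Re (integral {-T..T} (\<lambda>x. F (of_real x)))"
        by (rule integral_unique)
      thus ?thesis by (simp add: nonzero_eq_divide_eq mult.commute)
    qed
    hence "\<bar>integral {-T..T} f\<bar> \<le> cmod (integral {-T..T} (\<lambda>x. F (of_real x))) / pi"
      using abs_Re_le_cmod[of "integral {-T..T} (\<lambda>x. F (of_real x))"] by (simp add: divide_right_mono)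
    also have "\<dots> \<le> B T * T * (pi - 0) / pi"
      unfolding eq by (intro divide_right_mono) (use \<open>cmod (contour_integral ?A F) \<le> _\<close> in auto)
    finally show ?thesis by simp
  qed
  have "integral\<^sup>L lborel f = 0"
  proof -
    have "(\<lambda>n. integral\<^sup>L lborel (\<lambda>x. indicator {- real n..real n} x *\<^sub>R f x)) \<longlonglongrightarrow> integral\<^sup>L lborel f"
    proof (rule integral_dominated_convergence[where w = "\<lambda>x. norm (f x)"])
      show "AE x in lborel. (\<lambda>n. indicator {- real n..real n} x *\<^sub>R f x) \<longlonglongrightarrow> f x"
      proof (intro AE_I2 tendsto_eventually)
        fix x :: real
        obtain N where "\<bar>x\<bar> \<le> real N" using real_arch_simple by blast
        hence "\<forall>n\<ge>N. indicator {- real n..real n} x *\<^sub>R f x = f x"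
          by (force simp: indicator_def)
        thus "\<forall>\<^sub>F n in sequentially. indicator {- real n..real n} x *\<^sub>R f x = f x"
          unfolding eventually_sequentially by blast
      qed
    qed (use intf in \<open>auto simp: indicator_def\<close>)
    also have "(\<lambda>n. integral\<^sup>L lborel (\<lambda>x. indicator {- real n..real n} x *\<^sub>R f x))
        = (\<lambda>n. integral {- real n..real n} f)"
    proof
      fix n
      have "set_integrable lborel {- real n..real n} f"
        unfolding set_integrable_def by (rule integrable_mult_indicator) (auto intro: intf)
      from set_borel_integral_eq_integral(2)[OF this]
      show "integral\<^sup>L lborel (\<lambda>x. indicator {- real n..real n} x *\<^sub>R f x) = integral {- real n..real n} f"
        by (simp add: set_lebesgue_integral_def)
    qed
    finally have lim: "(\<lambda>n. integral {- real n..real n} f) \<longlonglongrightarrow> integral\<^sup>L lborel f" .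
    have "(\<lambda>n. integral {- real n..real n} f) \<longlonglongrightarrow> 0"
    proof (rule tendsto_rabs_zero_cancel, rule tendsto_sandwich[where f = "\<lambda>_. 0" and h = "\<lambda>n. B (real n) * real n"])
      show "\<forall>\<^sub>F n in sequentially. \<bar>integral {- real n..real n} f\<bar> \<le> B (real n) * real n"
      proof -
        have "\<forall>\<^sub>F n in sequentially. real n > 2 + cmod \<zeta>" by real_asymp
        thus ?thesis by eventually_elim (rule bound)
      qed
      show "(\<lambda>n. B (real n) * real n) \<longlonglongrightarrow> 0"
        unfolding B_def by real_asymp
    qed auto
    with lim show ?thesis by (rule LIMSEQ_unique)
  qed
  hence "integral\<^sup>L lborel (\<lambda>u. cauchy_density u * ln (cmod (of_real u - \<zeta>))
      - ln (cmod (\<i> - \<zeta>)) * cauchy_density u) = 0"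
    unfolding f_def by (simp add: algebra_simps)
  hence "integral\<^sup>L lborel (\<lambda>u. cauchy_density u * ln (cmod (of_real u - \<zeta>))) = ln (cmod (\<i> - \<zeta>))"
    using int int1 by (subst (asm) Bochner_Integration.integral_diff) auto
  with int show ?thesis by (simp add: has_bochner_integral_iff)
qed

text \<open>For a polynomial the formula follows by summing over the linear factors. The absence of zeros in the
closed half plane is essential, since in general \<open>ln |p|\<close> is only subharmonic there.\<close>

lemma poisson_poly:
  fixes p :: "complex poly"
  assumes nz: "\<And>z. 0 \<le> Im z \<Longrightarrow> poly p z \<noteq> 0"
  shows "has_bochner_integral lborel (\<lambda>u. cauchy_density u * ln (cmod (poly p (of_real u))))
    (ln (cmod (poly p \<i>)))"
proof -
  obtain root where root: "smult (lead_coeff p) (\<Prod>i<degree p. [:-root i, 1:]) = p"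
    using complex_poly_decompose' .
  have p: "poly p z = lead_coeff p * (\<Prod>i<degree p. z - root i)" for z
    by (subst root[symmetric]) (simp add: poly_prod)
  have lc: "lead_coeff p \<noteq> 0" using nz[of 0] by auto
  have im: "Im (root i) < 0" if "i < degree p" for i
  proof (rule ccontr)
    assume "\<not> Im (root i) < 0"
    moreover have "poly p (root i) = 0" unfolding p using that by auto
    ultimately show False using nz[of "root i"] by auto
  qed
  have expand: "ln (cmod (poly p z)) = ln (cmod (lead_coeff p)) + (\<Sum>i<degree p. ln (cmod (z - root i)))"
    if "0 \<le> Im z" for z
  proof -
    have "z - root i \<noteq> 0" if "i < degree p" for i using im[OF that] \<open>0 \<le> Im z\<close> by auto
    hence "0 < cmod (z - root i)" if "i < degree p" for i using that by simp
    hence "ln (\<Prod>i<degree p. cmod (z - root i)) = (\<Sum>i<degree p. ln (cmod (z - root i)))"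
      "0 < (\<Prod>i<degree p. cmod (z - root i))"
      by (auto intro!: ln_prod prod_pos)
    thus ?thesis unfolding p using lc
      by (simp add: norm_mult prod_norm[symmetric] ln_mult_pos)
  qed
  have "has_bochner_integral lborel
     (\<lambda>u. cauchy_density u * ln (cmod (lead_coeff p))
        + (\<Sum>i<degree p. cauchy_density u * ln (cmod (of_real u - root i))))
     (1 * ln (cmod (lead_coeff p)) + (\<Sum>i<degree p. ln (cmod (\<i> - root i))))"
    using im by (intro has_bochner_integral_add has_bochner_integral_sum has_bochner_integral_mult_left
      cauchy_density_has_integral poisson_linear_factor) auto
  thus ?thesis by (simp add: expand distrib_left sum_distrib_left)
qed

section \<open>Continuants with an imaginary end condition\<close>

text \<open>\<open>(contP, contQ)\<close> is the product of the matrices with rows \<open>(x, -1)\<close> and \<open>(1, 0)\<close> applied to the vector \<open>(1, \<i>)\<close>.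
The imaginary end condition keeps the quotient of the two components in the open upper half plane
even for real entries.\<close>

fun contP :: "complex list \<Rightarrow> complex" and contQ :: "complex list \<Rightarrow> complex" where
  "contP [] = 1"
| "contQ [] = \<i>"
| "contP (x # xs) = x * contP xs - contQ xs"
| "contQ (x # xs) = contP xs"

text \<open>The pairing of the vector \<open>(contP, contQ)\<close> with the row \<open>(1, - \<i>)\<close>; this is the same
end condition as on the right, so that the value does not depend on the direction of reading.\<close>

definition wave :: "complex list \<Rightarrow> complex" where
  "wave xs = contP xs - \<i> * contQ xs"

text \<open>The Weyl function of a half chain: the diagonal Green function at its first site.\<close>

definition m_function :: "complex list \<Rightarrow> complex" where
  "m_function xs = contQ xs / contP xs"

text \<open>The map \<open>m \<mapsto> 1 / (x - m)\<close> preserves the open upper half plane when \<open>Im x \<le> 0\<close>.\<close>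

lemma m_function_Im_pos_contP_nonzero:
  assumes "\<And>x. x \<in> set xs \<Longrightarrow> Im x \<le> 0"
  shows "contP xs \<noteq> 0 \<and> 0 < Im (m_function xs)"
  using assms
proof (induction xs)
  case Nil
  show ?case by (simp add: m_function_def)
next
  case (Cons x xs)
  hence IH: "contP xs \<noteq> 0" "0 < Im (m_function xs)" and x: "Im x \<le> 0" by auto
  have eq: "contP (x # xs) = contP xs * (x - m_function xs)"
    using IH(1) by (simp add: m_function_def field_simps)
  have im: "Im (x - m_function xs) < 0" using IH(2) x by simp
  hence nz: "x - m_function xs \<noteq> 0" by auto
  have "m_function (x # xs) = 1 / (x - m_function xs)"
    unfolding m_function_def[of "x # xs"] eq using IH(1) nz by simp
  moreover have "0 < (cmod (x - m_function xs))\<^sup>2" using nz by simp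
  ultimately have "0 < Im (m_function (x # xs))"
    using im by (simp add: Im_divide cmod_power2 divide_neg_pos)
  thus ?case unfolding eq using IH(1) nz by simp
qed

lemma contP_nonzero: "(\<And>x. x \<in> set xs \<Longrightarrow> Im x \<le> 0) \<Longrightarrow> contP xs \<noteq> 0"
  and m_function_Im_pos: "(\<And>x. x \<in> set xs \<Longrightarrow> Im x \<le> 0) \<Longrightarrow> 0 < Im (m_function xs)"
  using m_function_Im_pos_contP_nonzero by blast+

lemma contP_Cons: "contP xs \<noteq> 0 \<Longrightarrow> contP (x # xs) = contP xs * (x - m_function xs)"
  by (simp add: m_function_def field_simps)

lemma m_function_Cons:
  "contP xs \<noteq> 0 \<Longrightarrow> m_function (x # xs) = 1 / (x - m_function xs)"
  unfolding m_function_def[of "x # xs"] contP_Cons by simp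

text \<open>The bilinear pairing of the two halves does not depend on the place of the cut, because
\<open>x * P - Q\<close> can be charged to either side.\<close>

lemma wave_append:
  "wave (xs @ ys) = contP (rev xs) * contP ys - contQ (rev xs) * contQ ys"
proof (induction xs arbitrary: ys rule: rev_induct)
  case (snoc x xs)
  have "wave ((xs @ [x]) @ ys) = wave (xs @ x # ys)" by simp
  also have "\<dots> = contP (rev xs) * contP (x # ys) - contQ (rev xs) * contQ (x # ys)" by (rule snoc)
  finally show ?case by (simp add: algebra_simps)
qed (simp add: wave_def)

text \<open>Isolating one site: the rest of the chain enters only through its two half-chain Weyl functions.
This is the formula that localizes the effect of changing the energy at one site.\<close>

lemma wave_split:
  assumes "contP (rev xs) \<noteq> 0" "contP ys \<noteq> 0"
  shows "wave (xs @ x # ys) = contP (rev xs) * contP ys * (x - (m_function (rev xs) + m_function ys))"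
  using assms unfolding wave_append by (simp add: m_function_def field_simps)

lemma wave_nonzero:
  assumes "\<And>x. x \<in> set xs \<Longrightarrow> Im x \<le> 0"
  shows "wave xs \<noteq> 0"
proof -
  have "wave xs = contP xs * (1 - \<i> * m_function xs)"
    using contP_nonzero[OF assms] by (simp add: wave_def m_function_def field_simps)
  moreover have "Re (1 - \<i> * m_function xs) > 0" using m_function_Im_pos[of xs] assms by simp
  hence "1 - \<i> * m_function xs \<noteq> 0" by force
  ultimately show ?thesis using contP_nonzero[OF assms] by simp
qed

text \<open>The matrix product is real and has determinant one, so it preserves the symplectic form
of the vector \<open>(1, \<i>)\<close> with its conjugate.\<close>

lemma wronskian_real:
  assumes "\<And>x. x \<in> set xs \<Longrightarrow> Im x = 0"
  shows "Im (cnj (contP xs) * contQ xs) = 1"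
  using assms
proof (induction xs)
  case (Cons x xs)
  hence IH: "Im (cnj (contP xs) * contQ xs) = 1" and x: "Im x = 0" by auto
  have "Im (cnj (contP (x # xs)) * contQ (x # xs)) = Im (cnj (contP xs) * contQ xs)"
    using x by (simp add: algebra_simps)
  with IH show ?case by simp
qed simp

text \<open>For a real matrix of determinant one, the entry in the basis that diagonalizes rotations
has the squared modulus "Frobenius norm squared plus two".\<close>

lemma wave_real_norm:
  assumes "\<And>x. x \<in> set xs \<Longrightarrow> Im x = 0"
  shows "(cmod (wave xs))\<^sup>2 = (cmod (contP xs))\<^sup>2 + (cmod (contQ xs))\<^sup>2 + 2"
proof -
  have "Re (contP xs) * Im (contQ xs) - Im (contP xs) * Re (contQ xs) = 1"
    using wronskian_real[OF assms] by simp
  thus ?thesis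
    unfolding wave_def cmod_power2 by (simp add: power2_eq_square algebra_simps)
qed

lemma cmod_contP_contQ_le:
  assumes "\<And>x. x \<in> set xs \<Longrightarrow> cmod x \<le> b x" "\<And>x. x \<in> set xs \<Longrightarrow> 0 \<le> b x"
  shows "cmod (contP xs) \<le> (\<Prod>x\<leftarrow>xs. b x + 1) \<and> cmod (contQ xs) \<le> (\<Prod>x\<leftarrow>xs. b x + 1)"
  using assms
proof (induction xs)
  case (Cons x xs)
  let ?B = "\<Prod>x\<leftarrow>xs. b x + 1"
  have IH: "cmod (contP xs) \<le> ?B" "cmod (contQ xs) \<le> ?B" and x: "cmod x \<le> b x" "0 \<le> b x"
    using Cons by auto
  have B: "0 \<le> ?B" using IH(1) norm_ge_zero order_trans by blast
  have "cmod (contP (x # xs)) \<le> cmod x * cmod (contP xs) + cmod (contQ xs)"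
    using norm_triangle_ineq4[of "x * contP xs" "contQ xs"] by (simp add: norm_mult)
  also have "\<dots> \<le> b x * ?B + ?B"
    using IH x B by (intro add_mono mult_mono) auto
  finally have "cmod (contP (x # xs)) \<le> (b x + 1) * ?B" by (simp add: algebra_simps)
  moreover have "1 * ?B \<le> (b x + 1) * ?B" using x B by (intro mult_right_mono) auto
  ultimately show ?case using IH by simp
qed simp

lemma cmod_wave_le:
  "cmod (wave xs) \<le> 2 * (\<Prod>x\<leftarrow>xs. cmod x + 1)"
proof -
  have "cmod (wave xs) \<le> cmod (contP xs) + cmod (contQ xs)"
    using norm_triangle_ineq4[of "contP xs" "\<i> * contQ xs"] by (simp add: wave_def norm_mult)
  thus ?thesis using cmod_contP_contQ_le[of xs cmod] by simp
qed

text \<open>\<open>contP\<close> and \<open>contQ\<close> as polynomials in the energy.\<close>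

fun polyP :: "real list \<Rightarrow> complex poly" and polyQ :: "real list \<Rightarrow> complex poly" where
  "polyP [] = 1"
| "polyQ [] = [:\<i>:]"
| "polyP (w # ws) = [:of_real w, -1:] * polyP ws - polyQ ws"
| "polyQ (w # ws) = polyP ws"

definition shifted :: "complex \<Rightarrow> real list \<Rightarrow> complex list" where
  "shifted z ws = map (\<lambda>w. of_real w - z) ws"

lemma poly_polyP: "poly (polyP ws) z = contP (shifted z ws) \<and> poly (polyQ ws) z = contQ (shifted z ws)"
  by (induction ws) (simp_all add: shifted_def algebra_simps)

definition poly_wave :: "real list \<Rightarrow> complex poly" where
  "poly_wave ws = polyP ws - [:\<i>:] * polyQ ws"

lemma poly_wave: "poly (poly_wave ws) z = wave (shifted z ws)"
  by (simp add: poly_wave_def wave_def poly_polyP)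

text \<open>Energies at distance at least two from all values of the potential are uniformly hyperbolic: the
cone \<open>|Q| \<le> |P|\<close> is invariant and every step expands by at least \<open>g - 1\<close>.\<close>

lemma contP_uniform_lower:
  assumes "\<And>x. x \<in> set xs \<Longrightarrow> g \<le> cmod x" "2 \<le> g"
  shows "(g - 1) ^ length xs \<le> cmod (contP xs) \<and> cmod (contQ xs) \<le> cmod (contP xs)"
  using assms(1)
proof (induction xs)
  case (Cons x xs)
  hence IH: "(g - 1) ^ length xs \<le> cmod (contP xs)" "cmod (contQ xs) \<le> cmod (contP xs)"
    and x: "g \<le> cmod x" by auto
  have "g * cmod (contP xs) - cmod (contP xs) \<le> cmod x * cmod (contP xs) - cmod (contQ xs)"
    using IH(2) x by (intro diff_mono mult_right_mono) auto
  also have "\<dots> \<le> cmod (contP (x # xs))"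
    using norm_triangle_ineq2[of "x * contP xs" "contQ xs"] by (simp add: norm_mult)
  finally have lo: "(g - 1) * cmod (contP xs) \<le> cmod (contP (x # xs))" by (simp add: algebra_simps)
  have "(g - 1) * (g - 1) ^ length xs \<le> (g - 1) * cmod (contP xs)"
    using IH(1) assms(2) by (intro mult_left_mono) auto
  moreover have "1 * cmod (contP xs) \<le> (g - 1) * cmod (contP xs)"
    using assms(2) by (intro mult_right_mono) auto
  ultimately show ?case using lo by simp
qed simp

lemma shifted_Cons: "shifted z (w # ws) = (of_real w - z) # shifted z ws"
  and shifted_append: "shifted z (xs @ ys) = shifted z xs @ shifted z ys"
  and rev_shifted: "rev (shifted z ws) = shifted z (rev ws)"
  by (simp_all add: shifted_def rev_map)

lemma shifted_Im_neg:
  assumes "0 \<le> Im z" "x \<in> set (shifted z ws)"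
  shows "Im x \<le> 0"
  using assms by (auto simp: shifted_def)

lemma m_function_shifted_Im_pos: "0 \<le> Im z \<Longrightarrow> 0 < Im (m_function (shifted z ws))"
  by (rule m_function_Im_pos) (rule shifted_Im_neg)

lemma m_function_shifted_Cons:
  "0 \<le> Im z \<Longrightarrow> m_function (shifted z (w # ws)) = 1 / (of_real w - z - m_function (shifted z ws))"
  unfolding shifted_Cons by (rule m_function_Cons, rule contP_nonzero, rule shifted_Im_neg)

section \<open>Transfer matrices and their operator norm\<close>

lemma matrix_vector_2: "(g *v x) $ i = g $ i $ 1 * x $ 1 + g $ i $ 2 * x $ (2::2)" for g :: "complex^2^2"
  by (simp add: matrix_vector_mult_def sum_2)

lemma bounded_linear_matrix_complex: "bounded_linear ((*v) (g :: complex^2^2))"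
proof -
  have "linear ((*v) g)"
    by (rule linearI) (simp_all add: vec_eq_iff matrix_vector_2 algebra_simps scaleR_conv_of_real[where 'a = complex])
  thus ?thesis by (simp add: linear_conv_bounded_linear)
qed

lemma op_norm_mult: "op_norm (g ** h) \<le> op_norm g * op_norm h"
proof -
  have "(*v) (g ** h) = (*v) g \<circ> (*v) h"
    by (auto simp: matrix_vector_mul_assoc)
  thus ?thesis unfolding op_norm_def
    by (simp add: onorm_compose[OF bounded_linear_matrix_complex bounded_linear_matrix_complex])
qed

lemma op_norm_ge_entry: "cmod (g $ i $ j) \<le> op_norm g"
proof -
  have "cmod (g $ i $ j) = cmod ((g *v axis j 1) $ i)"
    using exhaust_2[of j] by (auto simp: matrix_vector_2 axis_def)
  also have "\<dots> \<le> norm (g *v axis j 1)" by (rule Finite_Cartesian_Product.norm_nth_le)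
  also have "\<dots> \<le> op_norm g * norm (axis j (1::complex) :: complex^2)"
    unfolding op_norm_def by (rule onorm[OF bounded_linear_matrix_complex])
  also have "norm (axis j (1::complex) :: complex^2) = 1" by simp
  finally show ?thesis by simp
qed

lemma op_norm_le_entries:
  "op_norm g \<le> cmod (g $ 1 $ 1) + cmod (g $ 1 $ 2) + cmod (g $ 2 $ 1) + cmod (g $ 2 $ 2)"
  unfolding op_norm_def
proof (rule onorm_le)
  fix x :: "complex^2"
  have n: "cmod (g $ i $ j * x $ j) \<le> cmod (g $ i $ j) * norm x" for i j
    unfolding norm_mult by (intro mult_left_mono Finite_Cartesian_Product.norm_nth_le) auto
  have "norm (g *v x) \<le> (\<Sum>i\<in>UNIV. cmod ((g *v x) $ i))"
    by (simp add: norm_vec_def L2_set_le_sum)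
  also have "\<dots> \<le> (cmod (g $ 1 $ 1 * x $ 1) + cmod (g $ 1 $ 2 * x $ 2)) + (cmod (g $ 2 $ 1 * x $ 1) + cmod (g $ 2 $ 2 * x $ 2))"
    by (simp add: sum_2 matrix_vector_2 add_mono norm_triangle_ineq)
  also have "\<dots> \<le> (cmod (g $ 1 $ 1) * norm x + cmod (g $ 1 $ 2) * norm x) + (cmod (g $ 2 $ 1) * norm x + cmod (g $ 2 $ 2) * norm x)"
    by (intro add_mono n)
  finally show "norm (g *v x) \<le> (cmod (g $ 1 $ 1) + cmod (g $ 1 $ 2) + cmod (g $ 2 $ 1) + cmod (g $ 2 $ 2)) * norm x"
    by (simp add: algebra_simps)
qed

lemma op_norm_triangle: "op_norm g \<le> op_norm h + op_norm (g - h)"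
proof -
  have "(*v) g = (\<lambda>x. h *v x + (g - h) *v x)"
    by (auto simp: vec_eq_iff matrix_vector_2 algebra_simps)
  thus ?thesis unfolding op_norm_def
    by (simp add: onorm_triangle[OF bounded_linear_matrix_complex bounded_linear_matrix_complex])
qed

lemma continuous_op_norm: "continuous_on UNIV op_norm"
  unfolding continuous_on_def
proof
  fix h :: "complex^2^2"
  have le: "op_norm k \<le> cmod (k $ 1 $ 1) + cmod (k $ 1 $ 2) + cmod (k $ 2 $ 1) + cmod (k $ 2 $ 2)" for k
    by (rule op_norm_le_entries)
  have "((\<lambda>g. op_norm g - op_norm h) \<longlongrightarrow> 0) (at h)"
  proof (rule Lim_null_comparison)
    let ?e = "\<lambda>k :: complex^2^2. cmod (k $ 1 $ 1) + cmod (k $ 1 $ 2) + cmod (k $ 2 $ 1) + cmod (k $ 2 $ 2)"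
    show "\<forall>\<^sub>F g in at h. norm (op_norm g - op_norm h) \<le> ?e (g - h)"
    proof (intro always_eventually allI)
      fix g
      have "?e (h - g) = ?e (g - h)" by (simp add: norm_minus_commute)
      thus "norm (op_norm g - op_norm h) \<le> ?e (g - h)"
        using op_norm_triangle[of g h] op_norm_triangle[of h g] le[of "g - h"] le[of "h - g"] by (simp add: abs_le_iff)
    qed
    show "((\<lambda>g. ?e (g - h)) \<longlongrightarrow> 0) (at h)"
      by (rule tendsto_eq_intros tendsto_ident_at refl | simp)+
  qed
  thus "(op_norm \<longlongrightarrow> op_norm h) (at h)" by (simp add: LIM_zero_iff)
qed

lemma op_norm_measurable [measurable]: "op_norm \<in> borel_measurable borel"
  by (rule borel_measurable_continuous_onI[OF continuous_op_norm])

fun transfer :: "complex \<Rightarrow> real list \<Rightarrow> complex^2^2" where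
  "transfer z [] = mat 1"
| "transfer z (w # ws) = schroedinger (of_real w - z) ** transfer z ws"

lemma transfer_append: "transfer z (xs @ ys) = transfer z xs ** transfer z ys"
  by (induction xs) (simp_all add: matrix_mul_assoc)

lemma schroedinger_mult_entries:
  "(schroedinger x ** g) $ 1 $ j = x * g $ 1 $ j - g $ 2 $ j"
  "(schroedinger x ** g) $ 2 $ j = g $ 1 $ j"
  by (simp_all add: schroedinger_def matrix_matrix_mult_def sum_2)

lemma transfer_cont:
  "transfer z ws $ 1 $ 1 + \<i> * transfer z ws $ 1 $ 2 = contP (shifted z ws) \<and>
   transfer z ws $ 2 $ 1 + \<i> * transfer z ws $ 2 $ 2 = contQ (shifted z ws)"
proof (induction ws)
  case (Cons w ws)
  have "transfer z (w # ws) $ 1 $ 1 + \<i> * transfer z (w # ws) $ 1 $ 2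
    = (of_real w - z) * (transfer z ws $ 1 $ 1 + \<i> * transfer z ws $ 1 $ 2)
      - (transfer z ws $ 2 $ 1 + \<i> * transfer z ws $ 2 $ 2)"
    by (simp add: schroedinger_mult_entries algebra_simps)
  with Cons show ?case by (simp add: shifted_def schroedinger_mult_entries)
qed (simp add: shifted_def mat_def)

lemma transfer_real: "Im z = 0 \<Longrightarrow> Im (transfer z ws $ i $ j) = 0"
proof (induction ws arbitrary: i j)
  case Nil thus ?case by (simp add: mat_def)
next
  case (Cons w ws)
  thus ?case using exhaust_2[of i] by (auto simp: schroedinger_mult_entries)
qed

lemma cmod_wave_le_op_norm: "cmod (wave (shifted z ws)) \<le> 4 * op_norm (transfer z ws)"
proof -
  let ?A = "transfer z ws"
  have "wave (shifted z ws) = (?A $ 1 $ 1 + \<i> * ?A $ 1 $ 2) - \<i> * (?A $ 2 $ 1 + \<i> * ?A $ 2 $ 2)"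
    by (simp add: wave_def transfer_cont)
  also have "cmod \<dots> \<le> (cmod (?A $ 1 $ 1) + cmod (\<i> * ?A $ 1 $ 2)) + cmod (\<i> * (?A $ 2 $ 1 + \<i> * ?A $ 2 $ 2))"
    by (intro order_trans[OF norm_triangle_ineq4] add_mono norm_triangle_ineq order_refl)
  also have "cmod (\<i> * (?A $ 2 $ 1 + \<i> * ?A $ 2 $ 2)) \<le> cmod (?A $ 2 $ 1) + cmod (?A $ 2 $ 2)"
    using norm_triangle_ineq[of "?A $ 2 $ 1" "\<i> * ?A $ 2 $ 2"] by (simp add: norm_mult)
  finally show ?thesis
    using op_norm_ge_entry[of ?A 1 1] op_norm_ge_entry[of ?A 1 2] op_norm_ge_entry[of ?A 2 1]
      op_norm_ge_entry[of ?A 2 2] by (simp add: norm_mult)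
qed

lemma wave_real_ge:
  assumes "Im z = 0"
  shows "cmod (contP (shifted z ws)) \<le> cmod (wave (shifted z ws))"
    and "cmod (contQ (shifted z ws)) \<le> cmod (wave (shifted z ws))"
    and "1 \<le> cmod (wave (shifted z ws))"
proof -
  have "Im x = 0" if "x \<in> set (shifted z ws)" for x
    using that assms by (auto simp: shifted_def)
  from wave_real_norm[OF this]
  have eq: "(cmod (wave (shifted z ws)))\<^sup>2 = (cmod (contP (shifted z ws)))\<^sup>2 + (cmod (contQ (shifted z ws)))\<^sup>2 + 2" .
  show "cmod (contP (shifted z ws)) \<le> cmod (wave (shifted z ws))"
    by (rule power2_le_imp_le) (use eq in auto)
  show "cmod (contQ (shifted z ws)) \<le> cmod (wave (shifted z ws))"
    by (rule power2_le_imp_le) (use eq in auto)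
  show "1 \<le> cmod (wave (shifted z ws))"
    by (rule power2_le_imp_le) (use eq in auto)
qed

lemma op_norm_le_wave:
  assumes z: "Im z = 0"
  shows "op_norm (transfer z ws) \<le> 4 * cmod (wave (shifted z ws))"
proof -
  let ?A = "transfer z ws"
  have split: "cmod a \<le> cmod (a + \<i> * b) \<and> cmod b \<le> cmod (a + \<i> * b)" if "Im a = 0" "Im b = 0" for a b
    using that abs_Re_le_cmod[of "a + \<i> * b"] abs_Im_le_cmod[of "a + \<i> * b"]
    by (simp add: cmod_eq_Re)
  note r = transfer_real[OF z]
  show ?thesis
    using op_norm_le_entries[of ?A] split[OF r r, of ws 1 1 ws 1 2] split[OF r r, of ws 2 1 ws 2 2]
      wave_real_ge[OF z, of ws] transfer_cont[of z ws] by simp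
qed

section \<open>Independent words and exchange of integrals\<close>

lemma nn_integral_measure_pmf_countable:
  "(\<integral>\<^sup>+ i. f i \<partial>measure_pmf p) = (\<integral>\<^sup>+ i. ennreal (pmf p i) * f i \<partial>count_space (set_pmf p))"
  unfolding nn_integral_measure_pmf
  by (rule nn_integral_count_space_eq) (auto simp: set_pmf_eq)

text \<open>A probability mass function has countable support, which allows exchanging integrals without any
joint measurability on the possibly uncountable underlying type.\<close>

lemma nn_integral_pmf_swap:
  fixes f :: "'i \<Rightarrow> 'a \<Rightarrow> ennreal"
  assumes [measurable]: "\<And>i. f i \<in> borel_measurable M"
  shows "(\<integral>\<^sup>+x. \<integral>\<^sup>+i. f i x \<partial>measure_pmf p \<partial>M) = (\<integral>\<^sup>+i. \<integral>\<^sup>+x. f i x \<partial>M \<partial>measure_pmf p)"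
  unfolding nn_integral_measure_pmf_countable
  by (subst nn_integral_count_space_nn_integral) (simp_all add: nn_integral_cmult)

lemma borel_measurable_nn_integral_pmf:
  fixes f :: "'i \<Rightarrow> 'a \<Rightarrow> ennreal"
  assumes [measurable]: "\<And>i. f i \<in> borel_measurable M"
  shows "(\<lambda>x. \<integral>\<^sup>+i. f i x \<partial>measure_pmf p) \<in> borel_measurable M"
proof -
  interpret sigma_finite_measure "count_space (set_pmf p)"
    by (rule sigma_finite_measure_count_space_countable) simp
  have "(\<lambda>(i, x). ennreal (pmf p i) * f i x) \<in> borel_measurable (count_space (set_pmf p) \<Otimes>\<^sub>M M)"
    by (rule measurable_pair_measure_countable1) auto
  hence "(\<lambda>(x, i). ennreal (pmf p i) * f i x) \<in> borel_measurable (M \<Otimes>\<^sub>M count_space (set_pmf p))"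
    by (subst (asm) measurable_pair_swap_iff) (simp add: case_prod_unfold)
  thus ?thesis
    unfolding nn_integral_measure_pmf_countable by (rule borel_measurable_nn_integral)
qed

lemma integral_pmf_swap:
  fixes f :: "'i \<Rightarrow> 'a \<Rightarrow> real"
  assumes meas [measurable]: "\<And>i. f i \<in> borel_measurable M"
    and nonneg: "\<And>i x. 0 \<le> f i x"
    and int_pmf: "\<And>x. integrable (measure_pmf p) (\<lambda>i. f i x)"
    and int_M: "\<And>i. integrable M (f i)"
    and int: "integrable (measure_pmf p) (\<lambda>i. integral\<^sup>L M (f i))"
  shows "has_bochner_integral M (\<lambda>x. measure_pmf.expectation p (\<lambda>i. f i x))
    (measure_pmf.expectation p (\<lambda>i. integral\<^sup>L M (f i)))"
proof (rule has_bochner_integral_nn_integral)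
  have eq: "ennreal (measure_pmf.expectation p (\<lambda>i. f i x)) = (\<integral>\<^sup>+i. ennreal (f i x) \<partial>measure_pmf p)" for x
    by (rule nn_integral_eq_integral[symmetric]) (auto simp: int_pmf nonneg)
  have "(\<lambda>x. enn2real (\<integral>\<^sup>+i. ennreal (f i x) \<partial>measure_pmf p)) \<in> borel_measurable M"
    by (intro measurable_compose[OF borel_measurable_nn_integral_pmf borel_measurable_enn2real]) auto
  also have "(\<lambda>x. enn2real (\<integral>\<^sup>+i. ennreal (f i x) \<partial>measure_pmf p)) = (\<lambda>x. measure_pmf.expectation p (\<lambda>i. f i x))"
    unfolding eq[symmetric] by (simp add: nonneg)
  finally show "(\<lambda>x. measure_pmf.expectation p (\<lambda>i. f i x)) \<in> borel_measurable M" .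
  show "(\<integral>\<^sup>+x. ennreal (measure_pmf.expectation p (\<lambda>i. f i x)) \<partial>M)
     = ennreal (measure_pmf.expectation p (\<lambda>i. integral\<^sup>L M (f i)))"
    unfolding eq
    by (subst nn_integral_pmf_swap)
       (auto simp: nonneg int_M nn_integral_eq_integral int)
qed (auto simp: nonneg)

lemma replicate_pmf_Suc_pair:
  "replicate_pmf (Suc n) p = map_pmf (\<lambda>(x, xs). x # xs) (pair_pmf p (replicate_pmf n p))"
  by (simp add: pair_pmf_def map_pmf_def bind_assoc_pmf bind_return_pmf)

lemma replicate_pmf_append_pair:
  "replicate_pmf (m + n) p = map_pmf (\<lambda>(xs, ys). xs @ ys) (pair_pmf (replicate_pmf m p) (replicate_pmf n p))"
  by (simp add: replicate_pmf_distrib pair_pmf_def map_pmf_def bind_assoc_pmf bind_return_pmf)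

lemma integrable_pair_pmf_fst:
  fixes f :: "'a \<Rightarrow> real"
  assumes "integrable (measure_pmf p) f"
  shows "integrable (measure_pmf (pair_pmf p q)) (\<lambda>x. f (fst x))"
  using integrable_map_pmf_eq[of fst "pair_pmf p q" f] assms by (simp add: map_fst_pair_pmf)

lemma integrable_pair_pmf_snd:
  fixes f :: "'b \<Rightarrow> real"
  assumes "integrable (measure_pmf q) f"
  shows "integrable (measure_pmf (pair_pmf p q)) (\<lambda>x. f (snd x))"
  using integrable_map_pmf_eq[of snd "pair_pmf p q" f] assms by (simp add: map_snd_pair_pmf)

lemma replicate_pmf_sum:
  fixes f :: "'a \<Rightarrow> real"
  assumes "integrable (measure_pmf p) f"
  shows "integrable (measure_pmf (replicate_pmf n p)) (\<lambda>xs. \<Sum>x\<leftarrow>xs. f x) \<and>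
    measure_pmf.expectation (replicate_pmf n p) (\<lambda>xs. \<Sum>x\<leftarrow>xs. f x)
      = real n * measure_pmf.expectation p f"
proof (induction n)
  case (Suc n)
  have "integrable (measure_pmf (pair_pmf p (replicate_pmf n p))) (\<lambda>y. f (fst y) + (\<Sum>x\<leftarrow>snd y. f x))"
    by (intro Bochner_Integration.integrable_add integrable_pair_pmf_fst integrable_pair_pmf_snd[where f = "\<lambda>xs. \<Sum>x\<leftarrow>xs. f x"])
       (use assms Suc in auto)
  moreover have "measure_pmf.expectation (pair_pmf p (replicate_pmf n p)) (\<lambda>y. f (fst y) + (\<Sum>x\<leftarrow>snd y. f x))
     = measure_pmf.expectation p f + real n * measure_pmf.expectation p f"
    using Suc assms
    by (subst Bochner_Integration.integral_add)
       (auto intro!: integrable_pair_pmf_fst integrable_pair_pmf_snd[where f = "\<lambda>xs. \<Sum>x\<leftarrow>xs. f x"]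
         simp: expectation_pair_pmf_snd[where f = "\<lambda>xs. \<Sum>x\<leftarrow>xs. f x"])
  ultimately show ?case
    unfolding replicate_pmf_Suc_pair by (simp add: case_prod_unfold algebra_simps)
qed (simp add: integrable_measure_pmf_finite)

lemma replicate_pmf_rev: "map_pmf rev (replicate_pmf n p) = replicate_pmf n p"
proof (induction n)
  case (Suc n)
  have "map_pmf rev (replicate_pmf (Suc n) p) = map_pmf (\<lambda>(x, xs). rev xs @ [x]) (pair_pmf p (replicate_pmf n p))"
    unfolding replicate_pmf_Suc_pair by (simp add: pmf.map_comp o_def case_prod_unfold)
  also have "\<dots> = map_pmf (\<lambda>(xs, x). xs @ [x]) (pair_pmf (map_pmf rev (replicate_pmf n p)) p)"
    unfolding pair_commute_pmf[of p] pair_map_pmf1 pmf.map_comp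
    by (intro map_pmf_cong refl) auto
  also have "\<dots> = map_pmf (\<lambda>(xs, x). xs @ [x]) (pair_pmf (replicate_pmf n p) p)"
    by (simp only: Suc)
  also have "\<dots> = replicate_pmf (n + 1) p"
    unfolding replicate_pmf_append_pair replicate_pmf_1 pair_map_pmf2 pmf.map_comp
    by (intro map_pmf_cong refl) auto
  finally show ?case by simp
qed simp

lemma emeasure_pair_pmf:
  "emeasure (measure_pmf (pair_pmf p q)) S = (\<integral>\<^sup>+a. emeasure (measure_pmf q) (Pair a -` S) \<partial>measure_pmf p)"
proof -
  have "pair_pmf p q = bind_pmf p (\<lambda>a. map_pmf (Pair a) q)"
    by (simp add: pair_pmf_def map_pmf_def)
  thus ?thesis by (simp only: emeasure_bind_pmf emeasure_map_pmf)
qed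

lemma prob_pair_pmf_Times:
  "measure_pmf.prob (pair_pmf p q) (A \<times> B) = measure_pmf.prob p A * measure_pmf.prob q B"
proof -
  have "Pair a -` (A \<times> B) = (if a \<in> A then B else {})" for a by auto
  hence "emeasure (measure_pmf (pair_pmf p q)) (A \<times> B)
      = (\<integral>\<^sup>+a. emeasure (measure_pmf q) B * indicator A a \<partial>measure_pmf p)"
    unfolding emeasure_pair_pmf by (intro nn_integral_cong) (auto simp: indicator_def)
  also have "\<dots> = emeasure (measure_pmf p) A * emeasure (measure_pmf q) B"
    by (subst nn_integral_cmult) (auto simp: mult.commute)
  finally show ?thesis
    by (simp add: measure_pmf.emeasure_eq_measure ennreal_mult[symmetric])
qed

section \<open>The Lyapunov exponent of a random potential\<close>

text \<open>Fekete's lemma, in the case where nonnegativity makes the limit finite.\<close>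

lemma nonneg_subadditive_convergent:
  fixes b :: "nat \<Rightarrow> real"
  assumes nonneg: "\<And>n. 0 \<le> b n" and sub: "\<And>m n. b (m + n) \<le> b m + b n"
  shows "convergent (\<lambda>n. b n / real n)"
proof -
  define l where "l = (INF n\<in>{1..}. b n / real n)"
  have bdd: "bdd_below ((\<lambda>n. b n / real n) ` {1..})"
    by (rule bdd_belowI[of _ 0]) (auto simp: nonneg)
  have mult: "b (q * m) \<le> real q * b m + b 0" for q m
  proof (induction q)
    case (Suc q)
    have "b (Suc q * m) \<le> b m + b (q * m)" using sub[of m "q * m"] by simp
    with Suc show ?case by (simp add: algebra_simps)
  qed simp
  have "(\<lambda>n. b n / real n) \<longlonglongrightarrow> l"
  proof (rule LIMSEQ_I)
    fix e :: real assume e: "0 < e"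
    have "l < l + e / 2" using e by simp
    hence "\<exists>y\<in>(\<lambda>n. b n / real n) ` {1..}. y < l + e / 2"
      unfolding l_def by (subst (asm) cInf_less_iff) (use bdd in auto)
    then obtain m where m: "1 \<le> m" "b m / real m < l + e / 2" by auto
    define K where "K = b 0 + (\<Sum>r<m. b r)"
    have K: "0 \<le> K" unfolding K_def by (intro add_nonneg_nonneg sum_nonneg nonneg)
    obtain N where N: "2 * K / e < real N" using reals_Archimedean2 by blast
    have "\<bar>b n / real n - l\<bar> < e" if n: "max 1 N \<le> n" for n
    proof -
      have n1: "1 \<le> n" "N \<le> n" using n by auto
      have "b n \<le> b (n div m * m) + b (n mod m)" using sub[of "n div m * m" "n mod m"] by simp
      also have "b (n mod m) \<le> (\<Sum>r<m. b r)"
        using m by (intro member_le_sum) (auto simp: nonneg)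
      also have "b (n div m * m) \<le> real (n div m) * b m + b 0" by (rule mult)
      also have "real (n div m) * b m \<le> real n / real m * b m"
        by (intro mult_right_mono nonneg) (rule of_nat_div_le_of_nat)
      finally have "b n \<le> real n * (b m / real m) + K" by (simp add: K_def)
      hence "b n / real n \<le> b m / real m + K / real n"
        using n1 by (simp add: field_simps)
      also have "K / real n < e / 2"
      proof -
        have "2 * K / e < real n" using N n1 by linarith
        thus ?thesis using e n1 by (simp add: field_simps)
      qed
      finally have "b n / real n < l + e" using m(2) by simp
      moreover have "l \<le> b n / real n" unfolding l_def using n1 bdd by (intro cINF_lower) auto
      ultimately show ?thesis by simp
    qed
    thus "\<exists>no. \<forall>n\<ge>no. norm (b n / real n - l) < e"
      by (intro exI[of _ "max 1 N"]) auto
  qed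
  thus ?thesis by (rule convergentI)
qed

text \<open>On the real axis \<open>|wave| \<ge> 1\<close>; the Poisson formula carries this bound into the upper half plane.\<close>

lemma wave_ln_nonneg:
  assumes "0 \<le> Im z"
  shows "0 \<le> ln (cmod (wave (shifted z ws)))"
proof (cases "Im z = 0")
  case True
  thus ?thesis using wave_real_ge(3)[OF True] by simp
next
  case False
  hence \<eta>: "0 < Im z" using assms by simp
  let ?p = "pcompose (poly_wave ws) [:of_real (Re z), of_real (Im z):]"
  have p: "poly ?p u = wave (shifted (of_real (Re z) + of_real (Im z) * u) ws)" for u
    by (simp add: poly_pcompose poly_wave mult.commute)
  have "poly ?p u \<noteq> 0" if "0 \<le> Im u" for u
    unfolding p by (rule wave_nonzero) (use that \<eta> in \<open>auto simp: shifted_def\<close>)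
  from poisson_poly[of ?p, OF this]
  have "has_bochner_integral lborel
      (\<lambda>u. cauchy_density u * ln (cmod (wave (shifted (of_real (Re z) + of_real (Im z) * of_real u) ws))))
      (ln (cmod (wave (shifted (of_real (Re z) + of_real (Im z) * \<i>) ws))))"
    by (simp add: p)
  moreover have "of_real (Re z) + of_real (Im z) * \<i> = z" by (simp add: complex_eq_iff)
  moreover have "0 \<le> cauchy_density u * ln (cmod (wave (shifted (of_real (Re z) + of_real (Im z) * of_real u) ws)))" for u
    using wave_real_ge(3)[of "of_real (Re z) + of_real (Im z) * of_real u" ws]
    by (intro mult_nonneg_nonneg cauchy_density_nonneg) simp
  ultimately show ?thesis
    by (simp add: has_bochner_integral_iff) (metis (no_types, lifting) AE_I2 integral_nonneg_AE)
qed

lemma add_le_one_plus_mult: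
  fixes x y :: real
  assumes "0 \<le> x" "0 \<le> y"
  shows "x + y + 1 \<le> (1 + x) * (1 + y)"
  using mult_nonneg_nonneg[OF assms] by (simp add: algebra_simps)

lemma wave_ln_le:
  assumes "0 \<le> Im z"
  shows "ln (cmod (wave (shifted z ws))) \<le> ln 2 + (\<Sum>w\<leftarrow>ws. ln (1 + \<bar>w\<bar>) + ln (1 + cmod z))"
proof -
  have nz: "wave (shifted z ws) \<noteq> 0"
    by (rule wave_nonzero) (use assms in \<open>auto simp: shifted_def\<close>)
  have prod: "0 < (\<Prod>x\<leftarrow>shifted z ws. cmod x + 1) \<and>
     ln (\<Prod>x\<leftarrow>shifted z ws. cmod x + 1) \<le> (\<Sum>w\<leftarrow>ws. ln (1 + \<bar>w\<bar>) + ln (1 + cmod z))"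
  proof (induction ws)
    case (Cons w ws)
    have "cmod (of_real w - z) + 1 \<le> (1 + \<bar>w\<bar>) * (1 + cmod z)"
      using norm_triangle_ineq4[of "of_real w" z] add_le_one_plus_mult[of "\<bar>w\<bar>" "cmod z"] by simp
    hence "ln (cmod (of_real w - z) + 1) \<le> ln ((1 + \<bar>w\<bar>) * (1 + cmod z))"
      by (intro ln_mono) (auto intro: add_nonneg_pos)
    also have "\<dots> = ln (1 + \<bar>w\<bar>) + ln (1 + cmod z)"
      by (intro ln_mult_pos add_pos_nonneg) auto
    finally have "ln (cmod (of_real w - z) + 1) \<le> ln (1 + \<bar>w\<bar>) + ln (1 + cmod z)" .
    moreover have "0 < cmod (of_real w - z) + 1" by (intro add_nonneg_pos) auto
    ultimately show ?case using Cons by (simp add: shifted_def ln_mult_pos)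
  qed (simp add: shifted_def)
  have "ln (cmod (wave (shifted z ws))) \<le> ln (2 * (\<Prod>x\<leftarrow>shifted z ws. cmod x + 1))"
    using nz cmod_wave_le[of "shifted z ws"] by (intro ln_mono) auto
  also have "\<dots> = ln 2 + ln (\<Prod>x\<leftarrow>shifted z ws. cmod x + 1)" using prod by (subst ln_mult_pos) auto
  finally show ?thesis using prod by simp
qed

text \<open>A random potential with independent entries of law \<open>\<nu>\<close>. The logarithmic moment is what makes the
Lyapunov exponent finite.\<close>

locale log_moment_pmf =
  fixes \<nu> :: "real pmf"
  assumes log_moment: "integrable (measure_pmf \<nu>) (\<lambda>w. ln (1 + \<bar>w\<bar>))"
begin

definition mean_log_wave :: "nat \<Rightarrow> complex \<Rightarrow> real" where
  "mean_log_wave n z = measure_pmf.expectation (replicate_pmf n \<nu>) (\<lambda>ws. ln (cmod (wave (shifted z ws))))"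

definition mean_log_norm :: "nat \<Rightarrow> complex \<Rightarrow> real" where
  "mean_log_norm n z = measure_pmf.expectation (replicate_pmf n \<nu>) (\<lambda>ws. ln (op_norm (transfer z ws)))"

text \<open>The Lyapunov exponent at real energy \<open>E\<close>, expressed through words of potential values
instead of convolution powers of a measure on matrices.\<close>

definition lyap :: "real \<Rightarrow> real" where
  "lyap E = lim (\<lambda>n. mean_log_norm n (of_real E) / real n)"

abbreviation log_mean :: real where
  "log_mean \<equiv> measure_pmf.expectation \<nu> (\<lambda>w. ln (1 + \<bar>w\<bar>))"

lemma log_mean_nonneg: "0 \<le> log_mean"
  by (rule integral_nonneg_AE) auto

lemma bound_integrable:
  "integrable (measure_pmf (replicate_pmf n \<nu>)) (\<lambda>ws. c + (\<Sum>w\<leftarrow>ws. ln (1 + \<bar>w\<bar>) + d))"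
  "measure_pmf.expectation (replicate_pmf n \<nu>) (\<lambda>ws. c + (\<Sum>w\<leftarrow>ws. ln (1 + \<bar>w\<bar>) + d))
     = c + real n * (log_mean + d)"
proof -
  have "integrable (measure_pmf \<nu>) (\<lambda>w. ln (1 + \<bar>w\<bar>) + d)"
    "measure_pmf.expectation \<nu> (\<lambda>w. ln (1 + \<bar>w\<bar>) + d) = log_mean + d"
    using log_moment by (auto simp: Bochner_Integration.integral_add)
  with replicate_pmf_sum[OF this(1), of n]
  show "integrable (measure_pmf (replicate_pmf n \<nu>)) (\<lambda>ws. c + (\<Sum>w\<leftarrow>ws. ln (1 + \<bar>w\<bar>) + d))"
    "measure_pmf.expectation (replicate_pmf n \<nu>) (\<lambda>ws. c + (\<Sum>w\<leftarrow>ws. ln (1 + \<bar>w\<bar>) + d))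
     = c + real n * (log_mean + d)"
    by auto
qed

lemma log_wave_integrable:
  assumes "0 \<le> Im z"
  shows "integrable (measure_pmf (replicate_pmf n \<nu>)) (\<lambda>ws. ln (cmod (wave (shifted z ws))))"
  using wave_ln_nonneg[OF assms] wave_ln_le[OF assms]
  by (intro Bochner_Integration.integrable_bound[OF bound_integrable(1)[of n "ln 2" "ln (1 + cmod z)"]] AE_I2)
     (auto intro: order_trans[OF _ abs_ge_self])

lemma mean_log_wave_nonneg: "0 \<le> Im z \<Longrightarrow> 0 \<le> mean_log_wave n z"
  unfolding mean_log_wave_def by (intro integral_nonneg_AE AE_I2 wave_ln_nonneg)

lemma mean_log_wave_le:
  assumes "0 \<le> Im z"
  shows "mean_log_wave n z \<le> ln 2 + real n * (log_mean + ln (1 + cmod z))"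
  unfolding mean_log_wave_def bound_integrable(2)[symmetric]
  by (intro integral_mono log_wave_integrable bound_integrable assms wave_ln_le)

lemma op_norm_transfer_log:
  assumes "Im z = 0"
  shows "\<bar>ln (op_norm (transfer z ws)) - ln (cmod (wave (shifted z ws)))\<bar> \<le> ln 4"
    and "0 < op_norm (transfer z ws)"
proof -
  let ?a = "op_norm (transfer z ws)" and ?b = "cmod (wave (shifted z ws))"
  have ab: "?b \<le> 4 * ?a" "?a \<le> 4 * ?b" "1 \<le> ?b"
    using cmod_wave_le_op_norm op_norm_le_wave[OF assms] wave_real_ge(3)[OF assms] by auto
  thus pos: "0 < ?a" by linarith
  have "ln ?b \<le> ln (4 * ?a)" "ln ?a \<le> ln (4 * ?b)" using ab pos by (auto intro!: ln_mono)
  moreover have "ln (4 * ?a) = ln 4 + ln ?a" "ln (4 * ?b) = ln 4 + ln ?b"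
    using pos ab(3) by (auto intro!: ln_mult_pos)
  ultimately show "\<bar>ln ?a - ln ?b\<bar> \<le> ln 4" by linarith
qed

lemma log_norm_integrable:
  assumes z: "Im z = 0"
  shows "integrable (measure_pmf (replicate_pmf n \<nu>)) (\<lambda>ws. ln (op_norm (transfer z ws)))"
proof -
  have "integrable (measure_pmf (replicate_pmf n \<nu>)) (\<lambda>ws. ln (op_norm (transfer z ws)) - ln (cmod (wave (shifted z ws))))"
    using op_norm_transfer_log(1)[OF z] by (intro measure_pmf.integrable_const_bound[where B = "ln 4"]) auto
  from Bochner_Integration.integrable_add[OF this log_wave_integrable[of z n]] z show ?thesis by simp
qed

lemma mean_log_norm_wave:
  assumes z: "Im z = 0"
  shows "\<bar>mean_log_norm n z - mean_log_wave n z\<bar> \<le> ln 4"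
proof -
  have "mean_log_norm n z - mean_log_wave n z
    = measure_pmf.expectation (replicate_pmf n \<nu>) (\<lambda>ws. ln (op_norm (transfer z ws)) - ln (cmod (wave (shifted z ws))))"
    unfolding mean_log_norm_def mean_log_wave_def using z
    by (intro Bochner_Integration.integral_diff[symmetric] log_norm_integrable log_wave_integrable) auto
  also have "\<bar>\<dots>\<bar> \<le> measure_pmf.expectation (replicate_pmf n \<nu>) (\<lambda>ws. \<bar>ln (op_norm (transfer z ws)) - ln (cmod (wave (shifted z ws)))\<bar>)"
    by (rule integral_abs_bound)
  also have "\<dots> \<le> measure_pmf.expectation (replicate_pmf n \<nu>) (\<lambda>ws. ln 4)"
    using op_norm_transfer_log(1)[OF z] log_norm_integrable[OF z, of n] log_wave_integrable[of z n] z
    by (intro integral_mono) auto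
  finally show ?thesis by simp
qed

lemma mean_log_norm_subadditive:
  assumes z: "Im z = 0"
  shows "mean_log_norm (m + n) z \<le> mean_log_norm m z + mean_log_norm n z"
proof -
  let ?f = "\<lambda>ws. ln (op_norm (transfer z ws))"
  let ?P = "pair_pmf (replicate_pmf m \<nu>) (replicate_pmf n \<nu>)"
  have int: "integrable (measure_pmf ?P) (\<lambda>y. ?f (fst y))" "integrable (measure_pmf ?P) (\<lambda>y. ?f (snd y))"
    by (intro integrable_pair_pmf_fst[where f = ?f] integrable_pair_pmf_snd[where f = ?f] log_norm_integrable z)+
  have "mean_log_norm (m + n) z = measure_pmf.expectation ?P (\<lambda>y. ?f (fst y @ snd y))"
    unfolding mean_log_norm_def replicate_pmf_append_pair by (simp add: case_prod_unfold)
  also have "\<dots> \<le> measure_pmf.expectation ?P (\<lambda>y. ?f (fst y) + ?f (snd y))"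
  proof (intro integral_mono Bochner_Integration.integrable_add int)
    show "integrable (measure_pmf ?P) (\<lambda>y. ?f (fst y @ snd y))"
      using log_norm_integrable[OF z, of "m + n"] unfolding replicate_pmf_append_pair
      by (simp add: case_prod_unfold)
    fix y
    have "?f (fst y @ snd y) \<le> ln (op_norm (transfer z (fst y)) * op_norm (transfer z (snd y)))"
      unfolding transfer_append
      using op_norm_transfer_log(2)[OF z, of "fst y @ snd y"] by (intro ln_mono op_norm_mult) (simp_all add: transfer_append)
    thus "?f (fst y @ snd y) \<le> ?f (fst y) + ?f (snd y)"
      using op_norm_transfer_log(2)[OF z] by (simp add: ln_mult_pos)
  qed
  also have "\<dots> = mean_log_norm m z + mean_log_norm n z"
    unfolding mean_log_norm_def using int
    by (subst Bochner_Integration.integral_add)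
       (auto simp: expectation_pair_pmf_fst[where f = ?f] expectation_pair_pmf_snd[where f = ?f])
  finally show ?thesis .
qed

lemma lyap_LIMSEQ: "(\<lambda>n. mean_log_norm n (of_real E) / real n) \<longlonglongrightarrow> lyap E"
proof -
  let ?b = "\<lambda>n. mean_log_norm n (of_real E) + ln 4"
  have "convergent (\<lambda>n. ?b n / real n)"
  proof (rule nonneg_subadditive_convergent)
    show "0 \<le> ?b n" for n
      using mean_log_norm_wave[of "of_real E" n] mean_log_wave_nonneg[of "of_real E" n] by simp
    show "?b (m + n) \<le> ?b m + ?b n" for m n
      using mean_log_norm_subadditive[of "of_real E" m n] by (simp add: add_increasing)
  qed
  moreover have "(\<lambda>n. ln 4 / real n) \<longlonglongrightarrow> 0" by real_asymp
  hence "convergent (\<lambda>n. ln 4 / real n)" by (rule convergentI)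
  ultimately have "convergent (\<lambda>n. ?b n / real n - ln 4 / real n)" by (rule convergent_diff)
  thus ?thesis unfolding lyap_def by (simp add: convergent_LIMSEQ_iff add_divide_distrib)
qed

lemma lyap_LIMSEQ_wave: "(\<lambda>n. mean_log_wave n (of_real E) / real n) \<longlonglongrightarrow> lyap E"
proof -
  have "(\<lambda>n. mean_log_norm n (of_real E) / real n - mean_log_wave n (of_real E) / real n) \<longlonglongrightarrow> 0"
  proof (rule Lim_null_comparison)
    show "(\<lambda>n. ln 4 / real n) \<longlonglongrightarrow> 0" by real_asymp
    show "\<forall>\<^sub>F n in sequentially. norm (mean_log_norm n (of_real E) / real n - mean_log_wave n (of_real E) / real n) \<le> ln 4 / real n"
      using mean_log_norm_wave[of "of_real E"]
      by (intro always_eventually allI) (simp add: divide_right_mono flip: diff_divide_distrib)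
  qed
  from tendsto_diff[OF lyap_LIMSEQ[of E] this] show ?thesis by simp
qed

lemma lyap_nonneg: "0 \<le> lyap E"
  by (rule LIMSEQ_le_const[OF lyap_LIMSEQ_wave]) (auto intro!: exI[of _ 0] divide_nonneg_nonneg mean_log_wave_nonneg)

lemma mean_log_wave_rate_le:
  "mean_log_wave n (of_real E) / real n \<le> ln 2 + log_mean + ln (1 + \<bar>E\<bar>)"
proof (cases "n = 0")
  case True
  thus ?thesis using log_mean_nonneg by simp
next
  case False
  have "mean_log_wave n (of_real E) / real n \<le> ln 2 / real n + (log_mean + ln (1 + \<bar>E\<bar>))"
    using mean_log_wave_le[of "of_real E" n] False by (simp add: field_simps)
  also have "ln 2 / real n \<le> ln 2 / 1" using False by (intro divide_left_mono) auto
  finally show ?thesis by simp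
qed

lemma lyap_le: "lyap E \<le> ln 2 + log_mean + ln (1 + \<bar>E\<bar>)"
  by (rule LIMSEQ_le_const2[OF lyap_LIMSEQ_wave]) (auto intro!: exI[of _ 0] mean_log_wave_rate_le)

lemma ln_affine_le:
  "ln 2 + log_mean + ln (1 + \<bar>a + \<eta> * u\<bar>) \<le> (ln 2 + log_mean + ln (1 + \<bar>a\<bar>) + 2 * \<bar>\<eta>\<bar> powr (1 / 2) + 2) * (1 + \<bar>u\<bar> powr (1 / 2))"
  (is "_ \<le> ?A * _")
proof -
  have "1 + \<bar>a + \<eta> * u\<bar> \<le> (1 + \<bar>a\<bar>) * (1 + \<bar>\<eta> * u\<bar>)"
    using abs_triangle_ineq[of a "\<eta> * u"] add_le_one_plus_mult[of "\<bar>a\<bar>" "\<bar>\<eta> * u\<bar>"] by linarith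
  hence "ln (1 + \<bar>a + \<eta> * u\<bar>) \<le> ln ((1 + \<bar>a\<bar>) * (1 + \<bar>\<eta> * u\<bar>))"
    by (intro ln_mono) auto
  also have "\<dots> = ln (1 + \<bar>a\<bar>) + ln (1 + \<bar>\<eta> * u\<bar>)" by (intro ln_mult_pos) auto
  also have "ln (1 + \<bar>\<eta> * u\<bar>) \<le> 2 * (1 + \<bar>\<eta> * u\<bar>) powr (1 / 2)" by (intro ln_le_sqrt) auto
  also have "(1 + \<bar>\<eta> * u\<bar>) powr (1 / 2) \<le> 1 + \<bar>\<eta> * u\<bar> powr (1 / 2)"
    using sqrt_add_le[of 1 "\<bar>\<eta> * u\<bar>"] by simp
  also have "\<bar>\<eta> * u\<bar> powr (1 / 2) = \<bar>\<eta>\<bar> powr (1 / 2) * \<bar>u\<bar> powr (1 / 2)"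
    by (simp add: abs_mult powr_mult)
  finally have "ln 2 + log_mean + ln (1 + \<bar>a + \<eta> * u\<bar>) \<le> ln 2 + log_mean + ln (1 + \<bar>a\<bar>) + 2 + 2 * \<bar>\<eta>\<bar> powr (1 / 2) * \<bar>u\<bar> powr (1 / 2)"
    by simp
  also have "\<dots> \<le> ?A * (1 + \<bar>u\<bar> powr (1 / 2))"
  proof -
    have "0 \<le> (ln 2 + log_mean + ln (1 + \<bar>a\<bar>) + 2) * \<bar>u\<bar> powr (1 / 2) + 2 * \<bar>\<eta>\<bar> powr (1 / 2)"
      using log_mean_nonneg by simp
    thus ?thesis by (simp add: algebra_simps)
  qed
  finally show ?thesis .
qed

text \<open>Affine substitution moves the Poisson formula at \<open>\<i>\<close> to the point \<open>a + \<i> \<eta>\<close>, and it survives averaging over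
the random words.\<close>

lemma poisson_mean_log_wave:
  assumes \<eta>: "0 < \<eta>"
  shows "has_bochner_integral lborel (\<lambda>u. cauchy_density u * mean_log_wave n (of_real (a + \<eta> * u)))
    (mean_log_wave n (of_real a + \<i> * of_real \<eta>))"
proof -
  let ?f = "\<lambda>ws u. cauchy_density u * ln (cmod (wave (shifted (of_real (a + \<eta> * u)) ws)))"
  have P: "has_bochner_integral lborel (?f ws) (ln (cmod (wave (shifted (of_real a + \<i> * of_real \<eta>) ws))))" for ws
  proof -
    let ?p = "pcompose (poly_wave ws) [:of_real a, of_real \<eta>:]"
    have p: "poly ?p u = wave (shifted (of_real a + u * of_real \<eta>) ws)" for u
      by (simp add: poly_pcompose poly_wave)
    have "poly ?p u \<noteq> 0" if "0 \<le> Im u" for u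
      unfolding p by (rule wave_nonzero) (use that \<eta> in \<open>auto simp: shifted_def\<close>)
    from poisson_poly[of ?p, OF this] show ?thesis by (simp add: p mult.commute[of \<eta>])
  qed
  have int: "integrable lborel (?f ws)" "integral\<^sup>L lborel (?f ws) = ln (cmod (wave (shifted (of_real a + \<i> * of_real \<eta>) ws)))" for ws
    using P[of ws] by (auto simp: has_bochner_integral_iff)
  have "has_bochner_integral lborel (\<lambda>u. measure_pmf.expectation (replicate_pmf n \<nu>) (\<lambda>ws. ?f ws u))
    (measure_pmf.expectation (replicate_pmf n \<nu>) (\<lambda>ws. integral\<^sup>L lborel (?f ws)))"
  proof (rule integral_pmf_swap)
    show "?f ws \<in> borel_measurable lborel" for ws using int(1)[of ws] by (rule borel_measurable_integrable)
    show "0 \<le> ?f ws u" for ws u by (intro mult_nonneg_nonneg cauchy_density_nonneg wave_ln_nonneg) simp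
    show "integrable (measure_pmf (replicate_pmf n \<nu>)) (\<lambda>ws. ?f ws u)" for u
      by (intro integrable_mult_right log_wave_integrable) simp
    show "integrable (measure_pmf (replicate_pmf n \<nu>)) (\<lambda>ws. integral\<^sup>L lborel (?f ws))"
      unfolding int(2) by (rule log_wave_integrable) (use \<eta> in simp)
  qed (rule int(1))
  thus ?thesis unfolding int(2) by (simp add: mean_log_wave_def)
qed

lemma lyap_measurable [measurable]: "lyap \<in> borel_measurable borel"
proof (rule borel_measurable_LIMSEQ_real[OF lyap_LIMSEQ_wave])
  fix n
  have *: "(\<lambda>E. poly (poly_wave ws) (complex_of_real E)) \<in> borel_measurable borel" for ws
    by (intro borel_measurable_continuous_onI continuous_intros)
  have eq: "mean_log_wave n (of_real E) = enn2real (\<integral>\<^sup>+ws. ennreal (ln (cmod (wave (shifted (of_real E) ws)))) \<partial>replicate_pmf n \<nu>)" for E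
    unfolding mean_log_wave_def
    by (subst nn_integral_eq_integral)
       (auto intro!: log_wave_integrable wave_ln_nonneg integral_nonneg_AE enn2real_ennreal[symmetric])
  show "(\<lambda>E. mean_log_wave n (of_real E) / real n) \<in> borel_measurable borel"
    unfolding eq using *
    by (intro borel_measurable_divide measurable_compose[OF borel_measurable_nn_integral_pmf borel_measurable_enn2real])
       (auto simp flip: poly_wave)
qed

lemma lyap_cauchy_integrable: "integrable lborel (\<lambda>u. cauchy_density u * lyap (a + \<eta> * u))"
  by (rule cauchy_integrable_bound[where A = "ln 2 + log_mean + ln (1 + \<bar>a\<bar>) + 2 * \<bar>\<eta>\<bar> powr (1 / 2) + 2"])
     (use order_trans[OF lyap_le ln_affine_le] lyap_nonneg in auto)

text \<open>The growth rate at the complex energy \<open>a + \<i> \<eta>\<close> is the harmonic extension of the Lyapunov exponent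
on the real line. Only this identity relates real energies, where regularity is assumed, to complex ones,
where the resonances can be counted.\<close>

lemma poisson_lyap_LIMSEQ:
  assumes \<eta>: "0 < \<eta>"
  shows "(\<lambda>n. mean_log_wave n (of_real a + \<i> * of_real \<eta>) / real n)
    \<longlonglongrightarrow> (\<integral>u. cauchy_density u * lyap (a + \<eta> * u) \<partial>lborel)"
proof -
  let ?A = "ln 2 + log_mean + ln (1 + \<bar>a\<bar>) + 2 * \<bar>\<eta>\<bar> powr (1 / 2) + 2"
  let ?w = "\<lambda>u. cauchy_density u * (?A * (1 + \<bar>u\<bar> powr (1 / 2)))"
  have "(\<lambda>n. \<integral>u. cauchy_density u * mean_log_wave n (of_real (a + \<eta> * u)) / real n \<partial>lborel)
    \<longlonglongrightarrow> (\<integral>u. cauchy_density u * lyap (a + \<eta> * u) \<partial>lborel)"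
  proof (rule integral_dominated_convergence[where w = ?w])
    have "0 \<le> ?A" using log_mean_nonneg by simp
    thus "integrable lborel ?w"
      by (intro cauchy_integrable_bound[where A = ?A]) (auto simp: abs_mult)
    show "(\<lambda>u. cauchy_density u * mean_log_wave n (of_real (a + \<eta> * u)) / real n) \<in> borel_measurable lborel" for n
      using poisson_mean_log_wave[OF \<eta>, of n a] by (auto simp: has_bochner_integral_iff)
    show "AE u in lborel. (\<lambda>n. cauchy_density u * mean_log_wave n (of_real (a + \<eta> * u)) / real n)
        \<longlonglongrightarrow> cauchy_density u * lyap (a + \<eta> * u)"
    proof (intro AE_I2)
      fix u
      show "(\<lambda>n. cauchy_density u * mean_log_wave n (of_real (a + \<eta> * u)) / real n)
        \<longlonglongrightarrow> cauchy_density u * lyap (a + \<eta> * u)"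
        using tendsto_mult_left[OF lyap_LIMSEQ_wave[of "a + \<eta> * u"], of "cauchy_density u"]
        by (simp only: times_divide_eq_right)
    qed
    show "AE u in lborel. norm (cauchy_density u * mean_log_wave n (of_real (a + \<eta> * u)) / real n) \<le> ?w u" for n
    proof (intro AE_I2)
      fix u
      have "mean_log_wave n (of_real (a + \<eta> * u)) / real n \<le> ?A * (1 + \<bar>u\<bar> powr (1 / 2))"
        by (rule order_trans[OF mean_log_wave_rate_le ln_affine_le])
      from mult_left_mono[OF this cauchy_density_nonneg[of u]]
      show "norm (cauchy_density u * mean_log_wave n (of_real (a + \<eta> * u)) / real n) \<le> ?w u"
        using cauchy_density_nonneg[of u] mean_log_wave_nonneg[of "of_real (a + \<eta> * u)" n] by (simp add: abs_mult)
    qed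
  qed auto
  moreover have "(\<integral>u. cauchy_density u * mean_log_wave n (of_real (a + \<eta> * u)) / real n \<partial>lborel)
      = mean_log_wave n (of_real a + \<i> * of_real \<eta>) / real n" for n
    using poisson_mean_log_wave[OF \<eta>, of n a] by (simp add: has_bochner_integral_iff)
  ultimately show ?thesis by (simp only:)
qed

end

section \<open>Resonances\<close>

text \<open>Behind a barrier of height \<open>V\<close> the Weyl function is \<open>1 / V\<close> up to \<open>O(1 / V\<^sup>2)\<close>, unless the chain behind the
barrier is itself resonant with it. The hypothesis on \<open>w\<close> excludes this: it forces the
Weyl function behind the barrier to have modulus at most \<open>1 / 2\<close>.\<close>

lemma m_function_barrier:
  assumes z: "0 \<le> Im z" "cmod z \<le> B"
    and V: "2 * B + 1 \<le> \<bar>V\<bar>"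
    and w: "2 \<le> cmod (of_real w - z - m_function (shifted z ws))"
  shows "cmod (m_function (shifted z (V # w # ws)) - 1 / of_real V) \<le> (2 * B + 1) / V\<^sup>2"
proof -
  define m where "m = m_function (shifted z (w # ws))"
  have B: "0 \<le> B" using z(2) norm_ge_zero order_trans by blast
  have V0: "0 < \<bar>V\<bar>" using V B by linarith
  have m: "cmod m \<le> 1 / 2"
    unfolding m_def m_function_shifted_Cons[OF z(1)] norm_divide using w by (simp add: divide_le_eq)
  define d where "d = of_real V - z - m"
  have zm: "cmod (z + m) \<le> B + 1 / 2"
    using norm_triangle_ineq[of z m] z(2) m by linarith
  have "cmod (of_real V) - cmod (z + m) \<le> cmod d"
    using norm_triangle_ineq2[of "of_real V" "z + m"] by (simp add: d_def algebra_simps)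
  hence d: "\<bar>V\<bar> / 2 \<le> cmod d" using zm V by simp
  hence d0: "d \<noteq> 0" using V0 by auto
  have "m_function (shifted z (V # w # ws)) - 1 / of_real V = 1 / d - 1 / of_real V"
    unfolding m_function_shifted_Cons[OF z(1)] m_def d_def by simp
  also have "\<dots> = (z + m) / (of_real V * d)"
    using d0 V0 by (simp add: d_def field_simps)
  finally have "cmod (m_function (shifted z (V # w # ws)) - 1 / of_real V) = cmod (z + m) / (\<bar>V\<bar> * cmod d)"
    by (simp add: norm_divide norm_mult)
  also have "\<dots> \<le> (B + 1 / 2) / (\<bar>V\<bar> * (\<bar>V\<bar> / 2))"
    using zm d V0 B by (intro frac_le mult_left_mono mult_pos_pos) auto
  also have "\<dots> = (2 * B + 1) / V\<^sup>2"
    using V0 by (simp add: field_simps power2_eq_square)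
  finally show ?thesis .
qed

text \<open>Two points at distance at least \<open>4\<close> cannot both be at distance less than \<open>2\<close> from
\<open>z\<close> plus the Weyl function of the remaining word. So whatever that word is,
the site behind the barrier takes a favourable value with probability at least \<open>\<delta>\<close>.\<close>

lemma prob_m_function_barrier:
  assumes z: "0 \<le> Im z" "cmod z \<le> B" and V: "2 * B + 1 \<le> \<bar>V\<bar>"
    and b: "4 \<le> \<bar>b1 - b2\<bar>" "\<delta> \<le> pmf \<nu> b1" "\<delta> \<le> pmf \<nu> b2"
  shows "pmf \<nu> V * \<delta> \<le> measure_pmf.prob (replicate_pmf (Suc (Suc m)) \<nu>)
    {ys. cmod (m_function (shifted z ys) - 1 / of_real V) \<le> (2 * B + 1) / V\<^sup>2}"
proof -
  let ?E = "{ys. cmod (m_function (shifted z ys) - 1 / of_real V) \<le> (2 * B + 1) / V\<^sup>2}"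
  let ?F = "{y. 2 \<le> cmod (of_real (fst y) - z - m_function (shifted z (snd y)))}"
  have choice: "\<delta> \<le> measure_pmf.prob \<nu> {w. 2 \<le> cmod (of_real w - z - m_function (shifted z ws))}" for ws
  proof -
    let ?c = "z + m_function (shifted z ws)"
    have "cmod (of_real b1 - of_real b2) \<le> cmod (of_real b1 - ?c) + cmod (of_real b2 - ?c)"
      using norm_triangle_ineq4[of "of_real b1 - ?c" "of_real b2 - ?c"] by simp
    hence "4 \<le> cmod (of_real b1 - ?c) + cmod (of_real b2 - ?c)"
      using b(1) by (simp flip: of_real_diff)
    hence "2 \<le> cmod (of_real b1 - ?c) \<or> 2 \<le> cmod (of_real b2 - ?c)" by linarith
    then obtain w where w: "2 \<le> cmod (of_real w - ?c)" "\<delta> \<le> pmf \<nu> w" using b by blast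
    have "\<delta> \<le> measure_pmf.prob \<nu> {w}" using w(2) by (simp add: measure_pmf_single)
    also have "\<dots> \<le> measure_pmf.prob \<nu> {w. 2 \<le> cmod (of_real w - z - m_function (shifted z ws))}"
      using w(1) by (intro measure_pmf.finite_measure_mono) (auto simp: algebra_simps)
    finally show ?thesis .
  qed
  have "ennreal \<delta> \<le> (\<integral>\<^sup>+ws. ennreal \<delta> \<partial>measure_pmf (replicate_pmf m \<nu>))" by simp
  also have "\<dots> \<le> (\<integral>\<^sup>+ws. emeasure (measure_pmf \<nu>) {w. 2 \<le> cmod (of_real w - z - m_function (shifted z ws))} \<partial>measure_pmf (replicate_pmf m \<nu>))"
    using choice by (intro nn_integral_mono) (simp add: measure_pmf.emeasure_eq_measure ennreal_leI)
  also have "\<dots> = emeasure (measure_pmf (pair_pmf (replicate_pmf m \<nu>) \<nu>)) {y. 2 \<le> cmod (of_real (snd y) - z - m_function (shifted z (fst y)))}"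
    unfolding emeasure_pair_pmf by (simp add: vimage_def)
  also have "\<dots> = emeasure (measure_pmf (pair_pmf \<nu> (replicate_pmf m \<nu>))) ?F"
    unfolding pair_commute_pmf[of \<nu>] by (simp add: vimage_def case_prod_unfold)
  finally have F: "\<delta> \<le> measure_pmf.prob (pair_pmf \<nu> (replicate_pmf m \<nu>)) ?F"
    by (simp add: measure_pmf.emeasure_eq_measure)
  have eq: "replicate_pmf (Suc (Suc m)) \<nu> = map_pmf (\<lambda>(x, w, ws). x # w # ws) (pair_pmf \<nu> (pair_pmf \<nu> (replicate_pmf m \<nu>)))"
    unfolding replicate_pmf_Suc_pair pair_map_pmf2 pmf.map_comp
    by (intro map_pmf_cong refl) auto
  have "pmf \<nu> V * \<delta> \<le> pmf \<nu> V * measure_pmf.prob (pair_pmf \<nu> (replicate_pmf m \<nu>)) ?F"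
    using F by (intro mult_left_mono) auto
  also have "\<dots> = measure_pmf.prob (pair_pmf \<nu> (pair_pmf \<nu> (replicate_pmf m \<nu>))) ({V} \<times> ?F)"
    by (simp add: prob_pair_pmf_Times measure_pmf_single)
  also have "\<dots> \<le> measure_pmf.prob (pair_pmf \<nu> (pair_pmf \<nu> (replicate_pmf m \<nu>)))
      ((\<lambda>(x, w, ws). x # w # ws) -` ?E)"
    using m_function_barrier[OF z V] by (intro measure_pmf.finite_measure_mono) auto
  also have "\<dots> = measure_pmf.prob (replicate_pmf (Suc (Suc m)) \<nu>) ?E"
    unfolding eq by simp
  finally show ?thesis .
qed

text \<open>The influence of the rest of the chain on the site \<open>k\<close>, when the sites to the left of \<open>k\<close> are
taken at the energy \<open>z1\<close> and those to the right at the energy \<open>z2\<close>.\<close>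

definition self_energy :: "complex \<Rightarrow> complex \<Rightarrow> real list \<Rightarrow> nat \<Rightarrow> complex" where
  "self_energy z1 z2 ws k = m_function (shifted z1 (rev (take k ws))) + m_function (shifted z2 (drop (Suc k) ws))"

text \<open>The energy is changed from \<open>z2\<close> to \<open>z1\<close> one site at a time, from left to right.\<close>

lemma ln_wave_telescope:
  assumes z: "0 \<le> Im z1" "0 \<le> Im z2"
  shows "ln (cmod (wave (shifted z1 ws))) - ln (cmod (wave (shifted z2 ws)))
    = (\<Sum>k<length ws. ln (cmod (of_real (ws ! k) - z1 - self_energy z1 z2 ws k))
        - ln (cmod (of_real (ws ! k) - z2 - self_energy z1 z2 ws k)))"
proof -
  \<comment> \<open>The first \<open>k\<close> sites have already been moved to \<open>z1\<close>.\<close>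
  define mix where "mix k = shifted z1 (take k ws) @ shifted z2 (drop k ws)" for k
  let ?F = "\<lambda>k. ln (cmod (wave (mix k)))"
  have "?F (Suc k) - ?F k = ln (cmod (of_real (ws ! k) - z1 - self_energy z1 z2 ws k))
        - ln (cmod (of_real (ws ! k) - z2 - self_energy z1 z2 ws k))" if k: "k < length ws" for k
  proof -
    let ?xs = "shifted z1 (take k ws)" and ?ys = "shifted z2 (drop (Suc k) ws)" and ?w = "of_real (ws ! k)"
    have mix: "mix (Suc k) = ?xs @ (?w - z1) # ?ys" "mix k = ?xs @ (?w - z2) # ?ys"
    proof -
      have "drop k ws = ws ! k # drop (Suc k) ws" using Cons_nth_drop_Suc[OF k] by simp
      hence drop: "shifted z2 (drop k ws) = (?w - z2) # ?ys" by (simp only: shifted_Cons)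
      have "shifted z1 (take (Suc k) ws) = ?xs @ [?w - z1]"
        unfolding take_Suc_conv_app_nth[OF k] shifted_append by (simp add: shifted_def)
      thus "mix (Suc k) = ?xs @ (?w - z1) # ?ys" unfolding mix_def by simp
      show "mix k = ?xs @ (?w - z2) # ?ys" unfolding mix_def drop ..
    qed
    let ?c = "contP (rev ?xs) * contP ?ys" and ?M = "self_energy z1 z2 ws k"
    have nz: "contP (rev ?xs) \<noteq> 0" "contP ?ys \<noteq> 0"
      unfolding rev_shifted using z by (auto intro!: contP_nonzero dest: shifted_Im_neg)
    have W: "wave (mix (Suc k)) = ?c * (?w - z1 - ?M)" "wave (mix k) = ?c * (?w - z2 - ?M)"
      unfolding mix wave_split[OF nz] self_energy_def rev_shifted by simp_all
    have "0 < Im ?M"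
      unfolding self_energy_def using m_function_shifted_Im_pos z by (simp add: add_pos_pos)
    hence "?w - z1 - ?M \<noteq> 0" "?w - z2 - ?M \<noteq> 0" using z by (auto simp: complex_eq_iff)
    thus ?thesis unfolding W norm_mult using nz by (simp add: ln_mult_pos)
  qed
  hence "(\<Sum>k<length ws. ln (cmod (of_real (ws ! k) - z1 - self_energy z1 z2 ws k))
        - ln (cmod (of_real (ws ! k) - z2 - self_energy z1 z2 ws k)))
      = (\<Sum>k<length ws. ?F (Suc k) - ?F k)" by (intro sum.cong) auto
  also have "\<dots> = ?F (length ws) - ?F 0" by (rule sum_lessThan_telescope)
  also have "\<dots> = ln (cmod (wave (shifted z1 ws))) - ln (cmod (wave (shifted z2 ws)))"
    by (simp add: mix_def shifted_def)
  finally show ?thesis by simp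
qed

text \<open>Raising the energy and the self-energy both push the imaginary part in the same direction, so
they cannot cancel. This makes every summand of the telescoping sum nonnegative.\<close>

lemma cmod_vertical_mono:
  assumes "0 < r" "r \<le> R" "0 < Im M"
  shows "cmod (of_real w - (of_real a + \<i> * of_real r) - M) \<le> cmod (of_real w - (of_real a + \<i> * of_real R) - M)"
    and "0 < cmod (of_real w - (of_real a + \<i> * of_real r) - M)"
proof -
  have "(- r - Im M)\<^sup>2 \<le> (- R - Im M)\<^sup>2"
    unfolding abs_le_square_iff[symmetric] using assms by simp
  thus "cmod (of_real w - (of_real a + \<i> * of_real r) - M) \<le> cmod (of_real w - (of_real a + \<i> * of_real R) - M)"
    by - (rule power2_le_imp_le, simp_all add: cmod_power2)
  show "0 < cmod (of_real w - (of_real a + \<i> * of_real r) - M)"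
    using assms by (auto simp: complex_eq_iff)
qed

context log_moment_pmf
begin

text \<open>At a site with potential \<open>a\<close> between the barriers \<open>V\<close> and \<open>- V\<close> the two contributions \<open>1 / V\<close> and \<open>- 1 / V\<close> to the
self-energy cancel up to \<open>2 * K / V\<^sup>2\<close>. The modulus at that site is therefore at most \<open>r + 2 * K / V\<^sup>2\<close> at height \<open>r\<close>,
but at least \<open>R\<close> at height \<open>R\<close>. All other sites contribute a nonnegative amount. The number \<open>n - 4\<close> counts the sites
that have two neighbours on either side.\<close>

lemma resonance_gain:
  fixes a V b1 b2 \<delta> r R :: real and n :: nat
  defines "B \<equiv> \<bar>a\<bar> + 1"
  defines "K \<equiv> 2 * B + 1"
  defines "lg \<equiv> ln (R / (r + 2 * K / V\<^sup>2))"
  assumes r: "0 < r" "r \<le> R" "R \<le> 1" and V: "K \<le> V" and lg: "0 \<le> lg"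
    and b: "4 \<le> \<bar>b1 - b2\<bar>" "\<delta> \<le> pmf \<nu> b1" "\<delta> \<le> pmf \<nu> b2" "0 \<le> \<delta>"
  shows "real (n - 4) * (pmf \<nu> a * (pmf \<nu> V * \<delta>) * (pmf \<nu> (- V) * \<delta>)) * lg
    \<le> mean_log_wave n (of_real a + \<i> * of_real R) - mean_log_wave n (of_real a + \<i> * of_real r)"
proof -
  define z1 where "z1 = of_real a + \<i> * of_real R"
  define z2 where "z2 = of_real a + \<i> * of_real r"
  have z: "0 < Im z1" "0 < Im z2" using r by (auto simp: z1_def z2_def)
  have zB: "cmod z1 \<le> B" "cmod z2 \<le> B"
    using norm_triangle_ineq[of "of_real a" "\<i> * of_real R"] norm_triangle_ineq[of "of_real a" "\<i> * of_real r"] r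
    by (auto simp: z1_def z2_def B_def norm_mult)
  have V0: "0 < V" using V by (simp add: K_def B_def)
  define Er where "Er = {ys. cmod (m_function (shifted z2 ys) - 1 / of_real V) \<le> K / V\<^sup>2}"
  define El where "El = {xs. cmod (m_function (shifted z1 xs) - 1 / of_real (- V)) \<le> K / (- V)\<^sup>2}"
  define good where "good k = {ws. rev (take k ws) \<in> El \<and> ws ! k = a \<and> drop (Suc k) ws \<in> Er}" for k
  define c where "c = pmf \<nu> a * (pmf \<nu> V * \<delta>) * (pmf \<nu> (- V) * \<delta>)"
  have c0: "0 \<le> c" unfolding c_def using b(4) by (intro mult_nonneg_nonneg) auto
  define gain where "gain ws k = ln (cmod (of_real (ws ! k) - z1 - self_energy z1 z2 ws k))
        - ln (cmod (of_real (ws ! k) - z2 - self_energy z1 z2 ws k))" for ws k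
  have M: "0 < Im (self_energy z1 z2 ws k)" for ws k
    unfolding self_energy_def using z m_function_shifted_Im_pos by (simp add: add_pos_pos)
  have gain0: "0 \<le> gain ws k" for ws k
  proof -
    have "ln (cmod (of_real (ws ! k) - z2 - self_energy z1 z2 ws k))
      \<le> ln (cmod (of_real (ws ! k) - z1 - self_energy z1 z2 ws k))"
      using cmod_vertical_mono[OF r(1,2) M[of ws k], of "ws ! k" a, folded z1_def z2_def]
      by (intro ln_mono)
    thus ?thesis by (simp add: gain_def)
  qed
  have gain_good: "lg \<le> gain ws k" if "ws \<in> good k" for ws k
  proof -
    let ?M = "self_energy z1 z2 ws k"
    let ?l = "m_function (shifted z1 (rev (take k ws))) - 1 / of_real (- V)"
      and ?r = "m_function (shifted z2 (drop (Suc k) ws)) - 1 / of_real V"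
    have "?M = ?l + ?r" by (simp add: self_energy_def)
    moreover have "cmod ?l \<le> K / V\<^sup>2" "cmod ?r \<le> K / V\<^sup>2"
      using that by (simp_all add: good_def El_def Er_def)
    ultimately have "cmod ?M \<le> K / V\<^sup>2 + K / V\<^sup>2"
      using norm_triangle_ineq[of ?l ?r] by simp
    moreover have a: "ws ! k = a" using that by (simp add: good_def)
    ultimately have "cmod (of_real (ws ! k) - z2 - ?M) \<le> r + 2 * K / V\<^sup>2"
      using norm_triangle_ineq4[of "- \<i> * of_real r" ?M] r by (simp add: z2_def norm_mult)
    moreover have "0 < cmod (of_real (ws ! k) - z2 - ?M)"
      by (rule cmod_vertical_mono(2)[OF r(1,2) M[of ws k], of "ws ! k" a, folded z2_def])
    ultimately have lo: "ln (cmod (of_real (ws ! k) - z2 - ?M)) \<le> ln (r + 2 * K / V\<^sup>2)" "0 < r + 2 * K / V\<^sup>2"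
      using less_le_trans by (auto intro!: ln_mono simp del: zero_less_norm_iff)
    have "R \<le> \<bar>Im (of_real (ws ! k) - z1 - ?M)\<bar>" using M[of ws k] r by (simp add: z1_def)
    also have "\<dots> \<le> cmod (of_real (ws ! k) - z1 - ?M)" by (rule abs_Im_le_cmod)
    finally have "ln R \<le> ln (cmod (of_real (ws ! k) - z1 - ?M))" using r by (intro ln_mono) auto
    with lo show ?thesis unfolding gain_def lg_def using r by (simp add: ln_div)
  qed
  have prob_good: "c \<le> measure_pmf.prob (replicate_pmf n \<nu>) (good k)" if k: "2 \<le> k" "k + 3 \<le> n" for k
  proof -
    obtain i where i: "k = Suc (Suc i)" using k(1) by (metis add_2_eq_Suc le_Suc_ex)
    obtain j where j: "n = k + Suc (Suc (Suc j))" using k(2) by (metis add_Suc_right le_Suc_ex numeral_3_eq_3 add.right_neutral add_Suc)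
    have eq: "replicate_pmf n \<nu> = map_pmf (\<lambda>(xs, w, ys). xs @ w # ys)
        (pair_pmf (replicate_pmf k \<nu>) (pair_pmf \<nu> (replicate_pmf (Suc (Suc j)) \<nu>)))"
      unfolding j replicate_pmf_append_pair replicate_pmf_Suc_pair[of "Suc (Suc j)"]
      by (simp only: pair_map_pmf2 pmf.map_comp o_def case_prod_unfold apsnd_def map_prod_def fst_conv snd_conv id_apply)
    have L: "pmf \<nu> (- V) * \<delta> \<le> measure_pmf.prob (replicate_pmf k \<nu>) {xs. rev xs \<in> El}"
    proof -
      have "pmf \<nu> (- V) * \<delta> \<le> measure_pmf.prob (replicate_pmf k \<nu>) El"
        unfolding i El_def K_def
        by (rule prob_m_function_barrier[OF _ _ _ b(1-3)]) (use z zB V V0 in \<open>auto simp: K_def\<close>)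
      also have "\<dots> = measure_pmf.prob (map_pmf rev (replicate_pmf k \<nu>)) El" by (simp only: replicate_pmf_rev)
      finally show ?thesis by (simp add: vimage_def)
    qed
    have Rr: "pmf \<nu> V * \<delta> \<le> measure_pmf.prob (replicate_pmf (Suc (Suc j)) \<nu>) Er"
      unfolding Er_def K_def
      by (rule prob_m_function_barrier[OF _ _ _ b(1-3)]) (use z zB V V0 in \<open>auto simp: K_def\<close>)
    have "c = (pmf \<nu> (- V) * \<delta>) * (pmf \<nu> a * (pmf \<nu> V * \<delta>))" by (simp add: c_def)
    also have "\<dots> \<le> measure_pmf.prob (replicate_pmf k \<nu>) {xs. rev xs \<in> El}
        * (pmf \<nu> a * measure_pmf.prob (replicate_pmf (Suc (Suc j)) \<nu>) Er)"
      using L Rr b(4) by (intro mult_mono mult_nonneg_nonneg) auto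
    also have "\<dots> = measure_pmf.prob (pair_pmf (replicate_pmf k \<nu>) (pair_pmf \<nu> (replicate_pmf (Suc (Suc j)) \<nu>)))
        ({xs. rev xs \<in> El} \<times> ({a} \<times> Er))"
      by (simp add: prob_pair_pmf_Times measure_pmf_single del: replicate_pmf.simps)
    also have "\<dots> \<le> measure_pmf.prob (pair_pmf (replicate_pmf k \<nu>) (pair_pmf \<nu> (replicate_pmf (Suc (Suc j)) \<nu>)))
        ((\<lambda>(xs, w, ys). xs @ w # ys) -` good k)"
    proof (rule measure_pmf.finite_measure_mono_AE)
      show "AE x in measure_pmf (pair_pmf (replicate_pmf k \<nu>) (pair_pmf \<nu> (replicate_pmf (Suc (Suc j)) \<nu>))).
        x \<in> {xs. rev xs \<in> El} \<times> ({a} \<times> Er) \<longrightarrow> x \<in> (\<lambda>(xs, w, ys). xs @ w # ys) -` good k"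
      proof (rule AE_pmfI, safe)
        fix xs w ys
        assume "(xs, w, ys) \<in> set_pmf (pair_pmf (replicate_pmf k \<nu>) (pair_pmf \<nu> (replicate_pmf (Suc (Suc j)) \<nu>)))"
        hence "length xs = k" by (auto simp: set_replicate_pmf simp del: replicate_pmf.simps)
        moreover assume "rev xs \<in> El" "ys \<in> Er"
        ultimately show "(xs, a, ys) \<in> (\<lambda>(xs, w, ys). xs @ w # ys) -` good k"
          by (simp add: good_def nth_append)
      qed
    qed simp
    also have "\<dots> = measure_pmf.prob (replicate_pmf n \<nu>) (good k)" unfolding eq by simp
    finally show ?thesis .
  qed
  have diff_ge: "(\<Sum>k<n. lg * indicator (good k) ws) \<le> ln (cmod (wave (shifted z1 ws))) - ln (cmod (wave (shifted z2 ws)))"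
    if "length ws = n" for ws
  proof -
    have "(\<Sum>k<n. lg * indicator (good k) ws) \<le> (\<Sum>k<n. gain ws k)"
      using gain0 gain_good by (intro sum_mono) (auto simp: indicator_def)
    also have "\<dots> = ln (cmod (wave (shifted z1 ws))) - ln (cmod (wave (shifted z2 ws)))"
      unfolding gain_def that[symmetric] using z by (intro ln_wave_telescope[symmetric]) auto
    finally show ?thesis .
  qed
  have int: "integrable (measure_pmf (replicate_pmf n \<nu>)) (\<lambda>ws. lg * indicator (good k) ws)" for k
    by (intro integrable_mult_right) (simp add: measure_pmf.emeasure_eq_measure)
  have "real (n - 4) * c * lg = (\<Sum>k\<in>{2..<n - 2}. lg * c)" by (simp add: algebra_simps)
  also have "\<dots> \<le> (\<Sum>k\<in>{2..<n - 2}. lg * measure_pmf.prob (replicate_pmf n \<nu>) (good k))"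
    using prob_good lg by (intro sum_mono mult_left_mono) auto
  also have "\<dots> \<le> (\<Sum>k<n. lg * measure_pmf.prob (replicate_pmf n \<nu>) (good k))"
    using lg by (intro sum_mono2) auto
  also have "\<dots> = measure_pmf.expectation (replicate_pmf n \<nu>) (\<lambda>ws. \<Sum>k<n. lg * indicator (good k) ws)"
    using int by (subst Bochner_Integration.integral_sum) (auto simp: measure_pmf.emeasure_eq_measure)
  also have "\<dots> \<le> measure_pmf.expectation (replicate_pmf n \<nu>)
      (\<lambda>ws. ln (cmod (wave (shifted z1 ws))) - ln (cmod (wave (shifted z2 ws))))"
  proof (rule integral_mono_AE)
    show "AE ws in measure_pmf (replicate_pmf n \<nu>). (\<Sum>k<n. lg * indicator (good k) ws)
       \<le> ln (cmod (wave (shifted z1 ws))) - ln (cmod (wave (shifted z2 ws)))"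
      by (rule AE_pmfI, rule diff_ge) (auto simp: set_replicate_pmf)
    show "integrable (measure_pmf (replicate_pmf n \<nu>)) (\<lambda>ws. \<Sum>k<n. lg * indicator (good k) ws)"
      by (rule Bochner_Integration.integrable_sum) (rule int)
  qed (use z in \<open>auto intro!: Bochner_Integration.integrable_diff log_wave_integrable\<close>)
  also have "\<dots> = mean_log_wave n z1 - mean_log_wave n z2"
    unfolding mean_log_wave_def using z by (intro Bochner_Integration.integral_diff log_wave_integrable) auto
  finally show ?thesis unfolding c_def z1_def z2_def .
qed

lemma poisson_lyap_gain:
  fixes a V b1 b2 \<delta> r R :: real
  defines "K \<equiv> 2 * (\<bar>a\<bar> + 1) + 1"
  defines "lg \<equiv> ln (R / (r + 2 * K / V\<^sup>2))"
  assumes r: "0 < r" "r \<le> R" "R \<le> 1" and V: "K \<le> V" and lg: "0 \<le> lg"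
    and b: "4 \<le> \<bar>b1 - b2\<bar>" "\<delta> \<le> pmf \<nu> b1" "\<delta> \<le> pmf \<nu> b2" "0 \<le> \<delta>"
  shows "pmf \<nu> a * (pmf \<nu> V * \<delta>) * (pmf \<nu> (- V) * \<delta>) * lg
    \<le> (\<integral>u. cauchy_density u * lyap (a + R * u) \<partial>lborel) - (\<integral>u. cauchy_density u * lyap (a + r * u) \<partial>lborel)"
proof -
  let ?c = "pmf \<nu> a * (pmf \<nu> V * \<delta>) * (pmf \<nu> (- V) * \<delta>)"
  let ?m = "\<lambda>n \<eta>. mean_log_wave n (of_real a + \<i> * of_real \<eta>) / real n"
  have lim: "(\<lambda>n. ?m n R - ?m n r) \<longlonglongrightarrow> (\<integral>u. cauchy_density u * lyap (a + R * u) \<partial>lborel) - (\<integral>u. cauchy_density u * lyap (a + r * u) \<partial>lborel)"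
    using r by (intro tendsto_diff poisson_lyap_LIMSEQ) auto
  have "(\<lambda>n. real (n - 4) / real n) \<longlonglongrightarrow> 1"
  proof (rule Lim_transform_eventually)
    show "(\<lambda>n. (real n - 4) / real n) \<longlonglongrightarrow> 1" by real_asymp
    show "\<forall>\<^sub>F n in sequentially. (real n - 4) / real n = real (n - 4) / real n"
      using eventually_ge_at_top[of 4] by eventually_elim (simp add: of_nat_diff)
  qed
  hence lim': "(\<lambda>n. real (n - 4) / real n * (?c * lg)) \<longlonglongrightarrow> 1 * (?c * lg)" by (intro tendsto_mult_right)
  have "1 * (?c * lg) \<le> (\<integral>u. cauchy_density u * lyap (a + R * u) \<partial>lborel) - (\<integral>u. cauchy_density u * lyap (a + r * u) \<partial>lborel)"
  proof (rule LIMSEQ_le[OF lim' lim], intro exI allI impI)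
    fix n :: nat
    have "real (n - 4) * ?c * lg \<le> mean_log_wave n (of_real a + \<i> * of_real R) - mean_log_wave n (of_real a + \<i> * of_real r)"
      unfolding lg_def K_def by (rule resonance_gain[OF r _ _ b]) (use V lg in \<open>auto simp: K_def lg_def\<close>)
    hence "real (n - 4) * ?c * lg / real n \<le> (mean_log_wave n (of_real a + \<i> * of_real R) - mean_log_wave n (of_real a + \<i> * of_real r)) / real n"
      by (rule divide_right_mono) simp
    thus "real (n - 4) / real n * (?c * lg) \<le> ?m n R - ?m n r"
      by (simp add: diff_divide_distrib mult.assoc)
  qed
  thus ?thesis by simp
qed

text \<open>Near \<open>a\<close> the difference is at most \<open>Bd\<close> by hypothesis. Far away, the logarithmic growth of the Lyapunov exponent
is absorbed by the tail of the Cauchy distribution, of which only the fraction of order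
\<open>\<eta> / s\<close> lies outside the window of radius \<open>s\<close>.\<close>

lemma poisson_lyap_error:
  fixes a Bd s \<eta> :: real
  defines "A \<equiv> ln 2 + log_mean + ln (1 + \<bar>a\<bar>) + 4"
  assumes s: "0 < s" "s \<le> 1" and \<eta>: "0 < \<eta>"
    and near: "\<And>x. \<bar>x - a\<bar> < s \<Longrightarrow> \<bar>lyap x - lyap a\<bar> \<le> Bd"
  shows "\<bar>(\<integral>u. cauchy_density u * lyap (a + \<eta> * u) \<partial>lborel) - lyap a\<bar> \<le> Bd + 8 * A * \<eta> / s"
proof -
  have A0: "0 \<le> A" unfolding A_def using log_mean_nonneg by simp
  have Bd0: "0 \<le> Bd" using near[of a] s by simp
  define T where "T = s / \<eta>"
  have T: "0 < T" using s \<eta> by (simp add: T_def)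
  have grow: "\<bar>lyap (a + y) - lyap a\<bar> \<le> A * (1 + \<bar>y\<bar> powr (1 / 2))" for y
  proof -
    have "lyap (a + y) \<le> A * (1 + \<bar>y\<bar> powr (1 / 2))"
      using order_trans[OF lyap_le ln_affine_le[of a 1 y]] by (simp add: A_def algebra_simps)
    moreover have "lyap a \<le> A" using lyap_le[of a] by (simp add: A_def)
    hence "lyap a \<le> A * (1 + \<bar>y\<bar> powr (1 / 2))" using A0 by (simp add: algebra_simps add_increasing2)
    ultimately show ?thesis using lyap_nonneg[of a] lyap_nonneg[of "a + y"] by linarith
  qed
  define tail where "tail u = indicator {u. T \<le> \<bar>u\<bar>} u * \<bar>u\<bar> powr (- 3 / 2)" for u :: real
  have tail: "integrable lborel tail" "integral\<^sup>L lborel tail = 4 * T powr (- 1 / 2)"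
    using powr_tail_has_integral[OF T] unfolding has_bochner_integral_iff tail_def[abs_def] by blast+
  have cd: "integrable lborel cauchy_density" "integral\<^sup>L lborel cauchy_density = 1"
    using cauchy_density_has_integral by (auto simp: has_bochner_integral_iff)
  have pw: "\<bar>cauchy_density u * (lyap (a + \<eta> * u) - lyap a)\<bar>
      \<le> Bd * cauchy_density u + 2 * A * T powr (- 1 / 2) * tail u" for u
  proof (cases "T \<le> \<bar>u\<bar>")
    case False
    hence "\<bar>\<eta> * u\<bar> < s" using \<eta> by (simp add: T_def abs_mult field_simps)
    hence "\<bar>lyap (a + \<eta> * u) - lyap a\<bar> \<le> Bd" by (intro near) simp
    from mult_left_mono[OF this cauchy_density_nonneg[of u]] show ?thesis
      using False cauchy_density_nonneg[of u] by (simp add: tail_def abs_mult mult.commute)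
  next
    case True
    hence u0: "u \<noteq> 0" "0 < \<bar>u\<bar>" using T by auto
    have eta_u: "\<bar>\<eta> * u\<bar> = s * (\<bar>u\<bar> / T)" using \<eta> s by (simp add: T_def abs_mult)
    have q1: "1 \<le> \<bar>u\<bar> / T" using True T by simp
    have "1 \<le> (\<bar>u\<bar> / T) powr (1 / 2)" using q1 by (simp add: ge_one_powr_ge_zero)
    moreover have "s * (\<bar>u\<bar> / T) \<le> 1 * (\<bar>u\<bar> / T)" using s q1 by (intro mult_right_mono) auto
    hence "\<bar>\<eta> * u\<bar> powr (1 / 2) \<le> (\<bar>u\<bar> / T) powr (1 / 2)"
      unfolding eta_u using s T by (intro powr_mono2 mult_nonneg_nonneg divide_nonneg_nonneg) auto
    ultimately have "A * (1 + \<bar>\<eta> * u\<bar> powr (1 / 2)) \<le> A * (2 * (\<bar>u\<bar> / T) powr (1 / 2))"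
      by (intro mult_left_mono A0) auto
    with grow[of "\<eta> * u"] have "\<bar>lyap (a + \<eta> * u) - lyap a\<bar> \<le> 2 * A * (\<bar>u\<bar> / T) powr (1 / 2)" by linarith
    hence "cauchy_density u * \<bar>lyap (a + \<eta> * u) - lyap a\<bar> \<le> 1 / u\<^sup>2 * (2 * A * (\<bar>u\<bar> / T) powr (1 / 2))"
      using cauchy_density_le[OF u0(1)] cauchy_density_nonneg[of u] by (intro mult_mono) auto
    also have "\<dots> = 2 * A * T powr (- 1 / 2) * (\<bar>u\<bar> powr (1 / 2) / u\<^sup>2)"
      using T by (simp add: powr_divide powr_minus_divide)
    also have "\<bar>u\<bar> powr (1 / 2) / u\<^sup>2 = tail u"
      unfolding powr_half_div_square[OF u0(1)] using True by (simp add: tail_def)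
    finally show ?thesis
      using cauchy_density_nonneg[of u] mult_nonneg_nonneg[OF Bd0 cauchy_density_nonneg[of u]]
      by (simp add: abs_mult)
  qed
  have int: "integrable lborel (\<lambda>u. cauchy_density u * (lyap (a + \<eta> * u) - lyap a))"
    using lyap_cauchy_integrable[of a \<eta>] cd by (simp add: right_diff_distrib)
  have "(\<integral>u. cauchy_density u * lyap (a + \<eta> * u) \<partial>lborel) - lyap a
      = (\<integral>u. cauchy_density u * (lyap (a + \<eta> * u) - lyap a) \<partial>lborel)"
    using lyap_cauchy_integrable[of a \<eta>] cd by (simp add: right_diff_distrib)
  also have "\<bar>\<dots>\<bar> \<le> (\<integral>u. \<bar>cauchy_density u * (lyap (a + \<eta> * u) - lyap a)\<bar> \<partial>lborel)"
    by (rule integral_abs_bound)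
  also have "\<dots> \<le> (\<integral>u. Bd * cauchy_density u + 2 * A * T powr (- 1 / 2) * tail u \<partial>lborel)"
    using int cd tail pw by (intro integral_mono) auto
  also have "\<dots> = Bd + 2 * A * T powr (- 1 / 2) * (4 * T powr (- 1 / 2))"
    using cd tail by simp
  also have "2 * A * T powr (- 1 / 2) * (4 * T powr (- 1 / 2)) = 8 * A * (T powr (- 1 / 2) * T powr (- 1 / 2))"
    by simp
  also have "T powr (- 1 / 2) * T powr (- 1 / 2) = \<eta> / s"
    using T s \<eta> by (simp add: powr_add[symmetric] powr_minus T_def field_simps)
  finally show ?thesis by simp
qed

lemma resonance_lower_bound:
  fixes a V b1 b2 \<delta> R s Bd :: real
  defines "K \<equiv> 2 * (\<bar>a\<bar> + 1) + 1" and "A \<equiv> ln 2 + log_mean + ln (1 + \<bar>a\<bar>) + 4"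
  assumes V: "K \<le> V" and R: "2 * K + 1 \<le> R * V\<^sup>2" "R \<le> 1" and s: "0 < s" "s \<le> 1"
    and b: "4 \<le> \<bar>b1 - b2\<bar>" "\<delta> \<le> pmf \<nu> b1" "\<delta> \<le> pmf \<nu> b2" "0 \<le> \<delta>"
    and near: "\<And>x. \<bar>x - a\<bar> < s \<Longrightarrow> \<bar>lyap x - lyap a\<bar> \<le> Bd"
  shows "pmf \<nu> a * (pmf \<nu> V * \<delta>) * (pmf \<nu> (- V) * \<delta>) * ln (R * V\<^sup>2 / (2 * K + 1))
    \<le> 2 * Bd + 16 * A * R / s"
proof -
  have K: "3 \<le> K" by (simp add: K_def)
  have V0: "0 < V" using V K by linarith
  \<comment> \<open>The width of the resonance; a smaller height would not increase the gain by more than a constant.\<close>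
  define r where "r = 1 / V\<^sup>2"
  have r: "0 < r" using V0 by (simp add: r_def)
  have rR: "r \<le> R" using R(1) K V0 by (simp add: r_def divide_le_eq)
  have eq: "R / (r + 2 * K / V\<^sup>2) = R * V\<^sup>2 / (2 * K + 1)"
    using V0 K by (simp add: r_def field_simps)
  have A0: "0 \<le> A" unfolding A_def using log_mean_nonneg by simp
  have "0 \<le> ln (R / (r + 2 * K / V\<^sup>2))"
    unfolding eq using R K by (intro ln_ge_zero) (simp add: le_divide_eq)
  from poisson_lyap_gain[OF r rR R(2), of a V, folded K_def, OF V this b]
  have "pmf \<nu> a * (pmf \<nu> V * \<delta>) * (pmf \<nu> (- V) * \<delta>) * ln (R * V\<^sup>2 / (2 * K + 1))
     \<le> (\<integral>u. cauchy_density u * lyap (a + R * u) \<partial>lborel) - (\<integral>u. cauchy_density u * lyap (a + r * u) \<partial>lborel)"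
    unfolding eq .
  moreover have "0 < R" using r rR by linarith
  note poisson_lyap_error[OF s this near, folded A_def] poisson_lyap_error[OF s r near, folded A_def]
  moreover have "8 * A * r / s \<le> 8 * A * R / s"
    using rR A0 s by (intro divide_right_mono mult_left_mono) auto
  ultimately show ?thesis by (simp add: abs_le_iff)
qed

text \<open>Uniform hyperbolicity off the range of the potential gives a bound for every word,
hence for the mean.\<close>

lemma lyap_ge:
  assumes g: "2 \<le> g" "\<And>w. w \<in> set_pmf \<nu> \<Longrightarrow> g \<le> \<bar>w - E\<bar>"
  shows "ln (g - 1) \<le> lyap E"
proof (rule LIMSEQ_le_const[OF lyap_LIMSEQ_wave], intro exI[of _ 1] allI impI)
  fix n :: nat
  assume n: "1 \<le> n"
  have "real n * ln (g - 1) = measure_pmf.expectation (replicate_pmf n \<nu>) (\<lambda>_. real n * ln (g - 1))"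
    by simp
  also have "\<dots> \<le> mean_log_wave n (of_real E)"
    unfolding mean_log_wave_def
  proof (rule integral_mono_AE)
    show "AE ws in measure_pmf (replicate_pmf n \<nu>). real n * ln (g - 1) \<le> ln (cmod (wave (shifted (of_real E) ws)))"
    proof (rule AE_pmfI)
      fix ws
      assume "ws \<in> set_pmf (replicate_pmf n \<nu>)"
      hence ws: "length ws = n" "set ws \<subseteq> set_pmf \<nu>" by (auto simp: set_replicate_pmf)
      have "g \<le> cmod x" if "x \<in> set (shifted (of_real E) ws)" for x
        using that ws(2) g(2) by (auto simp: shifted_def simp flip: of_real_diff)
      from contP_uniform_lower[OF this g(1), of "shifted (of_real E) ws"]
      have "(g - 1) ^ n \<le> cmod (contP (shifted (of_real E) ws))"
        using ws(1) by (simp add: shifted_def)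
      also have "\<dots> \<le> cmod (wave (shifted (of_real E) ws))" by (rule wave_real_ge) simp
      finally have "ln ((g - 1) ^ n) \<le> ln (cmod (wave (shifted (of_real E) ws)))"
        using g(1) by (intro ln_mono) auto
      thus "real n * ln (g - 1) \<le> ln (cmod (wave (shifted (of_real E) ws)))"
        using g(1) by (simp add: ln_realpow)
    qed
  qed (auto intro: log_wave_integrable)
  finally show "ln (g - 1) \<le> mean_log_wave n (of_real E) / real n"
    using n by (simp add: field_simps)
qed

end

section \<open>The random Schroedinger measure\<close>

definition index_pmf :: "(nat \<Rightarrow> real) \<Rightarrow> nat pmf" where
  "index_pmf p = embed_pmf (\<lambda>n. p (Suc n))"

text \<open>The common law of the independent random potential values: an index \<open>n\<close> with its weight, and a fair sign.\<close>

definition potential_pmf :: "(nat \<Rightarrow> real) \<Rightarrow> (nat \<Rightarrow> real) \<Rightarrow> real pmf" where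
  "potential_pmf p v = map_pmf (\<lambda>(n, b). if b then v (Suc n) else - v (Suc n))
     (pair_pmf (index_pmf p) (bernoulli_pmf (1 / 2)))"

lemma pmf_index_pmf:
  assumes "\<forall>n\<ge>1. p n > 0" "(\<lambda>n. p (Suc n)) sums 1"
  shows "pmf (index_pmf p) n = p (Suc n)"
  unfolding index_pmf_def
proof (rule pmf_embed_pmf)
  show nonneg: "0 \<le> p (Suc n)" for n using assms(1)[rule_format, of "Suc n"] by simp
  have "(\<integral>\<^sup>+n. ennreal (p (Suc n)) \<partial>count_space UNIV) = (\<Sum>n. ennreal (p (Suc n)))"
    by (rule nn_integral_count_space_nat)
  also have "\<dots> = ennreal (\<Sum>n. p (Suc n))"
    using assms(2) nonneg by (intro suminf_ennreal2) (auto simp: sums_iff)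
  finally show "(\<integral>\<^sup>+n. ennreal (p (Suc n)) \<partial>count_space UNIV) = 1"
    using assms(2) by (simp add: sums_iff)
qed

lemma nn_integral_potential_pmf:
  assumes p: "\<forall>n\<ge>1. p n > 0" "(\<lambda>n. p (Suc n)) sums 1"
  shows "(\<integral>\<^sup>+w. f w \<partial>potential_pmf p v)
    = (\<Sum>n. ennreal (p (Suc n) / 2) * f (v (Suc n)) + ennreal (p (Suc n) / 2) * f (- v (Suc n)))"
proof -
  have half: "ennreal (p (Suc n) / 2) = ennreal (p (Suc n)) * ennreal (1 / 2)" for n
    using p(1)[rule_format, of "Suc n"] by (simp add: ennreal_mult[symmetric] del: ennreal_half)
  have "(\<integral>\<^sup>+w. f w \<partial>potential_pmf p v)
      = (\<integral>\<^sup>+n. f (v (Suc n)) * ennreal (1 / 2) + f (- v (Suc n)) * ennreal (1 / 2) \<partial>index_pmf p)"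
    unfolding potential_pmf_def by (simp add: nn_integral_pair_pmf' del: ennreal_half)
  also have "\<dots> = (\<Sum>n. ennreal (p (Suc n)) * (f (v (Suc n)) * ennreal (1 / 2) + f (- v (Suc n)) * ennreal (1 / 2)))"
    unfolding nn_integral_measure_pmf by (simp add: nn_integral_count_space_nat pmf_index_pmf[OF p])
  finally show ?thesis
    unfolding half by (simp add: distrib_left mult_ac)
qed

lemma pmf_potential_pmf_ge:
  assumes p: "\<forall>n\<ge>1. p n > 0" "(\<lambda>n. p (Suc n)) sums 1" and n: "1 \<le> n"
  shows "p n / 2 \<le> pmf (potential_pmf p v) (v n)" "p n / 2 \<le> pmf (potential_pmf p v) (- v n)"
proof -
  obtain m where m: "n = Suc m" using n by (cases n) auto
  let ?f = "\<lambda>(n, b). if b then v (Suc n) else - v (Suc n)"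
  let ?P = "pair_pmf (index_pmf p) (bernoulli_pmf (1 / 2))"
  have "p n / 2 \<le> pmf (potential_pmf p v) (?f (m, b))" for b
  proof -
    have "p n / 2 = pmf ?P (m, b)" by (cases b) (simp_all add: pmf_pair pmf_index_pmf[OF p] m)
    also have "\<dots> = measure_pmf.prob ?P {(m, b)}" by (simp add: measure_pmf_single)
    also have "\<dots> \<le> measure_pmf.prob ?P (?f -` {?f (m, b)})"
      by (intro measure_pmf.finite_measure_mono) auto
    finally show ?thesis by (simp add: potential_pmf_def pmf_map)
  qed
  from this[of True] this[of False]
  show "p n / 2 \<le> pmf (potential_pmf p v) (v n)" "p n / 2 \<le> pmf (potential_pmf p v) (- v n)"
    by (simp_all add: m)
qed

lemma set_potential_pmf: "w \<in> set_pmf (potential_pmf p v) \<Longrightarrow> \<exists>n\<ge>1. w = v n \<or> w = - v n"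
  by (auto simp: potential_pmf_def split: if_splits)

lemma schroedinger_measure_eq_distr:
  assumes p: "\<forall>n\<ge>1. p n > 0" "(\<lambda>n. p (Suc n)) sums 1"
  shows "schroedinger_measure p v t
    = distr (measure_pmf (potential_pmf p v)) borel (\<lambda>w. schroedinger (of_real w - t))"
proof (rule measure_eqI)
  fix A assume "A \<in> sets (schroedinger_measure p v t)"
  hence A: "A \<in> sets borel" by simp
  let ?S = "\<lambda>w. schroedinger (of_real w - t)"
  have "emeasure (distr (measure_pmf (potential_pmf p v)) borel ?S) A = (\<integral>\<^sup>+w. indicator A (?S w) \<partial>potential_pmf p v)"
    using A by (subst nn_integral_distr[symmetric, where M' = borel]) auto
  also have "\<dots> = emeasure (schroedinger_measure p v t) A"
    unfolding emeasure_schroedinger_measure[OF A] nn_integral_potential_pmf[OF p]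
    using A by simp
  finally show "emeasure (schroedinger_measure p v t) A = emeasure (distr (measure_pmf (potential_pmf p v)) borel ?S) A" ..
qed simp

lemma matrix_mult_measurable:
  "(\<lambda>(g, h). g ** h) \<in> borel_measurable (borel \<Otimes>\<^sub>M (borel :: (complex^2^2) measure))"
  unfolding borel_prod matrix_matrix_mult_def case_prod_unfold
  by (intro borel_measurable_continuous_onI continuous_on_vec_lambda continuous_intros)

text \<open>Convolution powers are the laws of transfer matrices of independent words. This moves all
energies to one probability space, so that different energies can be compared for the same word.\<close>

lemma convolution_power_eq_distr:
  assumes p: "\<forall>n\<ge>1. p n > 0" "(\<lambda>n. p (Suc n)) sums 1"
  shows "convolution_power (schroedinger_measure p v t) n
    = distr (measure_pmf (replicate_pmf n (potential_pmf p v))) borel (transfer t)"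
proof (induction n)
  case 0
  show ?case
  proof (rule measure_eqI)
    fix A assume "A \<in> sets (convolution_power (schroedinger_measure p v t) 0)"
    thus "emeasure (convolution_power (schroedinger_measure p v t) 0) A
      = emeasure (distr (measure_pmf (replicate_pmf 0 (potential_pmf p v))) borel (transfer t)) A"
      by (simp add: emeasure_distr indicator_def)
  qed simp
next
  case (Suc n)
  let ?\<nu> = "potential_pmf p v" and ?S = "\<lambda>w. schroedinger (of_real w - t)"
  let ?M = "distr (measure_pmf ?\<nu>) borel ?S" and ?N = "distr (measure_pmf (replicate_pmf n ?\<nu>)) borel (transfer t)"
  interpret N: prob_space ?N by (rule measure_pmf.prob_space_distr) simp
  have sets_MN: "sets (?M \<Otimes>\<^sub>M ?N) = sets (borel \<Otimes>\<^sub>M borel)"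
    by (rule sets_pair_measure_cong) (rule sets_distr)+
  have mult: "(\<lambda>(g, h). g ** h) \<in> borel_measurable (?M \<Otimes>\<^sub>M ?N)"
    unfolding measurable_cong_sets[OF sets_MN refl] by (rule matrix_mult_measurable)
  show ?case
  proof (rule measure_eqI)
    fix A assume "A \<in> sets (convolution_power (schroedinger_measure p v t) (Suc n))"
    hence A: "A \<in> sets borel" by (simp add: mult_convolution_def)
    have "emeasure (convolution_power (schroedinger_measure p v t) (Suc n)) A
        = emeasure (distr (?M \<Otimes>\<^sub>M ?N) borel (\<lambda>(g, h). g ** h)) A"
      unfolding convolution_power.simps mult_convolution_def Suc
      unfolding schroedinger_measure_eq_distr[OF p] ..
    also have "\<dots> = (\<integral>\<^sup>+x. indicator A x \<partial>distr (?M \<Otimes>\<^sub>M ?N) borel (\<lambda>(g, h). g ** h))"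
      using A by (intro nn_integral_indicator[symmetric]) simp
    also have "\<dots> = (\<integral>\<^sup>+x. indicator A (case x of (g, h) \<Rightarrow> g ** h) \<partial>(?M \<Otimes>\<^sub>M ?N))"
      using A by (intro nn_integral_distr mult) simp
    also have "\<dots> = (\<integral>\<^sup>+g. \<integral>\<^sup>+h. indicator A (case (g, h) of (g, h) \<Rightarrow> g ** h) \<partial>?N \<partial>?M)"
      by (rule N.nn_integral_fst[symmetric])
         (rule measurable_compose[OF mult borel_measurable_indicator[OF A]])
    also have "\<dots> = (\<integral>\<^sup>+g. \<integral>\<^sup>+h. indicator A (g ** h) \<partial>?N \<partial>?M)"
      by (simp only: prod.case)
    also have "\<dots> = (\<integral>\<^sup>+w. \<integral>\<^sup>+ws. indicator A (?S w ** transfer t ws) \<partial>replicate_pmf n ?\<nu> \<partial>?\<nu>)"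
    proof -
      have m: "(\<lambda>x. indicator A (case x of (g, h) \<Rightarrow> g ** h) :: ennreal) \<in> borel_measurable (borel \<Otimes>\<^sub>M (borel :: (complex^2^2) measure))"
        using measurable_compose[OF matrix_mult_measurable borel_measurable_indicator[OF A]] .
      have 1: "(\<lambda>h. indicator A (g ** h) :: ennreal) \<in> borel_measurable borel" for g :: "complex^2^2"
        using measurable_compose[OF measurable_Pair1' m, of g] by simp
      have eq: "(\<integral>\<^sup>+h. indicator A (g ** h) \<partial>?N) = (\<integral>\<^sup>+ws. indicator A (g ** transfer t ws) \<partial>replicate_pmf n ?\<nu>)" for g :: "complex^2^2"
        using 1 by (subst nn_integral_distr) auto
      have 2: "(\<lambda>g. \<integral>\<^sup>+ws. indicator A (g ** transfer t ws) \<partial>replicate_pmf n ?\<nu>) \<in> borel_measurable borel"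
      proof (rule borel_measurable_nn_integral_pmf)
        fix ws
        show "(\<lambda>g. indicator A (g ** transfer t ws) :: ennreal) \<in> borel_measurable borel"
          using measurable_compose[OF measurable_Pair2' m, of "transfer t ws"] by simp
      qed
      show ?thesis unfolding eq using 2 by (subst nn_integral_distr) auto
    qed
    also have "\<dots> = (\<integral>\<^sup>+w. emeasure (measure_pmf (replicate_pmf n ?\<nu>)) (Cons w -` transfer t -` A) \<partial>?\<nu>)"
    proof (rule nn_integral_cong)
      fix w
      have "(\<lambda>ws. indicator A (?S w ** transfer t ws)) = (indicator (Cons w -` transfer t -` A) :: _ \<Rightarrow> ennreal)"
        by (auto simp: fun_eq_iff indicator_def)
      thus "(\<integral>\<^sup>+ws. indicator A (?S w ** transfer t ws) \<partial>replicate_pmf n ?\<nu>)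
          = emeasure (measure_pmf (replicate_pmf n ?\<nu>)) (Cons w -` transfer t -` A)"
        by simp
    qed
    also have "\<dots> = emeasure (measure_pmf (replicate_pmf (Suc n) ?\<nu>)) (transfer t -` A)"
      unfolding replicate_pmf_Suc_pair emeasure_map_pmf emeasure_pair_pmf
      by (simp add: vimage_def)
    also have "\<dots> = emeasure (distr (measure_pmf (replicate_pmf (Suc n) ?\<nu>)) borel (transfer t)) A"
      using A by (subst emeasure_distr) auto
    finally show "emeasure (convolution_power (schroedinger_measure p v t) (Suc n)) A
      = emeasure (distr (measure_pmf (replicate_pmf (Suc n) ?\<nu>)) borel (transfer t)) A" .
  qed (simp add: mult_convolution_def)
qed

text \<open>Since \<open>\<psi> r \<ge> r\<close>, a finite \<open>\<psi>\<close>-moment at the single energy \<open>0\<close> bounds the logarithmic moment.\<close>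

lemma potential_log_moment:
  assumes p: "\<forall>n\<ge>1. p n > 0" "(\<lambda>n. p (Suc n)) sums 1"
    and \<psi>: "\<forall>r>1. r \<le> \<psi> r" and fin: "moment \<psi> (schroedinger_measure p v 0) < \<infinity>"
  shows "log_moment_pmf (potential_pmf p v)"
proof
  let ?\<nu> = "potential_pmf p v" and ?S = "\<lambda>w. schroedinger (of_real w)"
  let ?h = "\<lambda>g. ennreal (ln (op_norm g)) * indicator {g. ln (op_norm g) > 1} g"
  have "(\<integral>\<^sup>+g. ?h g \<partial>schroedinger_measure p v 0) \<le> moment \<psi> (schroedinger_measure p v 0)"
    unfolding moment_def using \<psi>
    by (intro nn_integral_mono) (auto simp: indicator_def intro!: ennreal_leI)
  hence "(\<integral>\<^sup>+g. ?h g \<partial>schroedinger_measure p v 0) < \<infinity>" using fin by (rule le_less_trans)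
  moreover have "(\<integral>\<^sup>+g. ?h g \<partial>schroedinger_measure p v 0) = (\<integral>\<^sup>+w. ?h (?S w) \<partial>?\<nu>)"
    unfolding schroedinger_measure_eq_distr[OF p] by (subst nn_integral_distr) auto
  ultimately have finite: "(\<integral>\<^sup>+w. 2 + ?h (?S w) \<partial>?\<nu>) < \<infinity>"
    by (subst nn_integral_add) auto
  have "ennreal (norm (ln (1 + \<bar>w\<bar>))) \<le> 2 + ?h (?S w)" for w
  proof -
    let ?o = "op_norm (?S w)"
    have w: "\<bar>w\<bar> \<le> ?o"
      using op_norm_ge_entry[of "?S w" 1 1] by (simp add: schroedinger_def)
    have o1: "1 \<le> ?o"
      using op_norm_ge_entry[of "?S w" 2 1] by (simp add: schroedinger_def)
    have "ln (1 + \<bar>w\<bar>) \<le> ln (2 * ?o)" using w o1 by (intro ln_mono) auto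
    also have "\<dots> = ln 2 + ln ?o" using o1 by (intro ln_mult_pos) auto
    also have "ln 2 \<le> (1::real)" using ln_2_less_1 by simp
    finally have ln: "ln (1 + \<bar>w\<bar>) \<le> 1 + ln ?o" by simp
    show ?thesis
    proof (cases "ln ?o > 1")
      case True
      have "ennreal (ln (1 + \<bar>w\<bar>)) \<le> ennreal (2 + ln ?o)" using ln by (intro ennreal_leI) simp
      also have "\<dots> = 2 + ennreal (ln ?o)" using True by (subst ennreal_plus) auto
      finally show ?thesis using True by simp
    next
      case False
      hence "ennreal (ln (1 + \<bar>w\<bar>)) \<le> ennreal 2" using ln by (intro ennreal_leI) simp
      thus ?thesis using False by simp
    qed
  qed
  hence "(\<integral>\<^sup>+w. ennreal (norm (ln (1 + \<bar>w\<bar>))) \<partial>?\<nu>) \<le> (\<integral>\<^sup>+w. 2 + ?h (?S w) \<partial>?\<nu>)"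
    by (intro nn_integral_mono)
  thus "integrable (measure_pmf ?\<nu>) (\<lambda>w. ln (1 + \<bar>w\<bar>))"
    using finite by (intro integrableI_bounded) auto
qed

lemma lyapunov_exponent_eq:
  assumes p: "\<forall>n\<ge>1. p n > 0" "(\<lambda>n. p (Suc n)) sums 1"
    and "log_moment_pmf (potential_pmf p v)"
  shows "lyapunov_exponent (schroedinger_measure p v (of_real E)) = log_moment_pmf.lyap (potential_pmf p v) E"
proof -
  interpret log_moment_pmf "potential_pmf p v" by fact
  have "(\<integral>g. ln (op_norm g) \<partial>convolution_power (schroedinger_measure p v (of_real E)) n) = mean_log_norm n (of_real E)" for n
    unfolding convolution_power_eq_distr[OF p] mean_log_norm_def by (subst integral_distr) auto
  thus ?thesis unfolding lyapunov_exponent_def lyap_def by (simp add: mult.commute divide_inverse)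
qed

section \<open>The Lyapunov exponent is not constant\<close>

text \<open>The modulus of the profile \<open>exp (\<alpha> * r)\<close> is the power \<open>2 * \<alpha>\<close>. When it exceeds \<open>1\<close>, all
derivatives vanish.\<close>

lemma local_power_modulus_constant:
  fixes f :: "real \<Rightarrow> real"
  assumes f: "has_local_modulus (profile_modulus 2 \<phi>) f" and \<phi>: "\<forall>r>1. \<phi> r = exp (\<alpha> * r)" and \<alpha>: "1 / 2 < \<alpha>"
  shows "f x = f y"
proof -
  have "(f has_real_derivative 0) (at a)" for a
  proof -
    obtain \<rho> C where \<rho>: "0 < \<rho>" and
      C: "\<And>x y. dist x a < \<rho> \<Longrightarrow> dist y a < \<rho> \<Longrightarrow> \<bar>f x - f y\<bar> \<le> C * profile_modulus 2 \<phi> (dist x y)"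
      using f unfolding has_local_modulus_def by blast
    have "((\<lambda>h. (f (a + h) - f a) / h) \<longlongrightarrow> 0) (at 0)"
    proof (rule Lim_null_comparison)
      have "\<forall>\<^sub>F h in at (0::real). h \<noteq> 0 \<and> \<bar>h\<bar> < min \<rho> (exp (- 1))"
        using \<rho> by (auto simp: eventually_at intro!: exI[of _ "min \<rho> (exp (- 1))"])
      thus "\<forall>\<^sub>F h in at 0. norm ((f (a + h) - f a) / h) \<le> \<bar>C\<bar> * \<bar>h\<bar> powr (2 * \<alpha> - 1)"
      proof eventually_elim
        case (elim h)
        hence h: "0 < \<bar>h\<bar>" "\<bar>h\<bar> < \<rho>" "\<bar>h\<bar> < exp (- 1)" by auto
        have "ln \<bar>h\<bar> < - 1" using h ln_less_cancel_iff[of "\<bar>h\<bar>" "exp (- 1)"] by simp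
        hence "profile_modulus 2 \<phi> \<bar>h\<bar> = exp (\<alpha> * (- ln \<bar>h\<bar>)) powr (- 2)"
          using \<phi> h(1) by (simp add: profile_modulus_def ln_div)
        also have "\<dots> = \<bar>h\<bar> powr (2 * \<alpha>)" using h(1) by (simp add: powr_def)
        finally have mod: "profile_modulus 2 \<phi> \<bar>h\<bar> = \<bar>h\<bar> powr (2 * \<alpha>)" .
        have "\<bar>f (a + h) - f a\<bar> \<le> C * profile_modulus 2 \<phi> (dist (a + h) a)"
          using \<rho> h by (intro C) (auto simp: dist_real_def)
        also have "\<dots> = C * \<bar>h\<bar> powr (2 * \<alpha>)" by (simp add: dist_real_def mod)
        also have "\<dots> \<le> \<bar>C\<bar> * \<bar>h\<bar> powr (2 * \<alpha>)" by (intro mult_right_mono) auto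
        finally have "\<bar>f (a + h) - f a\<bar> / \<bar>h\<bar> \<le> \<bar>C\<bar> * \<bar>h\<bar> powr (2 * \<alpha>) / \<bar>h\<bar>"
          by (intro divide_right_mono) auto
        also have "\<dots> = \<bar>C\<bar> * \<bar>h\<bar> powr (2 * \<alpha> - 1)" using h(1) by (simp add: powr_diff)
        finally show ?case by simp
      qed
      have "((\<lambda>h. \<bar>C\<bar> * \<bar>h\<bar> powr (2 * \<alpha> - 1)) \<longlongrightarrow> \<bar>C\<bar> * \<bar>0\<bar> powr (2 * \<alpha> - 1)) (at 0)"
        using \<alpha> by (intro tendsto_intros tendsto_powr' ) auto
      thus "((\<lambda>h. \<bar>C\<bar> * \<bar>h\<bar> powr (2 * \<alpha> - 1)) \<longlongrightarrow> 0) (at 0)" by simp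
    qed
    thus ?thesis by (simp add: DERIV_def)
  qed
  thus ?thesis using DERIV_isconst_all by blast
qed

lemma strictly_increasing_from_gaps:
  fixes v :: "nat \<Rightarrow> real"
  assumes "\<forall>n\<ge>1. v (n + 1) - v n > 4" "1 \<le> m" "m \<le> n"
  shows "v m \<le> v n"
  using assms(3)
proof (induction rule: dec_induct)
  case (step k)
  thus ?case using assms(1)[rule_format, of k] assms(2) by simp
qed simp

text \<open>At distance \<open>g\<close> from all values of the potential, the exponent is at least \<open>ln (g - 1)\<close>, and the gaps
provide energies with \<open>g\<close> as large as desired.\<close>

lemma lyap_not_constant:
  fixes p v :: "nat \<Rightarrow> real"
  assumes lm: "log_moment_pmf (potential_pmf p v)"
    and v: "\<forall>n\<ge>1. v n > 0 \<and> v (n + 1) - v n > 4"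
    and gaps: "filterlim (\<lambda>n. v n - v (n - 1)) at_top sequentially"
  shows "\<exists>x y. log_moment_pmf.lyap (potential_pmf p v) x \<noteq> log_moment_pmf.lyap (potential_pmf p v) y"
proof -
  interpret log_moment_pmf "potential_pmf p v" by fact
  \<comment> \<open>With this distance, \<open>ln (g - 1)\<close> exceeds the value at \<open>0\<close>.\<close>
  define g where "g = exp (lyap 0) + 2"
  have "\<forall>\<^sub>F n in sequentially. 2 * g \<le> v n - v (n - 1)"
    using gaps by (simp add: filterlim_at_top)
  then obtain N where N: "\<And>n. N \<le> n \<Longrightarrow> 2 * g \<le> v n - v (n - 1)"
    by (auto simp: eventually_sequentially)
  define m where "m = Suc N"
  have G: "2 * g \<le> v (Suc m) - v m" using N[of "Suc m"] by (simp add: m_def)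
  have mono: "v i \<le> v j" if "1 \<le> i" "i \<le> j" for i j
    by (rule strictly_increasing_from_gaps[of v]) (use v that in auto)
  define E where "E = v m + g"
  have g0: "0 < g" by (simp add: g_def add_pos_pos)
  have "g \<le> \<bar>w - E\<bar>" if "w \<in> set_pmf (potential_pmf p v)" for w
  proof -
    from set_potential_pmf[OF that] obtain k where k: "1 \<le> k" "w = v k \<or> w = - v k" by blast
    have "0 < v k" "0 < v m" using v k by (auto simp: m_def)
    moreover have "v k \<le> v m \<or> v (Suc m) \<le> v k"
      using mono[of k m] mono[of "Suc m" k] k(1) by (cases "k \<le> m") auto
    ultimately show ?thesis using k(2) G g0 by (auto simp: E_def abs_if)
  qed
  hence "ln (g - 1) \<le> lyap E" by (intro lyap_ge) (simp_all add: g_def)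
  moreover have "lyap 0 < ln (g - 1)"
    using ln_less_cancel_iff[of "exp (lyap 0)" "g - 1"] by (simp add: g_def add_pos_pos)
  ultimately have "lyap 0 \<noteq> lyap E" by linarith
  thus ?thesis by blast
qed

section \<open>Failure of regularity\<close>

text \<open>The interplay of frequency of resonances and regularity, with constants that are independent of \<open>n\<close>. The scales
\<open>R\<close> and \<open>s\<close> remain free, because the two kinds of profile need different choices.\<close>

lemma resonance_inequality:
  fixes p v :: "nat \<Rightarrow> real"
  assumes p: "\<forall>n\<ge>1. p n > 0" "(\<lambda>n. p (Suc n)) sums 1"
    and gap: "v 2 - v 1 > 4"
    and lm: "log_moment_pmf (potential_pmf p v)"
  defines "L \<equiv> log_moment_pmf.lyap (potential_pmf p v)"
  obtains c K M where "0 < c" "1 \<le> K" "0 \<le> M"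
    "\<And>n R s B. 1 \<le> n \<Longrightarrow> K \<le> v n \<Longrightarrow> K \<le> R * (v n)\<^sup>2 \<Longrightarrow> R \<le> 1 \<Longrightarrow> 0 < s \<Longrightarrow> s \<le> 1 \<Longrightarrow>
       (\<And>x. \<bar>x - v 1\<bar> < s \<Longrightarrow> \<bar>L x - L (v 1)\<bar> \<le> B) \<Longrightarrow>
       c * (p n)\<^sup>2 * ln (R * (v n)\<^sup>2 / K) \<le> 2 * B + M * R / s"
proof -
  let ?\<nu> = "potential_pmf p v"
  interpret log_moment_pmf ?\<nu> by fact
  define \<delta> where "\<delta> = min (p 1 / 2) (p 2 / 2)"
  have p1: "0 < p 1" "0 < p 2" using p(1)[rule_format, of 1] p(1)[rule_format, of 2] by simp_all
  hence \<delta>: "0 < \<delta>" by (simp add: \<delta>_def)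
  have b: "4 \<le> \<bar>v 1 - v 2\<bar>" "\<delta> \<le> pmf ?\<nu> (v 1)" "\<delta> \<le> pmf ?\<nu> (v 2)" "0 \<le> \<delta>"
    using gap \<delta> pmf_potential_pmf_ge(1)[OF p, of 1 v] pmf_potential_pmf_ge(1)[OF p, of 2 v]
    by (auto simp: \<delta>_def)
  define K0 where "K0 = 2 * (\<bar>v 1\<bar> + 1) + 1"
  define A where "A = ln 2 + log_mean + ln (1 + \<bar>v 1\<bar>) + 4"
  have K0: "0 \<le> K0" by (simp add: K0_def)
  have A: "0 \<le> A" using log_mean_nonneg by (simp add: A_def)
  define c where "c = pmf ?\<nu> (v 1) * \<delta>\<^sup>2 / 4"
  have pa: "0 < pmf ?\<nu> (v 1)" using b(2) \<delta> by linarith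
  show ?thesis
  proof (rule that[of c "2 * K0 + 1" "16 * A"])
    show "0 < c" using pa \<delta> by (simp add: c_def)
    fix n R s B
    assume n: "1 \<le> n" and V: "2 * K0 + 1 \<le> v n" and R: "2 * K0 + 1 \<le> R * (v n)\<^sup>2" "R \<le> 1"
      and s: "0 < s" "s \<le> 1" and near: "\<And>x. \<bar>x - v 1\<bar> < s \<Longrightarrow> \<bar>L x - L (v 1)\<bar> \<le> B"
    let ?ln = "ln (R * (v n)\<^sup>2 / (2 * K0 + 1))"
    have ln0: "0 \<le> ?ln" using R(1) K0 by (intro ln_ge_zero) (simp add: le_divide_eq)
    have pn: "0 < p n" using p(1) n by simp
    have "c * (p n)\<^sup>2 = pmf ?\<nu> (v 1) * (p n / 2 * \<delta>) * (p n / 2 * \<delta>)"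
      by (simp add: c_def power2_eq_square)
    also have "\<dots> \<le> pmf ?\<nu> (v 1) * (pmf ?\<nu> (v n) * \<delta>) * (pmf ?\<nu> (- v n) * \<delta>)"
      using pmf_potential_pmf_ge[OF p n, of v] pn \<delta>
      by (intro mult_mono mult_nonneg_nonneg) auto
    finally have "c * (p n)\<^sup>2 * ?ln \<le> pmf ?\<nu> (v 1) * (pmf ?\<nu> (v n) * \<delta>) * (pmf ?\<nu> (- v n) * \<delta>) * ?ln"
      by (rule mult_right_mono[OF _ ln0])
    also have "\<dots> \<le> 2 * B + 16 * A * R / s"
      using resonance_lower_bound[of "v 1" "v n" R s "v 1" "v 2" \<delta> B, folded K0_def A_def L_def, OF _ R s b near]
        V K0 by simp
    finally show "c * (p n)\<^sup>2 * ?ln \<le> 2 * B + 16 * A * R / s" .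
  qed (use K0 A in auto)
qed

lemma profile_modulus_bound:
  assumes \<phi>: "moment_profile \<phi>" and V: "exp 1 < V" and d: "0 < d" "d < 1 / V"
  shows "profile_modulus 2 \<phi> d \<le> 1 / (\<phi> (ln V))\<^sup>2"
proof -
  have V0: "0 < V" using V exp_gt_zero[of "1::real"] by linarith
  have "1 < ln V" using V V0 ln_less_cancel_iff[of "exp 1" V] by simp
  moreover have "ln V < ln (1 / d)" using d V0 by (subst ln_less_cancel_iff) (auto simp: field_simps)
  ultimately have "\<phi> (ln V) < \<phi> (ln (1 / d))" "0 < \<phi> (ln V)"
    using \<phi> by (auto simp: moment_profile_def strict_mono_on_def)
  hence "\<phi> (ln (1 / d)) powr (- 2) \<le> \<phi> (ln V) powr (- 2)" by (intro powr_mono2') auto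
  also have "\<dots> = 1 / (\<phi> (ln V))\<^sup>2"
    using \<open>0 < \<phi> (ln V)\<close> by (simp add: powr_minus divide_inverse)
  finally show ?thesis using d by (simp add: profile_modulus_def)
qed

text \<open>The growth condition on \<open>\<phi>\<close> makes the tail term, of order \<open>1 / v n\<close>, at most of the order of the modulus
\<open>1 / (\<phi> (ln (v n)))\<^sup>2\<close> itself.\<close>

lemma no_local_profile_modulus:
  fixes p v :: "nat \<Rightarrow> real"
  assumes p: "\<forall>n\<ge>1. p n > 0" "(\<lambda>n. p (Suc n)) sums 1"
    and gap: "v 2 - v 1 > 4" and vlim: "filterlim v at_top sequentially"
    and lm: "log_moment_pmf (potential_pmf p v)"
    and \<phi>: "moment_profile \<phi>" and slow: "\<forall>\<^sub>F x in at_top. (\<phi> (ln x))\<^sup>2 \<le> x"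
    and lim: "filterlim (\<lambda>n. p n * \<phi> (ln (v n))) at_top sequentially"
  shows "\<not> has_local_modulus (profile_modulus 2 \<phi>) (log_moment_pmf.lyap (potential_pmf p v))"
proof
  let ?L = "log_moment_pmf.lyap (potential_pmf p v)"
  assume "has_local_modulus (profile_modulus 2 \<phi>) ?L"
  then obtain \<rho> C where \<rho>: "0 < \<rho>" and
    C: "\<And>x y. dist x (v 1) < \<rho> \<Longrightarrow> dist y (v 1) < \<rho> \<Longrightarrow> \<bar>?L x - ?L y\<bar> \<le> C * profile_modulus 2 \<phi> (dist x y)"
    unfolding has_local_modulus_def by blast
  obtain c K M where c: "0 < c" and K: "1 \<le> K" and M: "0 \<le> M" and
    res: "\<And>n R s B. 1 \<le> n \<Longrightarrow> K \<le> v n \<Longrightarrow> K \<le> R * (v n)\<^sup>2 \<Longrightarrow> R \<le> 1 \<Longrightarrow> 0 < s \<Longrightarrow> s \<le> 1 \<Longrightarrow>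
       (\<And>x. \<bar>x - v 1\<bar> < s \<Longrightarrow> \<bar>?L x - ?L (v 1)\<bar> \<le> B) \<Longrightarrow>
       c * (p n)\<^sup>2 * ln (R * (v n)\<^sup>2 / K) \<le> 2 * B + M * R / s"
    using resonance_inequality[OF p gap lm] by blast
  define D where "D = 2 * \<bar>C\<bar> + M * (K * exp 1)"
  have D: "0 \<le> D" using M K by (simp add: D_def)
  have "\<forall>\<^sub>F n in sequentially. D / c + 1 \<le> p n * \<phi> (ln (v n))"
    using lim by (simp add: filterlim_at_top)
  moreover have "\<forall>\<^sub>F n in sequentially. (\<phi> (ln (v n)))\<^sup>2 \<le> v n"
    using slow vlim by (rule eventually_compose_filterlim)
  moreover have "\<forall>\<^sub>F n in sequentially. K * exp 1 + exp 1 + 1 / \<rho> + 1 < v n"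
    using vlim by (simp add: filterlim_at_top_dense)
  ultimately have "\<forall>\<^sub>F n in sequentially. False"
    using eventually_ge_at_top[of 1]
  proof eventually_elim
    case (elim n)
    define V where "V = v n"
    have exp1: "1 \<le> exp (1::real)" by simp
    have Ke: "K \<le> K * exp 1" using K exp1 by simp
    have V: "K * exp 1 < V" "exp 1 < V" "1 / \<rho> < V" "1 < V"
      using elim(3) K \<rho> Ke exp1 zero_less_divide_1_iff[of \<rho>] unfolding V_def by linarith+
    define B where "B = \<bar>C\<bar> / (\<phi> (ln V))\<^sup>2"
    have "1 < ln V" using V(2,4) ln_less_cancel_iff[of "exp 1" V] by simp
    hence phi0: "0 < \<phi> (ln V)" using \<phi> by (simp add: moment_profile_def)
    have near: "\<bar>?L x - ?L (v 1)\<bar> \<le> B" if x: "\<bar>x - v 1\<bar> < 1 / V" for x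
    proof (cases "x = v 1")
      case True thus ?thesis by (simp add: B_def)
    next
      case False
      have "1 / V < \<rho>" using V(3,4) \<rho> by (simp add: field_simps)
      hence "\<bar>?L x - ?L (v 1)\<bar> \<le> C * profile_modulus 2 \<phi> (dist x (v 1))"
        using x \<rho> by (intro C) (auto simp: dist_real_def)
      also have "\<dots> \<le> \<bar>C\<bar> * profile_modulus 2 \<phi> \<bar>x - v 1\<bar>"
        using False by (simp add: dist_real_def profile_modulus_def mult_right_mono)
      also have "\<dots> \<le> \<bar>C\<bar> * (1 / (\<phi> (ln V))\<^sup>2)"
        using False x by (intro mult_left_mono profile_modulus_bound[OF \<phi> V(2)]) auto
      finally show ?thesis by (simp add: B_def)
    qed
    \<comment> \<open>The height at which the logarithmic gain equals exactly \<open>1\<close>.\<close>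
    define R where "R = K * exp 1 / V\<^sup>2"
    have RV: "R * V\<^sup>2 = K * exp 1" using V(4) by (simp add: R_def)
    have "V * 1 \<le> V * V" using V(4) by (intro mult_left_mono) auto
    hence "K * exp 1 \<le> V\<^sup>2" using V(1) by (simp add: power2_eq_square)
    hence R1: "R \<le> 1" using V(4) by (simp add: R_def)
    have "c * (p n)\<^sup>2 * ln (R * V\<^sup>2 / K) \<le> 2 * B + M * R / (1 / V)"
      unfolding V_def
      by (rule res) (use elim(4) V Ke R1 RV near in \<open>auto simp: V_def\<close>)
    also have "ln (R * V\<^sup>2 / K) = 1" unfolding RV using K by simp
    also have "M * R / (1 / V) = M * (K * exp 1) * (1 / V)"
      using V(4) by (simp add: R_def power2_eq_square)
    also have "\<dots> \<le> M * (K * exp 1) * (1 / (\<phi> (ln V))\<^sup>2)"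
      using elim(2) phi0 M K V(4) unfolding V_def by (intro mult_left_mono divide_left_mono) auto
    finally have "c * (p n)\<^sup>2 \<le> D * (1 / (\<phi> (ln V))\<^sup>2)"
      by (simp add: B_def D_def algebra_simps add_divide_distrib)
    hence le: "c * (p n * \<phi> (ln V))\<^sup>2 \<le> D"
      using phi0 by (simp add: field_simps)
    have Dc: "0 \<le> D / c" using D c by simp
    have "D / c < (D / c + 1) * 1" by simp
    also have "\<dots> \<le> (D / c + 1) * (D / c + 1)" using Dc by (intro mult_left_mono) auto
    also have "\<dots> \<le> (p n * \<phi> (ln V)) * (p n * \<phi> (ln V))"
      using elim(1) Dc unfolding V_def by (intro mult_mono) auto
    finally have "D < c * (p n * \<phi> (ln V))\<^sup>2"
      using c by (simp add: power2_eq_square field_simps)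
    with le show False by simp
  qed
  thus False by simp
qed

text \<open>A logarithmic modulus hardly notices that \<open>s\<close> is a power of \<open>1 / v n\<close>. There is thus room for a
height \<open>R\<close> far above the width of the resonance, and the gain \<open>ln (R * (v n)\<^sup>2 / K)\<close> is of order \<open>ln (v n)\<close>.\<close>

lemma no_local_log_modulus:
  fixes p v :: "nat \<Rightarrow> real"
  assumes p: "\<forall>n\<ge>1. p n > 0" "(\<lambda>n. p (Suc n)) sums 1"
    and gap: "v 2 - v 1 > 4" and vlim: "filterlim v at_top sequentially"
    and lm: "log_moment_pmf (potential_pmf p v)" and q: "1 < q"
    and lim: "filterlim (\<lambda>n. p n * ln (v n) powr q) at_top sequentially"
  shows "\<not> locally_log_Hoelder (2 * q - 1) (log_moment_pmf.lyap (potential_pmf p v))"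
proof
  let ?L = "log_moment_pmf.lyap (potential_pmf p v)"
  define \<gamma> where "\<gamma> = 2 * q - 1"
  have \<gamma>: "0 < \<gamma>" using q by (simp add: \<gamma>_def)
  assume "locally_log_Hoelder (2 * q - 1) ?L"
  then obtain \<rho> C where \<rho>: "0 < \<rho>" and
    C: "\<And>x y. dist x (v 1) < \<rho> \<Longrightarrow> dist y (v 1) < \<rho> \<Longrightarrow>
      \<bar>?L x - ?L y\<bar> \<le> C * (if dist x y = 0 then 0 else ln (1 / dist x y) powr (- \<gamma>))"
    unfolding locally_log_Hoelder_def has_local_modulus_def \<gamma>_def by blast
  obtain c K M where c: "0 < c" and K: "1 \<le> K" and M: "0 \<le> M" and
    res: "\<And>n R s B. 1 \<le> n \<Longrightarrow> K \<le> v n \<Longrightarrow> K \<le> R * (v n)\<^sup>2 \<Longrightarrow> R \<le> 1 \<Longrightarrow> 0 < s \<Longrightarrow> s \<le> 1 \<Longrightarrow>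
       (\<And>x. \<bar>x - v 1\<bar> < s \<Longrightarrow> \<bar>?L x - ?L (v 1)\<bar> \<le> B) \<Longrightarrow>
       c * (p n)\<^sup>2 * ln (R * (v n)\<^sup>2 / K) \<le> 2 * B + M * R / s"
    using resonance_inequality[OF p gap lm] by blast
  define D where "D = 2 * \<bar>C\<bar> * 2 powr \<gamma> + M"
  have D: "0 \<le> D" using M by (simp add: D_def)
  have "((\<lambda>x. x powr (- 1 / 2) * ln x powr \<gamma>) \<longlongrightarrow> 0) at_top" by real_asymp
  hence "\<forall>\<^sub>F x in at_top. x powr (- 1 / 2) * ln x powr \<gamma> < 1"
    by (rule order_tendstoD) simp
  hence small: "\<forall>\<^sub>F n in sequentially. v n powr (- 1 / 2) * ln (v n) powr \<gamma> < 1"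
    using vlim by (rule eventually_compose_filterlim)
  have "((\<lambda>x::real. x powr (- 1 / 2)) \<longlongrightarrow> 0) at_top" by real_asymp
  hence "\<forall>\<^sub>F x::real in at_top. x powr (- 1 / 2) < \<rho>" using \<rho> by (rule order_tendstoD)
  hence small': "\<forall>\<^sub>F n in sequentially. v n powr (- 1 / 2) < \<rho>"
    using vlim by (rule eventually_compose_filterlim)
  have "\<forall>\<^sub>F n in sequentially. 2 * D / c + 1 \<le> p n * ln (v n) powr q"
    using lim by (simp add: filterlim_at_top)
  moreover have "\<forall>\<^sub>F n in sequentially. K\<^sup>2 + 1 < v n"
    using vlim by (simp add: filterlim_at_top_dense)
  ultimately have "\<forall>\<^sub>F n in sequentially. False"
    using eventually_ge_at_top[of 1] small small'
  proof eventually_elim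
    case (elim n)
    define V where "V = v n"
    \<comment> \<open>\<open>V > K\<^sup>2\<close> ensures \<open>ln (V / K) \<ge> ln V / 2\<close>.\<close>
    have KK: "K \<le> K\<^sup>2" using K by (simp add: power2_eq_square)
    have V: "K\<^sup>2 < V" "K < V" "1 < V" using elim(2) KK K unfolding V_def by linarith+
    have lnV: "0 < ln V" using V(3) by simp
    \<comment> \<open>The geometric mean of \<open>1\<close> and \<open>R = 1 / V\<close>, so that the tail term \<open>M * R / s = M * s\<close> stays negligible.\<close>
    define s where "s = V powr (- 1 / 2)"
    have "V powr (- 1 / 2) \<le> V powr 0" using V(3) by (intro powr_mono) auto
    hence s: "0 < s" "s \<le> 1" "s < \<rho>"
      using V(3) elim(5) by (simp_all add: s_def V_def)
    have ln_s: "ln (1 / s) = ln V / 2" using V(3) by (simp add: s_def ln_div ln_powr)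
    define B where "B = \<bar>C\<bar> * (ln V / 2) powr (- \<gamma>)"
    have near: "\<bar>?L x - ?L (v 1)\<bar> \<le> B" if x: "\<bar>x - v 1\<bar> < s" for x
    proof (cases "x = v 1")
      case True thus ?thesis by (simp add: B_def)
    next
      case False
      have "\<bar>?L x - ?L (v 1)\<bar> \<le> C * (if dist x (v 1) = 0 then 0 else ln (1 / dist x (v 1)) powr (- \<gamma>))"
        using x s(3) \<rho> by (intro C) (auto simp: dist_real_def)
      also have "\<dots> \<le> \<bar>C\<bar> * ln (1 / \<bar>x - v 1\<bar>) powr (- \<gamma>)"
        using False by (simp add: dist_real_def mult_right_mono)
      also have "\<dots> \<le> \<bar>C\<bar> * (ln V / 2) powr (- \<gamma>)"
      proof (intro mult_left_mono powr_mono2')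
        have "ln (1 / s) \<le> ln (1 / \<bar>x - v 1\<bar>)"
          using x False s by (subst ln_le_cancel_iff) (auto intro!: divide_left_mono)
        thus "ln V / 2 \<le> ln (1 / \<bar>x - v 1\<bar>)" by (simp only: ln_s)
      qed (use lnV \<gamma> in auto)
      finally show ?thesis by (simp add: B_def)
    qed
    have "c * (p n)\<^sup>2 * ln (1 / V * V\<^sup>2 / K) \<le> 2 * B + M * (1 / V) / s"
      unfolding V_def
      by (rule res) (use elim(3) V K s near in \<open>auto simp: V_def power2_eq_square\<close>)
    also have "1 / V * V\<^sup>2 / K = V / K" using V(3) by (simp add: power2_eq_square)
    also have "M * (1 / V) / s = M * s"
    proof -
      have "s * s = 1 / V" using V(3) by (simp add: s_def powr_add[symmetric] powr_minus_divide)
      thus ?thesis using s(1) by (metis nonzero_mult_div_cancel_right mult.assoc less_irrefl)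
    qed
    finally have main: "c * (p n)\<^sup>2 * ln (V / K) \<le> 2 * B + M * s" .
    have "ln K \<le> ln V / 2"
    proof -
      have "ln (K\<^sup>2) \<le> ln V" using V(1) K by (intro ln_mono) auto
      thus ?thesis using K by (simp add: ln_realpow)
    qed
    hence "ln V / 2 \<le> ln (V / K)" using V(3) K by (simp add: ln_div)
    hence "c * (p n)\<^sup>2 * (ln V / 2) \<le> c * (p n)\<^sup>2 * ln (V / K)"
      using c by (intro mult_left_mono) auto
    with main have "c * (p n)\<^sup>2 * (ln V / 2) \<le> 2 * B + M * s" by linarith
    hence "c * (p n)\<^sup>2 * (ln V / 2) * ln V powr \<gamma> \<le> (2 * B + M * s) * ln V powr \<gamma>"
      by (rule mult_right_mono) simp
    also have "\<dots> = 2 * \<bar>C\<bar> * 2 powr \<gamma> + M * (s * ln V powr \<gamma>)"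
    proof -
      have "(ln V / 2) powr (- \<gamma>) * ln V powr \<gamma> = 2 powr \<gamma>"
        using lnV by (simp add: powr_divide powr_minus field_simps)
      thus ?thesis by (simp add: B_def algebra_simps)
    qed
    also have "\<dots> \<le> D"
      using mult_left_mono[OF less_imp_le[OF elim(4)] M] by (simp add: D_def s_def V_def)
    also have "c * (p n)\<^sup>2 * (ln V / 2) * ln V powr \<gamma> = c / 2 * (p n * ln V powr q)\<^sup>2"
    proof -
      have "ln V * ln V powr \<gamma> = ln V powr (1 + \<gamma>)" using lnV by (simp add: powr_add)
      also have "\<dots> = (ln V powr q)\<^sup>2" by (simp add: \<gamma>_def power2_eq_square powr_add[symmetric])
      finally show ?thesis by (simp add: power_mult_distrib)
    qed
    finally have le: "c / 2 * (p n * ln V powr q)\<^sup>2 \<le> D" .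
    have Dc: "0 \<le> 2 * D / c" using D c by simp
    have "2 * D / c < (2 * D / c + 1) * 1" by simp
    also have "\<dots> \<le> (2 * D / c + 1) * (2 * D / c + 1)" using Dc by (intro mult_left_mono) auto
    also have "\<dots> \<le> (p n * ln V powr q) * (p n * ln V powr q)"
      using elim(1) Dc unfolding V_def by (intro mult_mono) auto
    finally have "D < c / 2 * (p n * ln V powr q)\<^sup>2"
      using c by (simp add: power2_eq_square field_simps)
    with le show False by simp
  qed
  thus False by simp
qed

theorem corollary2p2:
  fixes \<phi> \<psi> :: "real \<Rightarrow> real" and p v :: "nat \<Rightarrow> real"
  assumes "moment_profile \<phi>" and "moment_profile \<psi>"
    and "\<forall>r>1. r \<le> \<psi> r \<and> \<psi> r \<le> \<phi> r"
    and "\<forall>n\<ge>1. p n > 0"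
    and "(\<lambda>n. p (Suc n)) sums 1"
    and "0 < limsup (\<lambda>n. ereal (p (n - 1) / p n))"
    and "limsup (\<lambda>n. ereal (p (n - 1) / p n)) \<le> 1"
    and "\<forall>n\<ge>1. v n > 0 \<and> v (n + 1) - v n > 4"
    and "filterlim v at_top sequentially"
    and "filterlim (\<lambda>n. v n - v (n - 1)) at_top sequentially"
    and "\<forall>m>0::real. (SUP t\<in>{t. cmod t \<le> m}. moment \<psi> (schroedinger_measure p v t)) < \<infinity>"
    and "filterlim (\<lambda>n. p n * \<phi> (ln (v n))) at_top sequentially"
  shows "(exponential_profile \<phi> \<or> subexponential_profile \<phi> \<longrightarrow>
            \<not> has_local_modulus (profile_modulus 2 \<phi>)
               (\<lambda>E::real. lyapunov_exponent (schroedinger_measure p v (of_real E)))) \<and>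
         (\<forall>q>1. (\<forall>r>1. \<phi> r = r powr q) \<longrightarrow>
            \<not> locally_log_Hoelder (2 * q - 1)
               (\<lambda>E::real. lyapunov_exponent (schroedinger_measure p v (of_real E))))"
proof -
  note p = assms(4,5)
  have "moment \<psi> (schroedinger_measure p v 0)
      \<le> (SUP t\<in>{t. cmod t \<le> 1}. moment \<psi> (schroedinger_measure p v t))"
    by (rule SUP_upper) simp
  also have "\<dots> < \<infinity>" using assms(11) by simp
  finally have lm: "log_moment_pmf (potential_pmf p v)"
    using assms(3) by (intro potential_log_moment[OF p, where \<psi> = \<psi>]) auto
  have L: "(\<lambda>E::real. lyapunov_exponent (schroedinger_measure p v (of_real E)))
      = log_moment_pmf.lyap (potential_pmf p v)"
    using lyapunov_exponent_eq[OF p lm] by auto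
  have gap: "v 2 - v 1 > 4" using assms(8)[rule_format, of 1] by (simp add: numeral_2_eq_2)
  \<comment> \<open>For \<open>\<alpha> > 1 / 2\<close> the tail term of the resonance inequality dominates the modulus, and rigidity is used instead.\<close>
  have steep: "\<not> has_local_modulus (profile_modulus 2 \<phi>) (log_moment_pmf.lyap (potential_pmf p v))"
    if "\<forall>r>1. \<phi> r = exp (\<alpha> * r)" "1 / 2 < \<alpha>" for \<alpha>
    using local_power_modulus_constant[OF _ that] lyap_not_constant[OF lm assms(8,10)] by metis
  have ln_gt: "\<forall>\<^sub>F x::real in at_top. 1 < ln x \<and> 0 < x"
    by (intro eventually_conj) real_asymp+
  note flat = no_local_profile_modulus[OF p gap assms(9) lm assms(1) _ assms(12)]
  have "\<not> has_local_modulus (profile_modulus 2 \<phi>) (log_moment_pmf.lyap (potential_pmf p v))"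
    if profile: "exponential_profile \<phi> \<or> subexponential_profile \<phi>"
  proof -
    consider \<alpha> where "0 < \<alpha>" "\<forall>r>1. \<phi> r = exp (\<alpha> * r)"
      | \<theta> where "0 < \<theta>" "\<theta> < 1" "\<forall>r>1. \<phi> r = exp (r powr \<theta>)"
    proof -
      \<comment> \<open>A sub-exponential profile with \<open>\<theta> = 1\<close> is the exponential one with \<open>\<alpha> = 1\<close>.\<close>
      have "\<exists>\<alpha>>0. \<forall>r>1. \<phi> r = exp (\<alpha> * r)" if "\<forall>r>1. \<phi> r = exp (r powr 1)"
        using that by (intro exI[of _ 1]) auto
      with profile show ?thesis
        using that unfolding exponential_profile_def subexponential_profile_def
        by (metis less_eq_real_def)
    qed
    thus ?thesis
    proof cases
      case (1 \<alpha>)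
      show ?thesis
      proof (cases "1 / 2 < \<alpha>")
        case True
        with 1 steep show ?thesis by blast
      next
        case False
        from ln_gt have "\<forall>\<^sub>F x in at_top. (\<phi> (ln x))\<^sup>2 \<le> x"
        proof eventually_elim
          case (elim x)
          have x: "0 < x" using elim by simp
          have "(\<phi> (ln x))\<^sup>2 = exp (2 * \<alpha> * ln x)"
            using elim 1(2) by (simp add: exp_double[symmetric] mult_ac)
          also have "\<dots> \<le> exp (1 * ln x)"
            unfolding exp_le_cancel_iff using elim False by (intro mult_right_mono) linarith+
          finally show ?case using x by simp
        qed
        thus ?thesis by (rule flat)
      qed
    next
      case (2 \<theta>)
      have "\<forall>\<^sub>F x::real in at_top. exp (2 * ln x powr \<theta>) \<le> x"
        using 2(1,2) by real_asymp
      with ln_gt have "\<forall>\<^sub>F x in at_top. (\<phi> (ln x))\<^sup>2 \<le> x"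
        by eventually_elim (use 2(3) in \<open>simp add: exp_double\<close>)
      thus ?thesis by (rule flat)
    qed
  qed
  moreover have "\<not> locally_log_Hoelder (2 * q - 1) (log_moment_pmf.lyap (potential_pmf p v))"
    if q: "1 < q" "\<forall>r>1. \<phi> r = r powr q" for q
  proof (rule no_local_log_modulus[OF p gap assms(9) lm q(1)])
    have "\<forall>\<^sub>F n in sequentially. 1 < ln (v n) \<and> 0 < v n"
      using ln_gt assms(9) by (rule eventually_compose_filterlim)
    hence "\<forall>\<^sub>F n in sequentially. p n * \<phi> (ln (v n)) = p n * ln (v n) powr q"
      by eventually_elim (use q in simp)
    with assms(12) show "filterlim (\<lambda>n. p n * ln (v n) powr q) at_top sequentially"
      by (simp cong: filterlim_cong)
  qed
  ultimately show ?thesis unfolding L by blast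
qed

end
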